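(* Let $(X,\mu)$ be a standard Borel probability space and let $P:X\to \Pr X$ be a probability kernel which preserves $\mu$. Let $(X^{(-\infty;0]},\tilde{\mu}^-,\tilde{P})$ be the associated random probability-preserving system on the space of past paths, and let $(\hat{X},\hat{\mu},\hat{S})$ be the backwards tail boundary of $(X,\mu,P)$. Then \[\mathrm{h}_{\mathrm{op}}(\mu,P) = \mathrm{h}_{\mathrm{op}}(\tilde{\mu}^-,\tilde{P}) = \mathrm{h}_{\mathrm{KS}}(\hat{\mu},\hat{S})\] (as elements of $[0,\infty]$), where $\mathrm{h}_{\mathrm{op}}$ denotes operator entropy and $\mathrm{h}_{\mathrm{KS}}$ denotes Kolmogorov-Sinai entropy.
   Context: Random p.-p. systems. A random probability-preserving (p.-p.) system is a triple $(X,\mu,P)$ where $(X,\mu)$ is a standard Borel probability space with $\sigma$-algebra $\Sigma_X$, and $P:X\to\Pr X$ is a probability kernel (so $x\mapsto P(x,A)$ is measurable for each $A\in\Sigma_X$) which preserves $\mu$: $\int_X P(x,A)\,\mu(\mathrm{d}x)=\mu(A)$ for all $A\in\Sigma_X$. The kernel acts on bounded measurable functions by $Pf(x)=\int_X f(y)\,P(x,\mathrm{d}y)$. Operator entropy. Let $\lambda$ be Lebesgue measure on $[0,1]$. For a finite family $\mathcal{F}$ of measurable functions $X\to[0,1]$, put $A_f=\{(x,t)\in X\times[0,1] : t\leq f(x)\}$ for $f\in\mathcal{F}$, and let $H_\mu(\mathcal{F})$ be the Shannon entropy, with respect to $\mu\otimes\lambda$, of the common refinement of the two-set partitions $\{A_f,A_f^c\}$,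 $f\in\mathcal{F}$. Define \[\mathrm{h}_{\mathrm{op}}(\mathcal{F},\mu,P)=\limsup_{n\to\infty}\frac1n H_\mu\Big(\bigcup_{k=0}^{n-1}P^k\mathcal{F}\Big),\qquad P^k\mathcal{F}=\{P^kf : f\in\mathcal{F}\},\] and \[\mathrm{h}_{\mathrm{op}}(\mu,P)=\sup_{\mathcal{F}}\mathrm{h}_{\mathrm{op}}(\mathcal{F},\mu,P),\] where $\mathcal{F}$ runs over all finite families of measurable functions $X\to[0,1]$. (Shannon entropy here and in $\mathrm{h}_{\mathrm{KS}}$ uses the same base of logarithm.) Path space. Let $\tilde{\mu}$ be the probability measure on $(X^{\mathbb{Z}},\Sigma_X^{\otimes\mathbb{Z}})$ with finite-dimensional marginals \[\tilde{\mu}(X^{(-\infty;i)}\times A_i\times\cdots\times A_j\times X^{(j;\infty)})=\int_{A_i}\int_{A_{i+1}}\cdots\int_{A_j}P(x_{j-1},\mathrm{d}x_j)\cdots P(x_i,\mathrm{d}x_{i+1})\,\mu(\mathrm{d}x_i)\] for integers $i\leq j$ and $A_i,\dots,A_j\in\Sigma_X$. Here and below intervals such as $(-\infty;0]$ are intervals of integers. Let $S:X^{\mathbb{Z}}\to X^{\mathbb{Z}}$ be the leftward shift, $(Sx)_n=x_{n+1}$, which preserves $\tilde{\mu}$. Past paths. Let $\tilde{\mu}^-$ be the marginal of $\tilde{\mu}$ on $X^{(-\infty;0]}$. The kernel $\tilde{P}$ on $X^{(-\infty;0]}$ is the one which, given $(\dots,x_{-1},x_0)$, draws $y$ from $P(x_0,\cdot)$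 and outputs the path $(\dots,x_{-1},x_0,y)$, now indexed so that $y$ is in coordinate $0$, $x_0$ in coordinate $-1$, and so on. It preserves $\tilde{\mu}^-$, so $(X^{(-\infty;0]},\tilde{\mu}^-,\tilde{P})$ is a random p.-p. system. Backwards tail boundary. For $n\leq 0$ let $\Phi_{\leq n}$ be the $\sigma$-algebra generated by the coordinates $x_k$ with $k\leq n$, and let $\Phi_{-\infty}=\bigcap_{n\leq 0}\Phi_{\leq n}$, regarded as a $\sigma$-subalgebra of $\Sigma_X^{\otimes\mathbb{Z}}$; it is invariant under $S$. The backwards tail boundary $(\hat{X},\hat{\mu},\hat{S})$ is a probability-preserving system on a standard Borel probability space, together with a measurable map $\varphi:X^{\mathbb{Z}}\to\hat{X}$ such that $\varphi_\ast\tilde{\mu}=\hat{\mu}$, $\varphi\circ S=\hat{S}\circ\varphi$ holds $\tilde{\mu}$-a.e., and the $\sigma$-algebra generated by $\varphi$ agrees with $\Phi_{-\infty}$ up to $\tilde{\mu}$-negligible sets. Such a system exists and is unique up to isomorphism of probability-preserving systems. *)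

theory Defs
  imports "HOL-Probability.Probability"
begin

definition standard_borel :: "'a measure \<Rightarrow> bool" where
  "standard_borel M \<longleftrightarrow>
     (\<exists>X. topspace X = space M \<and> completely_metrizable_space X \<and> separable_space X \<and>
          sets M = sigma_sets (space M) {U. openin X U})"

definition random_pp_system :: "'a measure \<Rightarrow> ('a \<Rightarrow> 'a measure) \<Rightarrow> bool" where
  "random_pp_system M P \<longleftrightarrow>
     standard_borel M \<and> prob_space M \<and> P \<in> measurable M (prob_algebra M) \<and>
     (\<forall>A\<in>sets M. (\<integral>\<^sup>+x. emeasure (P x) A \<partial>M) = emeasure M A)"

definition kernel_op :: "('a \<Rightarrow> 'a measure) \<Rightarrow> ('a \<Rightarrow> real) \<Rightarrow> 'a \<Rightarrow> real" where
  "kernel_op P f = (\<lambda>x. \<integral>y. f y \<partial>P x)"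

text \<open>
  The common refinement of a set of partitions of \<open>\<Omega>\<close>: each choice of one cell from every
  partition contributes the intersection of the chosen cells. Its members may include the empty
  set, which contributes nothing to the entropy because \<open>0 * ln 0 = 0\<close>. The intersection
  with \<open>\<Omega>\<close> only matters for the empty set of partitions, whose refinement is \<open>{\<Omega>}\<close>.
\<close>
definition common_refinement :: "'a set \<Rightarrow> 'a set set set \<Rightarrow> 'a set set" where
  "common_refinement \<Omega> \<P> = (\<lambda>c. \<Omega> \<inter> (\<Inter>Q\<in>\<P>. c Q)) ` (\<Pi>\<^sub>E Q\<in>\<P>. Q)"

definition shannon_entropy :: "'a measure \<Rightarrow> 'a set set \<Rightarrow> real" where
  "shannon_entropy M Q = - (\<Sum>C\<in>Q. measure M C * ln (measure M C))"

definition with_unit_interval :: "'a measure \<Rightarrow> ('a \<times> real) measure" where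
  "with_unit_interval M = M \<Otimes>\<^sub>M restrict_space lborel {0..1}"

definition subgraph_partition :: "'a measure \<Rightarrow> ('a \<Rightarrow> real) \<Rightarrow> ('a \<times> real) set set" where
  "subgraph_partition M f =
     (let \<Omega> = space M \<times> {0..1}; A = {(x, t) \<in> \<Omega>. t \<le> f x} in {A, \<Omega> - A})"

definition family_entropy :: "'a measure \<Rightarrow> ('a \<Rightarrow> real) set \<Rightarrow> real" where
  "family_entropy M F =
     shannon_entropy (with_unit_interval M)
       (common_refinement (space M \<times> {0..1}) (subgraph_partition M ` F))"

text \<open>In the limits superior below, the term for \<open>n = 0\<close> is the irrelevant value \<open>0\<close>.\<close>
definition operator_entropy_of ::
    "('a \<Rightarrow> real) set \<Rightarrow> 'a measure \<Rightarrow> ('a \<Rightarrow> 'a measure) \<Rightarrow> ereal" where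
  "operator_entropy_of F M P =
     limsup (\<lambda>n. ereal (family_entropy M (\<Union>k<n. (kernel_op P ^^ k) ` F) / real n))"

definition operator_entropy :: "'a measure \<Rightarrow> ('a \<Rightarrow> 'a measure) \<Rightarrow> ereal" where
  "operator_entropy M P =
     (SUP F \<in> {F. finite F \<and> (\<forall>f\<in>F. f \<in> borel_measurable M \<and> f \<in> space M \<rightarrow> {0..1})}.
        operator_entropy_of F M P)"

definition pp_system :: "'a measure \<Rightarrow> ('a \<Rightarrow> 'a) \<Rightarrow> bool" where
  "pp_system M T \<longleftrightarrow>
     standard_borel M \<and> prob_space M \<and> T \<in> measurable M M \<and> distr M M T = M"

definition preimage_partition :: "'a set \<Rightarrow> ('a \<Rightarrow> 'a) \<Rightarrow> 'a set set \<Rightarrow> 'a set set" where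
  "preimage_partition \<Omega> T Q = (\<lambda>C. T -` C \<inter> \<Omega>) ` Q"

definition ks_entropy_of :: "'a set set \<Rightarrow> 'a measure \<Rightarrow> ('a \<Rightarrow> 'a) \<Rightarrow> ereal" where
  "ks_entropy_of Q M T =
     limsup (\<lambda>n. ereal (shannon_entropy M
       (common_refinement (space M) ((\<lambda>k. preimage_partition (space M) (T ^^ k) Q) ` {..<n}))
       / real n))"

definition ks_entropy :: "'a measure \<Rightarrow> ('a \<Rightarrow> 'a) \<Rightarrow> ereal" where
  "ks_entropy M T =
     (SUP Q \<in> {Q. finite Q \<and> Q \<subseteq> sets M \<and> partition_on (space M) Q}. ks_entropy_of Q M T)"

text \<open>
  \<open>path_weight P A i n x\<close> is the probability that the chain started from \<open>x\<close> at
  time \<open>i\<close> lies in \<open>A k\<close> at every time \<open>k\<close> with \<open>i < k \<le> i + n\<close>.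
\<close>
primrec path_weight ::
    "('a \<Rightarrow> 'a measure) \<Rightarrow> (int \<Rightarrow> 'a set) \<Rightarrow> int \<Rightarrow> nat \<Rightarrow> 'a \<Rightarrow> ennreal" where
  "path_weight P A i 0 x = 1"
| "path_weight P A i (Suc n) x = (\<integral>\<^sup>+y\<in>A (i + 1). path_weight P A (i + 1) n y \<partial>P x)"

definition path_space_measure ::
    "'a measure \<Rightarrow> ('a \<Rightarrow> 'a measure) \<Rightarrow> (int \<Rightarrow> 'a) measure \<Rightarrow> bool" where
  "path_space_measure M P N \<longleftrightarrow>
     prob_space N \<and> sets N = sets (\<Pi>\<^sub>M k\<in>(UNIV :: int set). M) \<and>
     (\<forall>i j A. i \<le> j \<longrightarrow> (\<forall>k\<in>{i..j}. A k \<in> sets M) \<longrightarrow>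
        emeasure N {x \<in> space N. \<forall>k\<in>{i..j}. x k \<in> A k} =
        (\<integral>\<^sup>+x\<in>A i. path_weight P A i (nat (j - i)) x \<partial>M))"

definition path_shift :: "(int \<Rightarrow> 'a) \<Rightarrow> int \<Rightarrow> 'a" where
  "path_shift x = (\<lambda>n. x (n + 1))"

text \<open>Past paths are functions on the integers that are extensional on \<open>{..0}\<close>.\<close>
definition past_space :: "'a measure \<Rightarrow> (int \<Rightarrow> 'a) measure" where
  "past_space M = (\<Pi>\<^sub>M k\<in>{..0::int}. M)"

definition past_measure :: "'a measure \<Rightarrow> (int \<Rightarrow> 'a) measure \<Rightarrow> (int \<Rightarrow> 'a) measure" where
  "past_measure M N = distr N (past_space M) (\<lambda>x. restrict x {..0})"

definition past_kernel ::
    "'a measure \<Rightarrow> ('a \<Rightarrow> 'a measure) \<Rightarrow> (int \<Rightarrow> 'a) \<Rightarrow> (int \<Rightarrow> 'a) measure" where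
  "past_kernel M P x =
     distr (P (x 0)) (past_space M) (\<lambda>y. \<lambda>k\<in>{..0}. if k = 0 then y else x (k + 1))"

definition sigma_upto :: "(int \<Rightarrow> 'a) measure \<Rightarrow> 'a measure \<Rightarrow> int \<Rightarrow> (int \<Rightarrow> 'a) set set" where
  "sigma_upto N M n =
     sigma_sets (space N) {{x \<in> space N. x k \<in> A} | k A. k \<le> n \<and> A \<in> sets M}"

definition backwards_tail :: "(int \<Rightarrow> 'a) measure \<Rightarrow> 'a measure \<Rightarrow> (int \<Rightarrow> 'a) set set" where
  "backwards_tail N M = (\<Inter>n\<in>{..0}. sigma_upto N M n)"

definition agree_mod_null :: "'a measure \<Rightarrow> 'a set set \<Rightarrow> 'a set set \<Rightarrow> bool" where
  "agree_mod_null N \<A> \<B> \<longleftrightarrow>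
     (\<forall>A\<in>\<A>. \<exists>B\<in>\<B>. (A - B) \<union> (B - A) \<in> null_sets N) \<and>
     (\<forall>B\<in>\<B>. \<exists>A\<in>\<A>. (A - B) \<union> (B - A) \<in> null_sets N)"

definition backwards_tail_boundary ::
    "'a measure \<Rightarrow> (int \<Rightarrow> 'a) measure \<Rightarrow>
     'b measure \<Rightarrow> ('b \<Rightarrow> 'b) \<Rightarrow> ((int \<Rightarrow> 'a) \<Rightarrow> 'b) \<Rightarrow> bool" where
  "backwards_tail_boundary M N B T \<phi> \<longleftrightarrow>
     pp_system B T \<and>
     \<phi> \<in> measurable N B \<and> distr N B \<phi> = B \<and>
     (AE x in N. \<phi> (path_shift x) = T (\<phi> x)) \<and>
     agree_mod_null N (sets (vimage_algebra (space N) \<phi> B)) (backwards_tail N M)"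

end

theory Submission
  imports Defs
begin

text \<open>
  Entropies of finite families of sets are stable under small changes: \<open>H(A) \<le> H(A') +
  \<Sum> 2 sqrt (\<mu>(A\<^sub>i \<triangle> A'\<^sub>i))\<close>, and the subgraphs of \<open>f\<close> and \<open>g\<close> differ by
  \<open>E |f - g|\<close>. Write \<open>Q\<close> for the kernel on past paths and \<open>\<sigma>\<close> for the shift. Three inequalities are
  combined in a circle.

  \<^item> \<open>h\<^sub>K\<^sub>S \<le> h\<^sub>o\<^sub>p(X)\<close>: a tail set \<open>C\<close> is close to a set \<open>W\<close> depending on the last \<open>l\<close>
    coordinates. Applying \<open>Q\<close> is an \<open>L\<^sup>1\<close> contraction towards functions of the past, and
    \<open>\<sigma>\<^sup>-\<^sup>kC\<close> stays determined by the past, so \<open>Q\<^sup>l\<^sup>+\<^sup>k 1\<^sub>W\<close> stays close to \<open>\<sigma>\<^sup>-\<^sup>l\<^sup>-\<^sup>kC\<close>. But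
    \<open>Q\<^sup>l 1\<^sub>W\<close> is a function \<open>G(x\<^sub>0)\<close> of a single coordinate, and \<open>Q\<^sup>l\<^sup>+\<^sup>k 1\<^sub>W = P\<^sup>kG(x\<^sub>0)\<close>.
  \<^item> \<open>h\<^sub>o\<^sub>p(X) \<le> h\<^sub>o\<^sub>p(past)\<close>: lift \<open>f\<close> to \<open>f(x\<^sub>0)\<close>.
  \<^item> \<open>h\<^sub>o\<^sub>p(past) \<le> h\<^sub>K\<^sub>S\<close>: \<open>Q\<^sup>kf \<circ> \<sigma>\<^sup>-\<^sup>k\<close> is a reverse martingale, so it converges in \<open>L\<^sup>1\<close> to a
    tail function \<open>h\<close>, and \<open>Q\<^sup>kf\<close> is asymptotically \<open>h \<circ> \<sigma>\<^sup>k\<close>. Rounding \<open>h\<close> to multiples of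
    \<open>1 / m\<close> gives a finite partition of the boundary; the extra coordinate \<open>t\<close> costs only the
    constant \<open>ln (m + 1)\<close>.
\<close>

section \<open>Entropy of finite-valued random variables\<close>

text \<open>The three systems live on different spaces, but each is a factor of the stationary
  two-sided path space \<open>N\<close>: through coordinate 0, through \<open>past\<close> and
  through \<open>\<phi>\<close>. All entropies are therefore pulled back to \<open>N\<close> and
  written as entropies of one kind of variable, the random set of those indices whose event occurs.
  Families can then be compared index by index, and repetitions within a family cost nothing.

  The obstacle is that an iterate of the kernel operator is in general not a composition with a map,
  so partitions cannot be matched exactly; only L1 closeness of iterates to shifted tail functions
  is available. After division by \<open>n\<close>, errors are harmless as soon as their sum over
  \<open>k < n\<close> is at most a constant plus \<open>n\<close> times something small. The
  contraction gives a bound uniform in \<open>k\<close>. The martingale limit gives one only from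
  some \<open>k0\<close> on, and the finitely many earlier times go into the constant.

  The square root stems from the bound \<open>2 * sqrt p\<close> for the entropy of an event of
  probability \<open>p\<close>; any modulus that vanishes with \<open>p\<close> would serve.\<close>

definition rv_entropy :: "'a measure \<Rightarrow> ('a \<Rightarrow> 'c) \<Rightarrow> real" where
  "rv_entropy M X =
     - (\<Sum>c\<in>X ` space M. measure M (X -` {c} \<inter> space M) * ln (measure M (X -` {c} \<inter> space M)))"

lemma rv_entropy_cong:
  assumes "\<And>x. x \<in> space M \<Longrightarrow> X x = Y x"
  shows "rv_entropy M X = rv_entropy M Y"
proof -
  have "X ` space M = Y ` space M" "\<And>c. X -` {c} \<inter> space M = Y -` {c} \<inter> space M"
    using assms by (auto intro!: image_cong)
  then show ?thesis
    unfolding rv_entropy_def by simp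
qed

lemma rv_entropy_superset:
  assumes "finite S" "X ` space M \<subseteq> S"
  shows "rv_entropy M X =
     - (\<Sum>c\<in>S. measure M (X -` {c} \<inter> space M) * ln (measure M (X -` {c} \<inter> space M)))"
proof -
  have "X -` {c} \<inter> space M = {}" if "c \<notin> X ` space M" for c
    using that by auto
  then show ?thesis
    unfolding rv_entropy_def using assms by (auto intro!: sum.mono_neutral_left)
qed

lemma rv_entropy_distr:
  assumes f: "f \<in> measurable M N" and X: "simple_function N X"
  shows "rv_entropy (distr M N f) X = rv_entropy M (X \<circ> f)"
proof -
  let ?S = "X ` space N"
  have fin: "finite ?S"
    using X by (simp add: simple_function_def)
  have sub: "(X \<circ> f) ` space M \<subseteq> ?S"
    using measurable_space[OF f] by auto
  have "measure (distr M N f) (X -` {c} \<inter> space N) = measure M ((X \<circ> f) -` {c} \<inter> space M)" for c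
  proof -
    have "X -` {c} \<inter> space N \<in> sets N"
      using X by (rule simple_functionD)
    moreover have "f -` (X -` {c} \<inter> space N) \<inter> space M = (X \<circ> f) -` {c} \<inter> space M"
      using measurable_space[OF f] by auto
    ultimately show ?thesis
      using f by (simp add: measure_distr)
  qed
  then show ?thesis
    unfolding rv_entropy_superset[OF fin sub]
    by (subst rv_entropy_superset[OF fin]) auto
qed

context prob_space
begin

lemma information_space_exp: "information_space M (exp 1)"
  by (intro information_space.intro information_space_axioms.intro prob_space_axioms) simp

text \<open>In base \<open>exp 1\<close> the library entropy of a simple function is the plain sum,
  which makes the chain rule and data processing available.\<close>

lemma entropy_eq_rv_entropy:
  assumes "simple_function M X"
  shows "prob_space.entropy M (exp 1) (count_space (X ` space M)) X = rv_entropy M X"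
proof -
  interpret information_space M "exp 1"
    by (rule information_space_exp)
  show ?thesis
    by (subst entropy_simple_distributed[OF simple_distributedI[OF assms measure_nonneg refl]])
       (simp add: rv_entropy_def log_def)
qed

text \<open>\<open>det\<close> says that \<open>Y\<close> is a function of \<open>X\<close> without
  naming that function. In the applications the dependence comes from reasoning about sets; the
  factor map is built here once, from \<open>inv_into\<close>.\<close>

lemma rv_entropy_data_processing:
  assumes X: "simple_function M X"
    and det: "\<And>x y. x \<in> space M \<Longrightarrow> y \<in> space M \<Longrightarrow> X x = X y \<Longrightarrow> Y x = Y y"
  shows "rv_entropy M Y \<le> rv_entropy M X"
proof -
  interpret information_space M "exp 1"
    by (rule information_space_exp)
  define g where "g = Y \<circ> inv_into (space M) X"
  have "g (X x) = Y x" if "x \<in> space M" for x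
    using that det[of "inv_into (space M) X (X x)" x]
    by (simp add: g_def f_inv_into_f inv_into_into)
  then have "rv_entropy M Y = rv_entropy M (g \<circ> X)"
    by (intro rv_entropy_cong) simp
  also have "\<dots> \<le> rv_entropy M X"
    using entropy_data_processing[OF X, of g] X
    by (simp only: entropy_eq_rv_entropy simple_function_compose)
  finally show ?thesis .
qed

text \<open>Chain rule, and then conditioning on \<open>X\<close> does not increase the entropy of
  \<open>Y\<close>.\<close>

lemma rv_entropy_Pair_le:
  assumes X: "simple_function M X" and Y: "simple_function M Y"
  shows "rv_entropy M (\<lambda>x. (X x, Y x)) \<le> rv_entropy M X + rv_entropy M Y"
proof -
  interpret information_space M "exp 1"
    by (rule information_space_exp)
  show ?thesis
    using entropy_chain_rule[OF X Y] conditional_entropy_less_eq_entropy[OF Y X] X Y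
    by (simp add: entropy_eq_rv_entropy simple_function_Pair)
qed

lemma rv_entropy_le_ln_card:
  assumes X: "simple_function M X" and S: "finite S" "X ` space M \<subseteq> S"
  shows "rv_entropy M X \<le> ln (card S)"
proof -
  interpret information_space M "exp 1"
    by (rule information_space_exp)
  have "X ` space M \<noteq> {}"
    using not_empty by auto
  moreover have "finite (X ` space M)"
    using S by (rule finite_subset[rotated])
  ultimately have "0 < card (X ` space M)"
    by (simp add: card_gt_0_iff)
  moreover have "card (X ` space M) \<le> card S"
    using S by (rule card_mono)
  ultimately have "ln (real (card (X ` space M))) \<le> ln (real (card S))"
    by simp
  then show ?thesis
    using entropy_le_card[OF simple_distributedI[OF X measure_nonneg refl]] X
    by (simp add: entropy_eq_rv_entropy log_def)
qed

text \<open>The encoding used throughout: the nonempty fibres of this random set are the nonempty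
  cells of the common refinement of the two-set partitions given by the events.\<close>

lemma simple_function_Collect:
  assumes "finite I" "\<And>i. i \<in> I \<Longrightarrow> Measurable.pred M (A i)"
  shows "simple_function M (\<lambda>x. {i\<in>I. A i x})"
  unfolding simple_function_def
proof (intro conjI ballI)
  show "finite ((\<lambda>x. {i \<in> I. A i x}) ` space M)"
    by (rule finite_subset[of _ "Pow I"]) (use assms in auto)
  fix J assume "J \<in> (\<lambda>x. {i \<in> I. A i x}) ` space M"
  then have "J \<subseteq> I"
    by auto
  then have "(\<lambda>x. {i \<in> I. A i x}) -` {J} \<inter> space M = {x\<in>space M. \<forall>i\<in>I. A i x \<longleftrightarrow> i \<in> J}"
    by auto
  also have "\<dots> \<in> sets M"
    using assms by (intro sets.sets_Collect_finite_All) (auto simp: pred_def)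
  finally show "(\<lambda>x. {i \<in> I. A i x}) -` {J} \<inter> space M \<in> sets M" .
qed

end

section \<open>Modulus of continuity of the entropy of finitely many events\<close>

lemma binary_entropy_le:
  fixes p :: real
  assumes p: "0 \<le> p" "p \<le> 1"
  shows "- (p * ln p) - (1 - p) * ln (1 - p) \<le> 2 * sqrt p"
proof -
  have 1: "- (p * ln p) \<le> 2 * sqrt p - 2 * p"
  proof (cases "p = 0")
    case False
    then have "p > 0"
      using p by simp
    \<comment> \<open>At \<open>1 / p\<close> the inequality \<open>ln s <= s - 1\<close> would give
      only \<open>1 - p\<close>, which does not vanish with \<open>p\<close>. At
      \<open>1 / sqrt p\<close> the logarithm is halved and \<open>2 * sqrt p - 2 * p\<close>
      results.\<close>
    then have "ln (1 / sqrt p) \<le> 1 / sqrt p - 1"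
      by (intro ln_le_minus_one) simp
    moreover have "ln (1 / sqrt p) = - ln p / 2"
      using \<open>p > 0\<close> by (simp add: ln_div ln_sqrt)
    ultimately have "- ln p \<le> 2 * (1 / sqrt p - 1)"
      by simp
    then have "p * (- ln p) \<le> p * (2 * (1 / sqrt p - 1))"
      using p by (intro mult_left_mono) auto
    also have "\<dots> = 2 * (p / sqrt p) - 2 * p"
      by (simp add: algebra_simps)
    also have "p / sqrt p = sqrt p"
      using p by (rule_tac real_div_sqrt)
    finally show ?thesis
      by simp
  qed simp
  have 2: "- ((1 - p) * ln (1 - p)) \<le> p"
  proof (cases "p = 1")
    case False
    then have "1 - p > 0"
      using p by simp
    then have "ln (1 / (1 - p)) \<le> 1 / (1 - p) - 1"
      by (intro ln_le_minus_one) simp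
    then have "- ln (1 - p) \<le> 1 / (1 - p) - 1"
      using \<open>1 - p > 0\<close> by (simp add: ln_div)
    then have "(1 - p) * (- ln (1 - p)) \<le> (1 - p) * (1 / (1 - p) - 1)"
      using p by (intro mult_left_mono) auto
    then show ?thesis
      using \<open>1 - p > 0\<close> by (simp add: algebra_simps)
  qed simp
  show ?thesis
    using 1 2 p by linarith
qed

context prob_space
begin

lemma rv_entropy_bool_le:
  assumes [measurable]: "Measurable.pred M A"
  shows "rv_entropy M A \<le> 2 * sqrt (prob {x\<in>space M. A x})"
proof -
  have "A -` {False} \<inter> space M = {x\<in>space M. \<not> A x}" "A -` {True} \<inter> space M = {x\<in>space M. A x}"
    by auto
  moreover have "rv_entropy M A =
     - (\<Sum>c\<in>UNIV. prob (A -` {c} \<inter> space M) * ln (prob (A -` {c} \<inter> space M)))"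
    by (rule rv_entropy_superset) auto
  moreover have "prob {x\<in>space M. \<not> A x} = 1 - prob {x\<in>space M. A x}"
    by (rule prob_neg) simp
  ultimately show ?thesis
    using binary_entropy_le[of "prob {x\<in>space M. A x}"]
    by (simp add: UNIV_bool)
qed

text \<open>Subadditivity, adding one event at a time, each at the price of its binary
  entropy.\<close>

lemma rv_entropy_Collect_le_sum:
  assumes "finite I" "\<And>i. i \<in> I \<Longrightarrow> Measurable.pred M (A i)"
  shows "rv_entropy M (\<lambda>x. {i\<in>I. A i x}) \<le> (\<Sum>i\<in>I. 2 * sqrt (prob {x\<in>space M. A i x}))"
  using assms
proof (induction I)
  case empty
  have "rv_entropy M (\<lambda>x. {} :: 'b set) \<le> ln (card {{} :: 'b set})"
    by (rule rv_entropy_le_ln_card) auto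
  then show ?case
    by simp
next
  case (insert j I)
  have [measurable]: "Measurable.pred M (A j)"
    using insert by simp
  have sI: "simple_function M (\<lambda>x. {i\<in>I. A i x})"
    using insert by (intro simple_function_Collect) auto
  have sj: "simple_function M (A j)"
    unfolding simple_function_def
    by (auto intro: finite_subset[of _ "UNIV :: bool set"])
  have "rv_entropy M (\<lambda>x. {i\<in>insert j I. A i x}) \<le> rv_entropy M (\<lambda>x. (A j x, {i\<in>I. A i x}))"
    by (intro rv_entropy_data_processing simple_function_Pair sI sj) (auto 0 3)
  also have "\<dots> \<le> rv_entropy M (A j) + rv_entropy M (\<lambda>x. {i\<in>I. A i x})"
    by (intro rv_entropy_Pair_le sI sj)
  also have "\<dots> \<le> 2 * sqrt (prob {x\<in>space M. A j x}) + (\<Sum>i\<in>I. 2 * sqrt (prob {x\<in>space M. A i x}))"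
    using insert by (intro add_mono rv_entropy_bool_le) auto
  finally show ?case
    using insert by simp
qed

text \<open>The family \<open>A\<close> is determined by \<open>B\<close> together with the symmetric differences, each of
  which has small entropy.\<close>
lemma rv_entropy_perturb:
  assumes I: "finite I"
    and A: "\<And>i. i \<in> I \<Longrightarrow> Measurable.pred M (A i)" and B: "\<And>i. i \<in> I \<Longrightarrow> Measurable.pred M (B i)"
  shows "rv_entropy M (\<lambda>x. {i\<in>I. A i x}) \<le>
    rv_entropy M (\<lambda>x. {i\<in>I. B i x}) + (\<Sum>i\<in>I. 2 * sqrt (prob {x\<in>space M. A i x \<noteq> B i x}))"
proof -
  let ?B = "\<lambda>x. {i\<in>I. B i x}" and ?D = "\<lambda>x. {i\<in>I. A i x \<noteq> B i x}"
  have D: "Measurable.pred M (\<lambda>x. A i x \<noteq> B i x)" if "i \<in> I" for i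
    using A[OF that] B[OF that] by measurable
  have sB: "simple_function M ?B" and sD: "simple_function M ?D"
    using I B D by (auto intro!: simple_function_Collect)
  have "rv_entropy M (\<lambda>x. {i\<in>I. A i x}) \<le> rv_entropy M (\<lambda>x. (?B x, ?D x))"
    by (intro rv_entropy_data_processing simple_function_Pair sB sD) blast
  also have "\<dots> \<le> rv_entropy M ?B + rv_entropy M ?D"
    by (intro rv_entropy_Pair_le sB sD)
  also have "rv_entropy M ?D \<le> (\<Sum>i\<in>I. 2 * sqrt (prob {x\<in>space M. A i x \<noteq> B i x}))"
    using I D by (rule rv_entropy_Collect_le_sum)
  finally show ?thesis
    by simp
qed

end

lemma shannon_entropy_common_refinement:
  assumes fin: "finite \<P>" "\<And>Q. Q \<in> \<P> \<Longrightarrow> finite Q"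
    and cells: "\<And>Q x. Q \<in> \<P> \<Longrightarrow> x \<in> space M \<Longrightarrow> \<exists>!S. S \<in> Q \<and> x \<in> S"
    and X: "\<And>x y. x \<in> space M \<Longrightarrow> y \<in> space M \<Longrightarrow>
      X x = X y \<longleftrightarrow> (\<forall>Q\<in>\<P>. \<forall>S\<in>Q. x \<in> S \<longleftrightarrow> y \<in> S)"
  shows "shannon_entropy M (common_refinement (space M) \<P>) = rv_entropy M X"
proof -
  let ?R = "common_refinement (space M) \<P>" and ?L = "\<lambda>c. X -` {c} \<inter> space M"
  have finR: "finite ?R"
    unfolding common_refinement_def using fin by (intro finite_imageI finite_PiE) auto
  have eq: "?R - {{}} = ?L ` (X ` space M)"
  proof (intro set_eqI iffI)
    fix C assume "C \<in> ?R - {{}}"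
    then obtain c x where c: "c \<in> (\<Pi>\<^sub>E Q\<in>\<P>. Q)" "C = space M \<inter> (\<Inter>Q\<in>\<P>. c Q)" and x: "x \<in> C"
      by (auto simp: common_refinement_def)
    \<comment> \<open>In a nonempty cell the choice is forced: a member of \<open>Q\<close> that
      meets the cell is \<open>c Q\<close>.\<close>
    have cx: "S = c Q" if "Q \<in> \<P>" "S \<in> Q" "y \<in> S" "y \<in> C" for Q S y
      using cells[of Q y] that c by (auto simp: PiE_iff)
    have "C = ?L (X x)"
    proof (intro set_eqI iffI)
      fix y assume y: "y \<in> C"
      then have "\<forall>Q\<in>\<P>. \<forall>S\<in>Q. y \<in> S \<longleftrightarrow> x \<in> S"
        using cx x c(2) by blast
      then show "y \<in> ?L (X x)"
        using X[of y x] x y c(2) by auto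
    next
      fix y assume y: "y \<in> ?L (X x)"
      then have "\<forall>Q\<in>\<P>. \<forall>S\<in>Q. y \<in> S \<longleftrightarrow> x \<in> S"
        using X[of y x] x c(2) by auto
      then show "y \<in> C"
        using x y c by (auto simp: PiE_iff)
    qed
    then show "C \<in> ?L ` (X ` space M)"
      using x c(2) by blast
  next
    fix C assume "C \<in> ?L ` (X ` space M)"
    then obtain x where x: "x \<in> space M" "C = ?L (X x)"
      by auto
    \<comment> \<open>The member containing \<open>x\<close> in every partition, restricted to
      \<open>\<P>\<close> because choices have to be extensional.\<close>
    define c where "c = (\<lambda>Q\<in>\<P>. THE S. S \<in> Q \<and> x \<in> S)"
    have c: "c Q \<in> Q" "x \<in> c Q" if "Q \<in> \<P>" for Q
      using theI'[OF cells[OF that x(1)]] that by (auto simp: c_def)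
    have cu: "S = c Q" if "Q \<in> \<P>" "S \<in> Q" "y \<in> S" "y \<in> c Q" "y \<in> space M" for Q S y
      using cells[of Q y] that c by auto
    have "C = space M \<inter> (\<Inter>Q\<in>\<P>. c Q)"
    proof (intro set_eqI iffI)
      fix y assume "y \<in> C"
      then have y: "y \<in> space M" and "\<forall>Q\<in>\<P>. \<forall>S\<in>Q. y \<in> S \<longleftrightarrow> x \<in> S"
        using X[of y x] x by auto
      then have "y \<in> c Q" if "Q \<in> \<P>" for Q
        using c[OF that] that by blast
      then show "y \<in> space M \<inter> (\<Inter>Q\<in>\<P>. c Q)"
        using y by simp
    next
      fix y assume y: "y \<in> space M \<inter> (\<Inter>Q\<in>\<P>. c Q)"
      then have "\<forall>Q\<in>\<P>. \<forall>S\<in>Q. y \<in> S \<longleftrightarrow> x \<in> S"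
        using cu x c by blast
      then show "y \<in> C"
        using X[of y x] x y by auto
    qed
    moreover have "c \<in> (\<Pi>\<^sub>E Q\<in>\<P>. Q)"
      using c by (auto simp: c_def PiE_iff)
    ultimately have "C \<in> ?R"
      unfolding common_refinement_def by (rule image_eqI)
    moreover have "x \<in> C"
      using x by simp
    ultimately show "C \<in> ?R - {{}}"
      by blast
  qed
  have inj: "inj_on ?L (X ` space M)"
  proof (rule inj_onI)
    fix c d assume "c \<in> X ` space M" and eq: "?L c = ?L d"
    then obtain x where "x \<in> ?L c"
      by auto
    with eq have "x \<in> ?L d"
      by (rule subst)
    with \<open>x \<in> ?L c\<close> show "c = d"
      by simp
  qed
  have "(\<Sum>C\<in>?R. measure M C * ln (measure M C)) = (\<Sum>C\<in>?R - {{}}. measure M C * ln (measure M C))"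
    using finR by (intro sum.mono_neutral_right) auto
  also have "\<dots> = (\<Sum>c\<in>X ` space M. measure M (?L c) * ln (measure M (?L c)))"
    unfolding eq by (subst sum.reindex[OF inj]) simp
  finally show ?thesis
    by (simp add: shannon_entropy_def rv_entropy_def)
qed

section \<open>Stationary paths\<close>

abbreviation unit_functions :: "'a measure \<Rightarrow> ('a \<Rightarrow> real) set" where
  "unit_functions M \<equiv> {f. f \<in> borel_measurable M \<and> f \<in> space M \<rightarrow> {0..1}}"

lemma unit_functionsD:
  assumes "f \<in> unit_functions M"
  shows "f \<in> borel_measurable M" "\<And>x. x \<in> space M \<Longrightarrow> 0 \<le> f x" "\<And>x. x \<in> space M \<Longrightarrow> f x \<le> 1"
  using assms by auto

lemma (in finite_measure) integrable_unit_function: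
  assumes "f \<in> unit_functions M"
  shows "integrable M f"
  using assms by (intro integrable_const_bound[of _ 1] AE_I2) (auto simp: abs_le_iff dest!: funcset_mem)

lemma kernel_op_unit_function:
  assumes K: "K \<in> measurable M (prob_algebra M)" and f: "f \<in> unit_functions M"
  shows "kernel_op K f \<in> unit_functions M"
proof -
  have meas: "kernel_op K f \<in> borel_measurable M"
    unfolding kernel_op_def using f
    by (intro measurable_compose[OF measurable_prob_algebraD[OF K]] integral_measurable_subprob_algebra) auto
  have "0 \<le> kernel_op K f x \<and> kernel_op K f x \<le> 1" if x: "x \<in> space M" for x
  proof -
    have "K x \<in> space (prob_algebra M)"
      using K x by (rule measurable_space)
    then have Kx: "prob_space (K x)" "sets (K x) = sets M"
      by (auto simp: space_prob_algebra)
    interpret K: prob_space "K x" by fact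
    have "space (K x) = space M"
      using Kx by (rule_tac sets_eq_imp_space_eq)
    then have f': "f \<in> unit_functions (K x)"
      using f measurable_cong_sets[OF Kx(2), of borel borel] by auto
    have "(\<integral>y. f y \<partial>K x) \<le> (\<integral>y. 1 \<partial>K x)"
      using f' by (intro integral_mono K.integrable_unit_function) auto
    moreover have "0 \<le> (\<integral>y. f y \<partial>K x)"
      using f' by (intro Bochner_Integration.integral_nonneg_AE AE_I2) auto
    ultimately show ?thesis
      by (simp add: kernel_op_def K.prob_space)
  qed
  then show ?thesis
    using meas by auto
qed

lemma kernel_op_funpow_unit_function:
  assumes "K \<in> measurable M (prob_algebra M)" and "f \<in> unit_functions M"
  shows "(kernel_op K ^^ k) f \<in> unit_functions M"
proof (induction k)
  case (Suc k)
  have "kernel_op K ((kernel_op K ^^ k) f) \<in> unit_functions M"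
    using assms(1) Suc by (rule kernel_op_unit_function)
  then show ?case
    by (simp only: funpow.simps o_apply)
qed (use assms(2) in simp)

definition shift_by :: "int \<Rightarrow> (int \<Rightarrow> 'a) \<Rightarrow> int \<Rightarrow> 'a" where
  "shift_by a x = (\<lambda>k. x (k + a))"

definition past :: "(int \<Rightarrow> 'a) \<Rightarrow> int \<Rightarrow> 'a" where
  "past x = restrict x {..0}"

text \<open>The shift into the past for paths that are extensional on \<open>{..0}\<close>: it
  forgets coordinate 0. It undoes a step of the kernel on past paths
  (\<open>delay_extend_past\<close>).\<close>

definition delay :: "(int \<Rightarrow> 'a) \<Rightarrow> int \<Rightarrow> 'a" where
  "delay p = (\<lambda>k\<in>{..0}. p (k - 1))"

lemma shift_by_0 [simp]: "shift_by 0 x = x"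
  and shift_by_shift_by [simp]: "shift_by a (shift_by b x) = shift_by (a + b) x"
  and path_shift_eq: "path_shift x = shift_by 1 x"
  by (simp_all add: shift_by_def path_shift_def algebra_simps)

lemma delay_past [simp]: "delay (past x) = past (shift_by (- 1) x)"
  by (auto simp: delay_def past_def shift_by_def fun_eq_iff)

text \<open>\<open>path_weight\<close> with a terminal payoff \<open>g\<close>, evaluated at time
  \<open>i + n\<close>, in place of 1. The recursion of \<open>path_weight\<close> exposes the first
  step of the chain; a payoff is what allows the last step to be split off instead.\<close>

primrec path_integral ::
    "('a \<Rightarrow> 'a measure) \<Rightarrow> (int \<Rightarrow> 'a set) \<Rightarrow> ('a \<Rightarrow> ennreal) \<Rightarrow> int \<Rightarrow> nat \<Rightarrow> 'a \<Rightarrow> ennreal" where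
  "path_integral P A g i 0 x = g x"
| "path_integral P A g i (Suc n) x = (\<integral>\<^sup>+y\<in>A (i + 1). path_integral P A g (i + 1) n y \<partial>P x)"

lemma finite_int_subset_window:
  assumes "finite (J :: int set)"
  obtains n where "J \<subseteq> {- int n..int n}"
proof -
  define b where "b = (\<Sum>j\<in>J. \<bar>j\<bar>)"
  have b: "\<forall>j\<in>J. \<bar>j\<bar> \<le> b"
    unfolding b_def using assms by (auto intro!: member_le_sum)
  have "J \<subseteq> {- int (nat b)..int (nat b)}"
    using b by fastforce
  then show ?thesis
    by (rule that)
qed

locale markov_path =
  fixes M :: "'a measure" and P :: "'a \<Rightarrow> 'a measure" and N :: "(int \<Rightarrow> 'a) measure"
  assumes system: "random_pp_system M P" and path: "path_space_measure M P N"
begin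

lemma kernel [measurable]: "P \<in> measurable M (prob_algebra M)"
  using system by (auto simp: random_pp_system_def)

lemma kernel_subprob [measurable]: "P \<in> measurable M (subprob_algebra M)"
  by (rule measurable_prob_algebraD) (rule kernel)

lemma sets_kernel: "x \<in> space M \<Longrightarrow> sets (P x) = sets M"
  using measurable_space[OF kernel] by (auto simp: space_prob_algebra)

lemma space_kernel: "x \<in> space M \<Longrightarrow> space (P x) = space M"
  by (intro sets_eq_imp_space_eq sets_kernel)

lemma measurable_kernel: "x \<in> space M \<Longrightarrow> measurable (P x) L = measurable M L"
  by (intro measurable_cong_sets sets_kernel refl)

sublocale N: prob_space N
  using path by (simp add: path_space_measure_def)

lemma sets_N [measurable_cong]: "sets N = sets (\<Pi>\<^sub>M k\<in>(UNIV :: int set). M)"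
  using path by (simp add: path_space_measure_def)

lemma space_N: "space N = (\<Pi>\<^sub>E k\<in>(UNIV :: int set). space M)"
  using sets_eq_imp_space_eq[OF sets_N] by (simp add: space_PiM)

lemma measurable_coord [measurable]: "(\<lambda>x. x k) \<in> measurable N M"
  by measurable

lemma coord_space: "x \<in> space N \<Longrightarrow> x k \<in> space M"
  using measurable_space[OF measurable_coord] .

lemma emeasure_cylinder:
  assumes "\<And>k. A k \<in> sets M"
  shows "emeasure N {x\<in>space N. \<forall>k\<in>{i..i + int n}. x k \<in> A k} = (\<integral>\<^sup>+x\<in>A i. path_weight P A i n x \<partial>M)"
proof -
  have "\<forall>i j A. i \<le> j \<longrightarrow> (\<forall>k\<in>{i..j}. A k \<in> sets M) \<longrightarrow>
      emeasure N {x\<in>space N. \<forall>k\<in>{i..j}. x k \<in> A k} = (\<integral>\<^sup>+x\<in>A i. path_weight P A i (nat (j - i)) x \<partial>M)"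
    using path by (simp add: path_space_measure_def)
  from this[rule_format, of i "i + int n" A] show ?thesis
    using assms by simp
qed

lemma cylinder_in_sets [measurable]:
  assumes [measurable]: "\<And>k. A k \<in> sets M"
  shows "{x\<in>space N. \<forall>k\<in>{i..j::int}. x k \<in> A k} \<in> sets N"
  by measurable

section \<open>Integrals over cylinders and the Markov property\<close>

lemma measurable_path_integral:
  assumes A: "\<And>k. A k \<in> sets M" and g: "g \<in> borel_measurable M"
  shows "path_integral P A g i n \<in> borel_measurable M"
proof (induction n arbitrary: i)
  case 0
  then show ?case
    using g by simp
next
  case (Suc n)
  have "(\<lambda>y. path_integral P A g (i + 1) n y * indicator (A (i + 1)) y) \<in> borel_measurable M"
    using Suc A by measurable
  then have "(\<lambda>x. \<integral>\<^sup>+y\<in>A (i + 1). path_integral P A g (i + 1) n y \<partial>P x) \<in> borel_measurable M"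
    by (rule measurable_compose[OF kernel_subprob nn_integral_measurable_subprob_algebra])
  then show ?case
    by simp
qed

lemma path_integral_cong:
  assumes "\<And>x. x \<in> space M \<Longrightarrow> f x = g x" "x \<in> space M"
  shows "path_integral P A f i n x = path_integral P A g i n x"
  using assms by (induction n arbitrary: i x) (auto intro!: nn_integral_cong simp: space_kernel)

lemma path_integral_cmult:
  assumes A: "\<And>k. A k \<in> sets M" and g: "g \<in> borel_measurable M" and "x \<in> space M"
  shows "path_integral P A (\<lambda>x. c * g x) i n x = c * path_integral P A g i n x"
  using \<open>x \<in> space M\<close>
proof (induction n arbitrary: i x)
  case (Suc n)
  have [measurable]: "path_integral P A g (i + 1) n \<in> borel_measurable (P x)" "A (i + 1) \<in> sets (P x)"
    using measurable_path_integral[OF A g] Suc.prems A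
    by (simp_all add: measurable_kernel sets_kernel)
  have "path_integral P A (\<lambda>x. c * g x) i (Suc n) x =
      (\<integral>\<^sup>+y. c * (path_integral P A g (i + 1) n y * indicator (A (i + 1)) y) \<partial>P x)"
    using Suc by (auto intro!: nn_integral_cong simp: space_kernel mult.assoc)
  also have "\<dots> = c * path_integral P A g i (Suc n) x"
    by (simp add: nn_integral_cmult)
  finally show ?case .
qed simp

lemma path_integral_add:
  assumes A: "\<And>k. A k \<in> sets M" and f: "f \<in> borel_measurable M" and g: "g \<in> borel_measurable M"
    and "x \<in> space M"
  shows "path_integral P A (\<lambda>x. f x + g x) i n x = path_integral P A f i n x + path_integral P A g i n x"
  using \<open>x \<in> space M\<close>
proof (induction n arbitrary: i x)
  case (Suc n)
  have [measurable]: "path_integral P A f (i + 1) n \<in> borel_measurable (P x)"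
      "path_integral P A g (i + 1) n \<in> borel_measurable (P x)" "A (i + 1) \<in> sets (P x)"
    using measurable_path_integral[OF A f] measurable_path_integral[OF A g] Suc.prems A
    by (simp_all add: measurable_kernel sets_kernel)
  have "path_integral P A (\<lambda>x. f x + g x) i (Suc n) x =
      (\<integral>\<^sup>+y. path_integral P A f (i + 1) n y * indicator (A (i + 1)) y +
         path_integral P A g (i + 1) n y * indicator (A (i + 1)) y \<partial>P x)"
    using Suc by (auto intro!: nn_integral_cong simp: space_kernel distrib_right)
  also have "\<dots> = path_integral P A f i (Suc n) x + path_integral P A g i (Suc n) x"
    by (simp add: nn_integral_add)
  finally show ?case .
qed simp

lemma path_integral_SUP:
  assumes A: "\<And>k. A k \<in> sets M" and U: "\<And>m. U m \<in> borel_measurable M" and inc: "incseq U"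
    and "x \<in> space M"
  shows "path_integral P A (SUP m. U m) i n x = (SUP m. path_integral P A (U m) i n x)"
    and "incseq (\<lambda>m. path_integral P A (U m) i n x)"
proof -
  have mono: "path_integral P A (U m) i n x \<le> path_integral P A (U m') i n x" if "m \<le> m'" for m m' i n x
    using incseqD[OF inc that]
    by (induction n arbitrary: i x) (auto simp: le_fun_def intro!: nn_integral_mono mult_right_mono)
  then show "incseq (\<lambda>m. path_integral P A (U m) i n x)"
    by (simp add: incseq_def)
  show "path_integral P A (SUP m. U m) i n x = (SUP m. path_integral P A (U m) i n x)"
    using \<open>x \<in> space M\<close>
  proof (induction n arbitrary: i x)
    case (Suc n)
    have [measurable]: "path_integral P A (U m) (i + 1) n \<in> borel_measurable (P x)"
        "A (i + 1) \<in> sets (P x)" for m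
      using measurable_path_integral[OF A U] Suc.prems A
      by (simp_all add: measurable_kernel sets_kernel)
    have "path_integral P A (SUP m. U m) i (Suc n) x =
        (\<integral>\<^sup>+y. (SUP m. path_integral P A (U m) (i + 1) n y * indicator (A (i + 1)) y) \<partial>P x)"
      using Suc.prems
      by (auto intro!: nn_integral_cong simp: space_kernel Suc.IH SUP_mult_right_ennreal simp del: SUP_apply Sup_apply)
    also have "\<dots> = (SUP m. path_integral P A (U m) i (Suc n) x)"
      by (subst nn_integral_monotone_convergence_SUP)
         (auto simp: incseq_def le_fun_def intro!: mult_right_mono mono)
    finally show ?case .
  qed (simp add: image_image)
qed

text \<open>A terminal indicator can be absorbed into the last set of the cylinder. The indicator of
  the set at time \<open>i\<close> appears on both sides because for \<open>n = 0\<close> the last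
  set is also the first, which \<open>path_weight\<close> itself ignores.\<close>

lemma path_weight_indicator:
  "path_weight P (A(i + int n := A (i + int n) \<inter> B)) i n x *
     indicator ((A(i + int n := A (i + int n) \<inter> B)) i) x =
   path_integral P A (indicator B) i n x * indicator (A i) x"
proof (induction n arbitrary: i x)
  case 0
  then show ?case
    by (simp add: indicator_inter_arith mult.commute)
next
  case (Suc n)
  have *: "i + int (Suc n) = (i + 1) + int n"
    by simp
  show ?case
    using Suc[of "i + 1"] unfolding * by simp
qed

text \<open>Induction over nonnegative measurable functions. Indicators reduce to the given cylinder
  formula, and monotone limits pass through all the nested integrals.\<close>

lemma nn_integral_cylinder:
  assumes A: "\<And>k. A k \<in> sets M" and g: "g \<in> borel_measurable M"
  shows "(\<integral>\<^sup>+x. g (x (i + int n)) * indicator {x\<in>space N. \<forall>k\<in>{i..i + int n}. x k \<in> A k} x \<partial>N) =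
    (\<integral>\<^sup>+x\<in>A i. path_integral P A g i n x \<partial>M)"
  using g
proof (induct rule: borel_measurable_induct)
  note [measurable] = A cylinder_in_sets[OF A] measurable_path_integral[OF A]
  case (cong f g)
  have "(\<integral>\<^sup>+x. f (x (i + int n)) * indicator {x\<in>space N. \<forall>k\<in>{i..i + int n}. x k \<in> A k} x \<partial>N) =
     (\<integral>\<^sup>+x. g (x (i + int n)) * indicator {x\<in>space N. \<forall>k\<in>{i..i + int n}. x k \<in> A k} x \<partial>N)"
    using cong(3) by (intro nn_integral_cong) (simp add: coord_space)
  also have "\<dots> = (\<integral>\<^sup>+x\<in>A i. path_integral P A f i n x \<partial>M)"
    unfolding cong(4) using path_integral_cong[of f g] cong(3) by (intro nn_integral_cong) simp
  finally show ?case .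
next
  note [measurable] = A cylinder_in_sets[OF A] measurable_path_integral[OF A]
  case (set B)
  let ?A = "A(i + int n := A (i + int n) \<inter> B)"
  have "(\<integral>\<^sup>+x. indicator B (x (i + int n)) * indicator {x\<in>space N. \<forall>k\<in>{i..i + int n}. x k \<in> A k} x \<partial>N) =
     (\<integral>\<^sup>+x. indicator {x\<in>space N. \<forall>k\<in>{i..i + int n}. x k \<in> ?A k} x \<partial>N)"
    by (intro nn_integral_cong) (auto simp: indicator_def)
  also have "\<dots> = emeasure N {x\<in>space N. \<forall>k\<in>{i..i + int n}. x k \<in> ?A k}"
    using A set by (intro nn_integral_indicator cylinder_in_sets) auto
  also have "\<dots> = (\<integral>\<^sup>+x\<in>?A i. path_weight P ?A i n x \<partial>M)"
    using A set by (intro emeasure_cylinder) auto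
  also have "\<dots> = (\<integral>\<^sup>+x\<in>A i. path_integral P A (indicator B) i n x \<partial>M)"
    by (intro nn_integral_cong path_weight_indicator)
  finally show ?case .
next
  note [measurable] = A cylinder_in_sets[OF A] measurable_path_integral[OF A]
  case (mult u c)
  note [measurable] = mult(2)
  have "(\<integral>\<^sup>+x\<in>A i. path_integral P A (\<lambda>x. c * u x) i n x \<partial>M) =
      (\<integral>\<^sup>+x. c * (path_integral P A u i n x * indicator (A i) x) \<partial>M)"
    using path_integral_cmult[OF A mult(2)] by (intro nn_integral_cong) (simp add: mult.assoc)
  then show ?case
    using mult(4) by (simp add: nn_integral_cmult mult.assoc)
next
  note [measurable] = A cylinder_in_sets[OF A] measurable_path_integral[OF A]
  case (add u v)
  note [measurable] = add(1,4)
  have "(\<integral>\<^sup>+x\<in>A i. path_integral P A (\<lambda>x. v x + u x) i n x \<partial>M) =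
      (\<integral>\<^sup>+x. path_integral P A v i n x * indicator (A i) x + path_integral P A u i n x * indicator (A i) x \<partial>M)"
    using path_integral_add[OF A add(4,1)] by (intro nn_integral_cong) (simp add: distrib_right)
  then show ?case
    using add(3,7) by (simp add: nn_integral_add distrib_right)
next
  note [measurable] = A cylinder_in_sets[OF A] measurable_path_integral[OF A]
  case (seq U)
  note [measurable] = seq(1)
  let ?C = "{x\<in>space N. \<forall>k\<in>{i..i + int n}. x k \<in> A k}"
  have "(\<integral>\<^sup>+x\<in>A i. path_integral P A (SUP m. U m) i n x \<partial>M) =
      (\<integral>\<^sup>+x. (SUP m. path_integral P A (U m) i n x * indicator (A i) x) \<partial>M)"
    using path_integral_SUP(1)[OF A seq(1,4)] by (intro nn_integral_cong) (simp add: SUP_mult_right_ennreal del: SUP_apply Sup_apply)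
  also have "\<dots> = (SUP m. \<integral>\<^sup>+x\<in>A i. path_integral P A (U m) i n x \<partial>M)"
  proof (rule nn_integral_monotone_convergence_SUP_AE)
    show "AE x in M. path_integral P A (U m) i n x * indicator (A i) x \<le>
        path_integral P A (U (Suc m)) i n x * indicator (A i) x" for m
      using path_integral_SUP(2)[OF A seq(1,4)]
      by (intro AE_I2 mult_right_mono) (auto simp: incseq_def)
  qed simp
  also have "\<dots> = (SUP m. \<integral>\<^sup>+x. U m (x (i + int n)) * indicator ?C x \<partial>N)"
    using seq(3) by simp
  also have "\<dots> = (\<integral>\<^sup>+x. (SUP m. U m (x (i + int n)) * indicator ?C x) \<partial>N)"
    using seq(4)
    by (intro nn_integral_monotone_convergence_SUP[symmetric])
       (auto simp: incseq_def le_fun_def intro!: mult_right_mono)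
  also have "\<dots> = (\<integral>\<^sup>+x. (SUP m. U m) (x (i + int n)) * indicator ?C x \<partial>N)"
    by (intro nn_integral_cong) (simp add: SUP_mult_right_ennreal image_image)
  finally show ?case
    by (rule sym)
qed

text \<open>Integrates out the last step of the chain first, against the order of the
  recursion.\<close>

lemma path_weight_Suc_last:
  assumes "x \<in> space M" and B: "B \<in> sets M"
  shows "path_weight P (A(i + int n + 1 := B)) i (Suc n) x =
    path_integral P A (\<lambda>x. emeasure (P x) B) i n x"
  using assms(1)
proof (induction n arbitrary: i x)
  case 0
  then show ?case
    using B by (simp add: sets_kernel)
next
  case (Suc n)
  have *: "i + int (Suc n) + 1 = (i + 1) + int n + 1"
    by simp
  have "path_weight P (A((i + 1) + int n + 1 := B)) i (Suc (Suc n)) x =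
     (\<integral>\<^sup>+y\<in>A (i + 1). path_weight P (A((i + 1) + int n + 1 := B)) (i + 1) (Suc n) y \<partial>P x)"
    by simp
  also have "\<dots> = (\<integral>\<^sup>+y\<in>A (i + 1). path_integral P A (\<lambda>x. emeasure (P x) B) (i + 1) n y \<partial>P x)"
    by (intro nn_integral_cong) (simp only: space_kernel[OF Suc.prems] Suc.IH)
  finally show ?case
    unfolding * by (simp only: path_integral.simps)
qed

text \<open>Given the coordinates from \<open>i\<close> to \<open>i + n\<close>, the next one has
  law \<open>P\<close> at the last of them, tested on cylinders.\<close>

lemma markov_property_cylinder:
  assumes A: "\<And>k. A k \<in> sets M" and B: "B \<in> sets M"
  shows "emeasure N {x\<in>space N. (\<forall>k\<in>{i..i + int n}. x k \<in> A k) \<and> x (i + int n + 1) \<in> B} =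
    (\<integral>\<^sup>+x. emeasure (P (x (i + int n))) B * indicator {x\<in>space N. \<forall>k\<in>{i..i + int n}. x k \<in> A k} x \<partial>N)"
proof -
  let ?A = "A(i + int n + 1 := B)"
  have "{x\<in>space N. (\<forall>k\<in>{i..i + int n}. x k \<in> A k) \<and> x (i + int n + 1) \<in> B} =
      {x\<in>space N. \<forall>k\<in>{i..i + int (Suc n)}. x k \<in> ?A k}"
    by (auto 0 3)
  moreover have "\<And>k. ?A k \<in> sets M"
    using A B by simp
  ultimately have "emeasure N {x\<in>space N. (\<forall>k\<in>{i..i + int n}. x k \<in> A k) \<and> x (i + int n + 1) \<in> B} =
      (\<integral>\<^sup>+x\<in>?A i. path_weight P ?A i (Suc n) x \<partial>M)"
    by (simp only: emeasure_cylinder)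
  also have "\<dots> = (\<integral>\<^sup>+x\<in>A i. path_integral P A (\<lambda>x. emeasure (P x) B) i n x \<partial>M)"
    by (intro nn_integral_cong) (simp add: path_weight_Suc_last[OF _ B] del: path_weight.simps)
  also have "\<dots> = (\<integral>\<^sup>+x. emeasure (P (x (i + int n))) B *
      indicator {x\<in>space N. \<forall>k\<in>{i..i + int n}. x k \<in> A k} x \<partial>N)"
    by (intro nn_integral_cylinder[symmetric] A measurable_emeasure_kernel[OF kernel_subprob B])
  finally show ?thesis .
qed

end

section \<open>Invariance of the past measure\<close>

context markov_path
begin

text \<open>The path measure is specified on intervals of times, while uniqueness of measures is
  tested on arbitrary finite \<open>J\<close>. Filling the gaps with \<open>space M\<close> turns
  the latter into the former.\<close>

lemma prod_emb_eq_window: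
  assumes "J \<subseteq> {- int n..int n}" "J \<subseteq> I"
  shows "prod_emb I (\<lambda>_. M) J (Pi\<^sub>E J A) =
    {x\<in>\<Pi>\<^sub>E k\<in>I. space M. \<forall>k\<in>{- int n..int n} \<inter> I. x k \<in> (if k \<in> J then A k else space M)}"
proof (intro set_eqI iffI)
  fix x assume x: "x \<in> prod_emb I (\<lambda>_. M) J (Pi\<^sub>E J A)"
  then have "x \<in> (\<Pi>\<^sub>E k\<in>I. space M)" "\<And>k. k \<in> J \<Longrightarrow> x k \<in> A k"
    by (auto simp: prod_emb_def PiE_iff)
  then show "x \<in> {x\<in>\<Pi>\<^sub>E k\<in>I. space M. \<forall>k\<in>{- int n..int n} \<inter> I. x k \<in> (if k \<in> J then A k else space M)}"
    by (auto simp: PiE_iff)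
next
  fix x assume x: "x \<in> {x\<in>\<Pi>\<^sub>E k\<in>I. space M. \<forall>k\<in>{- int n..int n} \<inter> I. x k \<in> (if k \<in> J then A k else space M)}"
  then have "x k \<in> A k" if "k \<in> J" for k
    using that assms by (auto dest!: bspec[of _ _ k])
  then show "x \<in> prod_emb I (\<lambda>_. M) J (Pi\<^sub>E J A)"
    using x by (auto simp: prod_emb_def PiE_iff)
qed

lemma path_weight_shift:
  "path_weight P (\<lambda>k. A (k - a)) (i + a) n x = path_weight P A i n x"
proof (induction n arbitrary: i x)
  case (Suc n)
  have *: "i + a + 1 = (i + 1) + a"
    by simp
  show ?case
    unfolding path_weight.simps * Suc by simp
qed simp

lemma measurable_shift_by [measurable]: "shift_by a \<in> measurable N N"
proof -
  have "(\<lambda>x k. x (k + a)) \<in> measurable N (\<Pi>\<^sub>M k\<in>(UNIV :: int set). M)"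
    by (rule measurable_PiM_single') (auto simp: space_N PiE_iff)
  then show ?thesis
    unfolding shift_by_def by (simp cong: measurable_cong_sets add: sets_N)
qed

lemma shift_by_space: "x \<in> space N \<Longrightarrow> shift_by a x \<in> space N"
  using measurable_space[OF measurable_shift_by] .

lemma emeasure_cylinder_shift:
  assumes A: "\<And>k. A k \<in> sets M"
  shows "emeasure N {x\<in>space N. \<forall>k\<in>{i..i + int n}. x (k + a) \<in> A k} =
    emeasure N {x\<in>space N. \<forall>k\<in>{i..i + int n}. x k \<in> A k}"
proof -
  have "(\<forall>k\<in>{i..i + int n}. x (k + a) \<in> A k) \<longleftrightarrow>
      (\<forall>k\<in>{i + a..i + a + int n}. x k \<in> A (k - a))" for x :: "int \<Rightarrow> 'a"
  proof safe
    fix k assume *: "\<forall>k\<in>{i..i + int n}. x (k + a) \<in> A k" "k \<in> {i + a..i + a + int n}"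
    then have "k - a \<in> {i..i + int n}"
      by auto
    with *(1) have "x (k - a + a) \<in> A (k - a)"
      by blast
    then show "x k \<in> A (k - a)"
      by simp
  next
    fix k assume *: "\<forall>k\<in>{i + a..i + a + int n}. x k \<in> A (k - a)" "k \<in> {i..i + int n}"
    then have "k + a \<in> {i + a..i + a + int n}"
      by auto
    with *(1) have "x (k + a) \<in> A (k + a - a)"
      by blast
    then show "x (k + a) \<in> A k"
      by simp
  qed
  then have "emeasure N {x\<in>space N. \<forall>k\<in>{i..i + int n}. x (k + a) \<in> A k} =
      (\<integral>\<^sup>+x\<in>A (i + a - a). path_weight P (\<lambda>k. A (k - a)) (i + a) n x \<partial>M)"
    by (simp only: emeasure_cylinder[of "\<lambda>k. A (k - a)", OF A])
  also have "\<dots> = emeasure N {x\<in>space N. \<forall>k\<in>{i..i + int n}. x k \<in> A k}"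
    by (simp add: path_weight_shift emeasure_cylinder A)
  finally show ?thesis .
qed

text \<open>Every cylinder formula starts from \<open>M\<close> with the same kernel, whatever the
  initial time, so a shift only relabels the sets of a cylinder; cylinders determine the measure.
  The amount \<open>a\<close> may be negative, which the later arguments exploit.\<close>

lemma distr_shift_by: "distr N N (shift_by a) = N"
proof (rule measure_eqI_PiM_infinite[where I = UNIV and M = "\<lambda>_. M"])
  show "finite_measure (distr N N (shift_by a))"
    by (intro prob_space.finite_measure N.prob_space_distr measurable_shift_by)
  fix A :: "int \<Rightarrow> 'a set" and J :: "int set"
  assume J: "finite J" and A: "\<And>i. i \<in> J \<Longrightarrow> A i \<in> sets M"
  obtain n where n: "J \<subseteq> {- int n..int n}"
    using J by (rule finite_int_subset_window)
  define B where "B k = (if k \<in> J then A k else space M)" for k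
  have B: "\<And>k. B k \<in> sets M"
    using A by (simp add: B_def)
  have emb: "prod_emb UNIV (\<lambda>_. M) J (Pi\<^sub>E J A) =
      {x\<in>space N. \<forall>k\<in>{- int n..- int n + int (2 * n)}. x k \<in> B k}"
    by (subst prod_emb_eq_window[OF n subset_UNIV]) (simp add: space_N B_def)
  have "emeasure (distr N N (shift_by a)) (prod_emb UNIV (\<lambda>_. M) J (Pi\<^sub>E J A)) =
      emeasure N (shift_by a -` {x\<in>space N. \<forall>k\<in>{- int n..- int n + int (2 * n)}. x k \<in> B k} \<inter> space N)"
    unfolding emb by (intro emeasure_distr measurable_shift_by cylinder_in_sets B)
  also have "shift_by a -` {x\<in>space N. \<forall>k\<in>{- int n..- int n + int (2 * n)}. x k \<in> B k} \<inter> space N =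
      {x\<in>space N. \<forall>k\<in>{- int n..- int n + int (2 * n)}. x (k + a) \<in> B k}"
    by (auto simp: shift_by_space) (auto simp: shift_by_def)
  also have "emeasure N \<dots> = emeasure N (prod_emb UNIV (\<lambda>_. M) J (Pi\<^sub>E J A))"
    unfolding emb by (rule emeasure_cylinder_shift[OF B])
  finally show "emeasure (distr N N (shift_by a)) (prod_emb UNIV (\<lambda>_. M) J (Pi\<^sub>E J A)) =
    emeasure N (prod_emb UNIV (\<lambda>_. M) J (Pi\<^sub>E J A))" .
qed (simp_all add: sets_N)

lemma integral_shift_by:
  fixes f :: "(int \<Rightarrow> 'a) \<Rightarrow> real"
  assumes "f \<in> borel_measurable N"
  shows "(\<integral>x. f (shift_by a x) \<partial>N) = (\<integral>x. f x \<partial>N)"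
  using integral_distr[OF measurable_shift_by assms, of a] by (simp add: distr_shift_by)

lemma AE_shift_by:
  assumes "AE x in N. Q x"
  shows "AE x in N. Q (shift_by a x)"
proof (rule AE_distrD[OF measurable_shift_by])
  show "AE x in distr N N (shift_by a). Q x"
    unfolding distr_shift_by by (rule assms)
qed

section \<open>The kernel on past paths, its invariant measure and its duality with
  \<open>delay\<close>\<close>

abbreviation "past_sp \<equiv> past_space M"
abbreviation "mu \<equiv> past_measure M N"
abbreviation "K \<equiv> past_kernel M P"

lemma space_past: "space past_sp = (\<Pi>\<^sub>E k\<in>{..0}. space M)"
  by (simp add: past_space_def space_PiM)

lemma measurable_past [measurable]: "past \<in> measurable N past_sp"
  unfolding past_def past_space_def by (intro measurable_restrict measurable_coord)

lemma past_in_space: "x \<in> space N \<Longrightarrow> past x \<in> space past_sp"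
  using measurable_space[OF measurable_past] .

lemma measurable_past_coord [measurable]: "k \<le> 0 \<Longrightarrow> (\<lambda>p. p k) \<in> measurable past_sp M"
  unfolding past_space_def by (rule measurable_component_singleton) simp

lemma measurable_delay [measurable]: "delay \<in> measurable past_sp past_sp"
  unfolding delay_def past_space_def
  by (intro measurable_restrict) (use measurable_past_coord in \<open>auto simp: past_space_def\<close>)

lemma mu_eq: "mu = distr N past_sp past"
  by (simp add: past_measure_def past_def[abs_def])

lemma sets_mu [measurable_cong, simp]: "sets mu = sets past_sp"
  and space_mu [simp]: "space mu = space past_sp"
  by (simp_all add: mu_eq)

sublocale mu: prob_space mu
  unfolding mu_eq by (rule N.prob_space_distr) measurable

lemma measurable_mu [simp]: "measurable mu L = measurable past_sp L"
  by (rule measurable_cong_sets) simp_all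

lemma integral_mu:
  fixes f :: "(int \<Rightarrow> 'a) \<Rightarrow> real"
  assumes "f \<in> borel_measurable past_sp"
  shows "(\<integral>p. f p \<partial>mu) = (\<integral>x. f (past x) \<partial>N)"
  unfolding mu_eq using assms by (intro integral_distr) measurable

abbreviation extend_past :: "(int \<Rightarrow> 'a) \<Rightarrow> 'a \<Rightarrow> int \<Rightarrow> 'a" where
  "extend_past x y \<equiv> \<lambda>k\<in>{..0}. if k = 0 then y else x (k + 1)"

lemma measurable_extend_past: "(\<lambda>(x, y). extend_past x y) \<in> measurable (past_sp \<Otimes>\<^sub>M M) past_sp"
  unfolding past_space_def case_prod_beta
proof (rule measurable_restrict)
  fix k :: int assume "k \<in> {..0}"
  then show "(\<lambda>x. if k = 0 then snd x else fst x (k + 1)) \<in> (\<Pi>\<^sub>M k\<in>{..0}. M) \<Otimes>\<^sub>M M \<rightarrow>\<^sub>M M"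
    by (cases "k = 0") (auto intro!: measurable_compose[OF measurable_fst measurable_component_singleton])
qed

lemma past_kernel_measurable [measurable]: "K \<in> measurable past_sp (prob_algebra past_sp)"
proof -
  have "(\<lambda>x. P (x 0)) \<in> measurable past_sp (prob_algebra M)"
    by (rule measurable_compose[OF measurable_past_coord kernel]) simp
  from measurable_distr_prob_space2[OF this measurable_extend_past] show ?thesis
    by (simp add: past_kernel_def[abs_def])
qed

lemma past_kernel_subprob [measurable]: "K \<in> measurable past_sp (subprob_algebra past_sp)"
  by (rule measurable_prob_algebraD) (rule past_kernel_measurable)

lemma sets_past_kernel [simp]: "sets (K p) = sets past_sp"
  and space_past_kernel [simp]: "space (K p) = space past_sp"
  by (simp_all add: past_kernel_def)

lemma prob_past_kernel: "p \<in> space past_sp \<Longrightarrow> prob_space (K p)"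
  using measurable_space[OF past_kernel_measurable] by (auto simp: space_prob_algebra)

lemma measurable_extend_past_1:
  assumes "p \<in> space past_sp"
  shows "extend_past p \<in> measurable (P (p 0)) past_sp"
proof -
  have "p 0 \<in> space M"
    using assms measurable_space[OF measurable_past_coord[of 0]] by simp
  then show ?thesis
    using measurable_compose[OF measurable_Pair1'[OF assms] measurable_extend_past]
    by (simp add: measurable_kernel)
qed

lemma integral_past_kernel:
  fixes f :: "(int \<Rightarrow> 'a) \<Rightarrow> real"
  assumes "p \<in> space past_sp" "f \<in> borel_measurable past_sp"
  shows "(\<integral>q. f q \<partial>K p) = (\<integral>y. f (extend_past p y) \<partial>P (p 0))"
  unfolding past_kernel_def using assms by (intro integral_distr measurable_extend_past_1)

text \<open>A step of \<open>K\<close> loses no information: the old path can be read off the new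
  one. Hence \<open>v (delay q)\<close> is the constant \<open>v p\<close> when \<open>q\<close> is
  drawn from \<open>K p\<close>, the source of both the adjoint formula and the contraction.\<close>

lemma delay_extend_past:
  assumes "p \<in> space past_sp"
  shows "delay (extend_past p y) = p"
  using assms by (auto simp: delay_def space_past PiE_iff extensional_def fun_eq_iff)

lemma past_cylinder_in_sets:
  assumes A: "\<And>k. A k \<in> sets M"
  shows "{p\<in>space past_sp. \<forall>k\<in>{i..0}. p k \<in> A k} \<in> sets past_sp"
proof (rule sets.sets_Collect_finite_All)
  fix k :: int assume "k \<in> {i..0}"
  then have "(\<lambda>p. p k) -` A k \<inter> space past_sp \<in> sets past_sp"
    using A by (intro measurable_sets[OF measurable_past_coord]) auto
  then show "{p\<in>space past_sp. p k \<in> A k} \<in> sets past_sp"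
    by (simp add: vimage_def Int_def conj_commute)
qed simp

text \<open>Only coordinate 0 of the new path is random; its coordinate \<open>k < 0\<close> is
  coordinate \<open>k + 1\<close> of the old one, hence the window that is one shorter.\<close>

lemma emeasure_past_kernel_cylinder:
  assumes A: "\<And>k. A k \<in> sets M" and x: "x \<in> space N"
  shows "emeasure (K (past x)) {p\<in>space past_sp. \<forall>k\<in>{- int n..0}. p k \<in> A k} =
    emeasure (P (x 0)) (A 0) * indicator {x\<in>space N. \<forall>k\<in>{1 - int n..0}. x k \<in> A (k - 1)} x"
proof -
  let ?C = "{p\<in>space past_sp. \<forall>k\<in>{- int n..0}. p k \<in> A k}"
  have [measurable]: "?C \<in> sets past_sp"
    using A by (rule past_cylinder_in_sets)
  have "emeasure (K (past x)) ?C = emeasure (P (x 0)) (extend_past (past x) -` ?C \<inter> space (P (x 0)))"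
    unfolding past_kernel_def
    using measurable_extend_past_1[OF past_in_space[OF x]]
    by (subst emeasure_distr) (auto simp: past_def)
  also have "extend_past (past x) -` ?C \<inter> space (P (x 0)) =
      (if x \<in> {x\<in>space N. \<forall>k\<in>{1 - int n..0}. x k \<in> A (k - 1)} then A 0 else {})"
    (is "?L = ?R")
  proof (intro set_eqI)
    fix y
    have *: "(\<forall>k\<in>{1 - int n..0}. x k \<in> A (k - 1)) \<longleftrightarrow> (\<forall>k\<in>{- int n..-1}. x (k + 1) \<in> A k)"
    proof safe
      fix k assume "\<forall>k\<in>{1 - int n..0}. x k \<in> A (k - 1)" "k \<in> {- int n..-1}"
      then show "x (k + 1) \<in> A k"
        by (auto dest!: bspec[of _ _ "k + 1"])
    next
      fix k assume "\<forall>k\<in>{- int n..-1}. x (k + 1) \<in> A k" "k \<in> {1 - int n..0}"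
      then show "x k \<in> A (k - 1)"
        by (auto dest!: bspec[of _ _ "k - 1"])
    qed
    have "y \<in> ?L \<longleftrightarrow> y \<in> space M \<and> (\<forall>k\<in>{- int n..0}. (if k = 0 then y else x (k + 1)) \<in> A k)"
      using measurable_space[OF measurable_extend_past_1[OF past_in_space[OF x]], of y]
      by (auto simp: space_kernel[OF coord_space[OF x]] past_def)
    also have "\<dots> \<longleftrightarrow> y \<in> A 0 \<and> (\<forall>k\<in>{- int n..-1}. x (k + 1) \<in> A k)"
      using sets.sets_into_space[OF A[of 0]] by (auto 0 3 split: if_splits)
    finally show "y \<in> ?L \<longleftrightarrow> y \<in> ?R"
      using x by (auto simp: *)
  qed
  also have "emeasure (P (x 0)) \<dots> =
      emeasure (P (x 0)) (A 0) * indicator {x\<in>space N. \<forall>k\<in>{1 - int n..0}. x k \<in> A (k - 1)} x"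
    by (simp add: indicator_def)
  finally show ?thesis .
qed

text \<open>A step of \<open>K\<close> turns the past of a path up to time 0 into its past up to
  time 1, in law; stationarity identifies the two.\<close>

lemma past_kernel_invariant: "mu \<bind> K = mu"
proof (rule sym, rule measure_eqI_PiM_infinite[where I = "{..0}" and M = "\<lambda>_. M"])
  have ne: "space mu \<noteq> {}"
    using mu.not_empty by simp
  have K': "K \<in> measurable mu (subprob_algebra past_sp)"
    by simp
  show 1: "sets (mu \<bind> K) = sets (\<Pi>\<^sub>M k\<in>{..0}. M)"
    using sets_bind[OF _ ne, of K past_sp] by (simp add: past_space_def)
  show "sets mu = sets (\<Pi>\<^sub>M k\<in>{..0}. M)"
    by (simp add: past_space_def)
  show "finite_measure mu"
    by (rule mu.finite_measure_axioms)
  fix A :: "int \<Rightarrow> 'a set" and J :: "int set"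
  assume J: "finite J" "J \<subseteq> {..0}" and A: "\<And>i. i \<in> J \<Longrightarrow> A i \<in> sets M"
  obtain n' where n': "J \<subseteq> {- int n'..int n'}"
    using J(1) by (rule finite_int_subset_window)
  \<comment> \<open>One more than the window requires, so that the condition left on the old path,
    on \<open>{- int n'..0}\<close>, reaches time 0, where the Markov property is applied.\<close>
  define n where "n = Suc n'"
  have n: "J \<subseteq> {- int n..int n}"
    using n' by (auto simp: n_def)
  define B where "B k = (if k \<in> J then A k else space M)" for k
  have B: "\<And>k. B k \<in> sets M"
    using A by (simp add: B_def)
  let ?X = "{p\<in>space past_sp. \<forall>k\<in>{- int n..0}. p k \<in> B k}"
  have "{- int n..int n} \<inter> {..0} = {- int n..0}"
    by auto
  then have emb: "prod_emb {..0} (\<lambda>_. M) J (Pi\<^sub>E J A) = ?X"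
    by (subst prod_emb_eq_window[OF n J(2)]) (simp add: space_past B_def)
  have X [measurable]: "?X \<in> sets past_sp"
    using B by (rule past_cylinder_in_sets)
  have eq: "- int n' + int n' + 1 = 1" "- int n' + int n' = 0" "1 - int n = - int n'"
    by (simp_all add: n_def)
  have "emeasure (mu \<bind> K) ?X = (\<integral>\<^sup>+p. emeasure (K p) ?X \<partial>mu)"
    by (rule emeasure_bind[OF ne K' X])
  also have "\<dots> = (\<integral>\<^sup>+x. emeasure (K (past x)) ?X \<partial>N)"
    unfolding mu_eq
    by (rule nn_integral_distr[OF measurable_past])
       (simp add: measurable_emeasure_kernel[OF past_kernel_subprob X])
  also have "\<dots> = (\<integral>\<^sup>+x. emeasure (P (x 0)) (B 0) *
      indicator {x\<in>space N. \<forall>k\<in>{- int n'..0}. x k \<in> B (k - 1)} x \<partial>N)"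
    using emeasure_past_kernel_cylinder[of B _ n, OF B] by (intro nn_integral_cong) (simp add: eq)
  also have "\<dots> = emeasure N {x\<in>space N. (\<forall>k\<in>{- int n'..0}. x k \<in> B (k - 1)) \<and> x 1 \<in> B 0}"
    using markov_property_cylinder[of "\<lambda>k. B (k - 1)" "B 0" "- int n'" n', OF B B] unfolding eq by simp
  also have "{x\<in>space N. (\<forall>k\<in>{- int n'..0}. x k \<in> B (k - 1)) \<and> x 1 \<in> B 0} =
      {x\<in>space N. \<forall>k\<in>{- int n..- int n + int n}. x (k + 1) \<in> B k}"
    (is "?L = ?R")
  proof (intro set_eqI iffI)
    fix x assume x: "x \<in> ?L"
    then have "x (k + 1) \<in> B k" if "k \<in> {- int n..- int n + int n}" for k
      using that by (cases "k = 0") (auto simp: n_def dest!: bspec[of _ _ "k + 1"])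
    then show "x \<in> ?R"
      using x by simp
  next
    fix x assume x: "x \<in> ?R"
    then have "\<forall>k\<in>{- int n..- int n + int n}. x (k + 1) \<in> B k"
      by simp
    from this[THEN bspec, of 0] this[THEN bspec, of "k - 1" for k] show "x \<in> ?L"
      using x by (auto simp: n_def)
  qed
  also have "emeasure N \<dots> = emeasure N {x\<in>space N. \<forall>k\<in>{- int n..- int n + int n}. x k \<in> B k}"
    by (rule emeasure_cylinder_shift[OF B])
  also have "{x\<in>space N. \<forall>k\<in>{- int n..- int n + int n}. x k \<in> B k} = past -` ?X \<inter> space N"
    by (auto simp: past_in_space) (auto simp: past_def)
  also have "emeasure N \<dots> = emeasure mu ?X"
    unfolding mu_eq by (intro emeasure_distr[symmetric] measurable_past X)
  finally show "emeasure mu (prod_emb {..0} (\<lambda>_. M) J (Pi\<^sub>E J A)) =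
      emeasure (mu \<bind> K) (prod_emb {..0} (\<lambda>_. M) J (Pi\<^sub>E J A))"
    unfolding emb by (rule sym)
qed

lemma integral_past_kernel_op:
  fixes f :: "(int \<Rightarrow> 'a) \<Rightarrow> real"
  assumes f: "f \<in> borel_measurable past_sp" and bounded: "\<And>p. p \<in> space past_sp \<Longrightarrow> \<bar>f p\<bar> \<le> c"
  shows "(\<integral>p. (\<integral>q. f q \<partial>K p) \<partial>mu) = (\<integral>p. f p \<partial>mu)"
proof -
  have "(\<integral>p. f p \<partial>(mu \<bind> K)) = (\<integral>p. (\<integral>q. f q \<partial>K p) \<partial>mu)"
  proof (rule integral_bind[where K = past_sp and B = c and B' = 1])
    show "AE p in mu. emeasure (K p) (space (K p)) \<le> ennreal 1"
      using prob_space.emeasure_space_1[OF prob_past_kernel] by (intro AE_I2) simp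
  qed (use f bounded mu.finite_measure_axioms in simp_all)
  then show ?thesis
    by (simp add: past_kernel_invariant)
qed

lemma kernel_op_K_unit:
  "g \<in> unit_functions past_sp \<Longrightarrow> kernel_op K g \<in> unit_functions past_sp"
  by (rule kernel_op_unit_function[OF past_kernel_measurable])

lemma funpow_kernel_op_K_unit:
  "g \<in> unit_functions past_sp \<Longrightarrow> (kernel_op K ^^ n) g \<in> unit_functions past_sp"
  by (rule kernel_op_funpow_unit_function[OF past_kernel_measurable])

lemma integrable_K:
  fixes f :: "(int \<Rightarrow> 'a) \<Rightarrow> real"
  assumes "p \<in> space past_sp" "f \<in> borel_measurable past_sp" "\<And>q. q \<in> space past_sp \<Longrightarrow> \<bar>f q\<bar> \<le> c"
  shows "integrable (K p) f"
proof -
  interpret Kp: prob_space "K p"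
    using assms(1) by (rule prob_past_kernel)
  have "f \<in> borel_measurable (K p)"
    using assms(2) measurable_cong_sets[OF sets_past_kernel refl] by blast
  then show ?thesis
    using assms(3) by (intro Kp.integrable_const_bound[of _ c] AE_I2) auto
qed

text \<open>By invariance the right side may be averaged over \<open>K p\<close> first, and there
  the factor \<open>v (delay q)\<close> is constant. This is the weak form of saying that
  \<open>kernel_op K g\<close> is the conditional expectation of \<open>g\<close> one step ahead,
  given the past.\<close>

lemma kernel_op_adjoint:
  assumes g: "g \<in> unit_functions past_sp" and v: "v \<in> unit_functions past_sp"
  shows "(\<integral>p. kernel_op K g p * v p \<partial>mu) = (\<integral>p. g p * v (delay p) \<partial>mu)"
proof -
  note g' = unit_functionsD[OF g] and v' = unit_functionsD[OF v]
  have [measurable]: "g \<in> borel_measurable past_sp" "v \<in> borel_measurable past_sp"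
    by (fact g'(1) v'(1))+
  have dl: "delay p \<in> space past_sp" if "p \<in> space past_sp" for p
    using measurable_space[OF measurable_delay that] .
  have "(\<integral>p. g p * v (delay p) \<partial>mu) = (\<integral>p. (\<integral>q. g q * v (delay q) \<partial>K p) \<partial>mu)"
  proof (rule integral_past_kernel_op[of _ 1, symmetric])
    show "\<bar>g p * v (delay p)\<bar> \<le> 1" if "p \<in> space past_sp" for p
      using g'(2,3)[OF that] v'(2,3)[OF dl[OF that]] by (auto simp: abs_mult intro!: mult_le_one)
  qed measurable
  also have "\<dots> = (\<integral>p. kernel_op K g p * v p \<partial>mu)"
  proof (rule Bochner_Integration.integral_cong[OF refl])
    fix p assume "p \<in> space mu"
    then have p: "p \<in> space past_sp"
      by simp
    have "(\<integral>q. g q * v (delay q) \<partial>K p) = (\<integral>y. g (extend_past p y) * v p \<partial>P (p 0))"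
      using p by (subst integral_past_kernel) (simp_all add: delay_extend_past)
    also have "\<dots> = (\<integral>y. g (extend_past p y) \<partial>P (p 0)) * v p"
      by simp
    also have "(\<integral>y. g (extend_past p y) \<partial>P (p 0)) = kernel_op K g p"
      unfolding kernel_op_def using p by (simp add: integral_past_kernel)
    finally show "(\<integral>q. g q * v (delay q) \<partial>K p) = kernel_op K g p * v p" .
  qed
  finally show ?thesis
    by simp
qed

text \<open>Subtracting \<open>v p\<close> commutes with averaging over \<open>K p\<close>, because
  \<open>v p\<close> equals \<open>v (delay q)\<close> there. The absolute value moves inside the
  average, and invariance removes the kernel.\<close>

lemma kernel_op_contraction:
  assumes g: "g \<in> unit_functions past_sp" and v: "v \<in> unit_functions past_sp"
  shows "(\<integral>p. \<bar>kernel_op K g p - v p\<bar> \<partial>mu) \<le> (\<integral>p. \<bar>g p - v (delay p)\<bar> \<partial>mu)"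
proof -
  note g' = unit_functionsD[OF g] and v' = unit_functionsD[OF v]
  have [measurable]: "g \<in> borel_measurable past_sp" "v \<in> borel_measurable past_sp"
    by (fact g'(1) v'(1))+
  have Kg: "kernel_op K g \<in> unit_functions past_sp"
    using g by (rule kernel_op_K_unit)
  note Kg' = unit_functionsD[OF Kg]
  have [measurable]: "kernel_op K g \<in> borel_measurable past_sp"
    by (fact Kg'(1))
  have dl: "delay p \<in> space past_sp" if "p \<in> space past_sp" for p
    using measurable_space[OF measurable_delay that] .
  have bound: "\<bar>g p - v (delay p)\<bar> \<le> 1" if "p \<in> space past_sp" for p
    using g'(2,3)[OF that] v'(2,3)[OF dl[OF that]] by (auto simp: abs_le_iff)
  have meas: "(\<lambda>p. \<bar>g p - v (delay p)\<bar>) \<in> borel_measurable past_sp"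
    by measurable
  have le: "\<bar>kernel_op K g p - v p\<bar> \<le> (\<integral>q. \<bar>g q - v (delay q)\<bar> \<partial>K p)" if p: "p \<in> space past_sp" for p
  proof -
    interpret Kp: prob_space "K p"
      using p by (rule prob_past_kernel)
    have "integrable (K p) g"
      using g'(2,3) by (intro integrable_K[OF p g'(1), of 1]) (force simp: abs_le_iff)
    moreover have "Kp.prob (space past_sp) = 1"
      using Kp.prob_space by simp
    ultimately have "kernel_op K g p - v p = (\<integral>q. g q - v p \<partial>K p)"
      by (subst Bochner_Integration.integral_diff) (simp_all add: kernel_op_def)
    also have "\<bar>\<dots>\<bar> \<le> (\<integral>q. \<bar>g q - v p\<bar> \<partial>K p)"
      by (rule integral_abs_bound)
    also have "\<dots> = (\<integral>q. \<bar>g q - v (delay q)\<bar> \<partial>K p)"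
      using p by (simp add: integral_past_kernel delay_extend_past)
    finally show ?thesis .
  qed
  have "(\<integral>p. \<bar>kernel_op K g p - v p\<bar> \<partial>mu) \<le> (\<integral>p. (\<integral>q. \<bar>g q - v (delay q)\<bar> \<partial>K p) \<partial>mu)"
  proof (rule integral_mono)
    show "integrable mu (\<lambda>p. \<bar>kernel_op K g p - v p\<bar>)"
      using Kg'(2,3) v'(2,3) by (intro mu.integrable_const_bound[of _ 1] AE_I2) (force simp: abs_le_iff)+
    show "integrable mu (\<lambda>p. \<integral>q. \<bar>g q - v (delay q)\<bar> \<partial>K p)"
    proof (rule mu.integrable_const_bound[of _ 1])
      show "AE p in mu. norm (\<integral>q. \<bar>g q - v (delay q)\<bar> \<partial>K p) \<le> 1"
      proof (rule AE_I2)
        fix p assume "p \<in> space mu"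
        then have p: "p \<in> space past_sp"
          by simp
        interpret Kp: prob_space "K p"
          using p by (rule prob_past_kernel)
        have "(\<integral>q. \<bar>g q - v (delay q)\<bar> \<partial>K p) \<le> (\<integral>q. 1 \<partial>K p)"
          using bound by (intro integral_mono integrable_K[OF p meas, of 1]) auto
        then show "norm (\<integral>q. \<bar>g q - v (delay q)\<bar> \<partial>K p) \<le> 1"
          using Kp.prob_space by simp
      qed
      show "(\<lambda>p. \<integral>q. \<bar>g q - v (delay q)\<bar> \<partial>K p) \<in> borel_measurable mu"
        unfolding measurable_mu
        by (rule measurable_compose[OF past_kernel_subprob integral_measurable_subprob_algebra[OF meas]])
    qed
  qed (use le in simp)
  also have "\<dots> = (\<integral>p. \<bar>g p - v (delay p)\<bar> \<partial>mu)"
    using bound by (intro integral_past_kernel_op[OF meas, of 1]) simp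
  finally show ?thesis .
qed

end

section \<open>Tail sets as limits of functions of one coordinate\<close>

context markov_path
begin

lemma funpow_kernel_op_K_cong:
  assumes "\<And>p. p \<in> space past_sp \<Longrightarrow> f p = g p" "p \<in> space past_sp"
  shows "(kernel_op K ^^ n) f p = (kernel_op K ^^ n) g p"
  using assms(2)
proof (induction n arbitrary: p)
  case (Suc n)
  then show ?case
    by (auto simp: kernel_op_def intro!: Bochner_Integration.integral_cong)
qed (use assms(1) in simp)

text \<open>\<open>K\<close> draws the new coordinate 0 from \<open>P\<close> at the old one, so
  functions of coordinate 0 form a copy of the original system.\<close>

lemma kernel_op_lift:
  assumes G: "G \<in> unit_functions M" and p: "p \<in> space past_sp"
  shows "(kernel_op K ^^ n) (\<lambda>p. G (p 0)) p = (kernel_op P ^^ n) G (p 0)"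
  using p
proof (induction n arbitrary: p)
  case (Suc n)
  have PG: "(kernel_op P ^^ n) G \<in> unit_functions M"
    by (rule kernel_op_funpow_unit_function[OF kernel G])
  have meas: "(\<lambda>p. (kernel_op P ^^ n) G (p 0)) \<in> borel_measurable past_sp"
    by (rule measurable_compose[OF measurable_past_coord]) (use PG in auto)
  have "(kernel_op K ^^ Suc n) (\<lambda>p. G (p 0)) p = (\<integral>q. (kernel_op K ^^ n) (\<lambda>p. G (p 0)) q \<partial>K p)"
    by (simp add: kernel_op_def)
  also have "\<dots> = (\<integral>q. (kernel_op P ^^ n) G (q 0) \<partial>K p)"
    using Suc.IH by (intro Bochner_Integration.integral_cong) simp_all
  also have "\<dots> = (\<integral>y. (kernel_op P ^^ n) G y \<partial>P (p 0))"
    by (subst integral_past_kernel[OF Suc.prems meas]) simp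
  also have "\<dots> = (kernel_op P ^^ Suc n) G (p 0)"
    by (simp add: kernel_op_def)
  finally show ?case .
qed simp

lemma lift_unit:
  assumes "G \<in> unit_functions M"
  shows "(\<lambda>p. G (p 0)) \<in> unit_functions past_sp"
proof -
  have "G \<in> borel_measurable M" "G \<in> space M \<rightarrow> {0..1}"
    using assms by auto
  moreover have "p 0 \<in> space M" if "p \<in> space past_sp" for p
    using measurable_space[OF measurable_past_coord that] by simp
  ultimately show ?thesis
    by (auto intro!: measurable_compose[OF measurable_past_coord])
qed

text \<open>\<open>l\<close> counts the coordinates before time 0, so \<open>l = 0\<close> still
  admits coordinate 0. The condition is pointwise rather than in terms of sigma-algebras, so that
  such functions factor everywhere and not just almost everywhere.\<close>

definition depends_on_last :: "nat \<Rightarrow> ((int \<Rightarrow> 'a) \<Rightarrow> 'c) \<Rightarrow> bool" where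
  "depends_on_last l g \<longleftrightarrow>
     (\<forall>p\<in>space past_sp. \<forall>q\<in>space past_sp. (\<forall>k\<in>{- int l..0}. p k = q k) \<longrightarrow> g p = g q)"

lemma depends_on_last_mono:
  assumes "depends_on_last l g" "l \<le> l'"
  shows "depends_on_last l' g"
proof -
  have "{- int l..0} \<subseteq> {- int l'..0}"
    using assms(2) by auto
  then show ?thesis
    using assms(1) unfolding depends_on_last_def by blast
qed

lemma depends_on_last_compose:
  assumes "depends_on_last l g"
  shows "depends_on_last l (\<lambda>p. h (g p))"
  unfolding depends_on_last_def
  by (intro ballI impI arg_cong[of _ _ h]) (use assms in \<open>unfold depends_on_last_def, blast\<close>)

text \<open>The new coordinate 0 is integrated out, and coordinate \<open>- (l + 1)\<close> of the
  new path is coordinate \<open>- l\<close> of the old one: the window shrinks by one.\<close>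

lemma depends_on_last_kernel_op:
  assumes g: "g \<in> unit_functions past_sp" and dep: "depends_on_last (Suc l) g"
  shows "depends_on_last l (kernel_op K g)"
  unfolding depends_on_last_def
proof (intro ballI impI)
  fix p q assume p: "p \<in> space past_sp" and q: "q \<in> space past_sp"
    and eq: "\<forall>k\<in>{- int l..0}. p k = q k"
  have [measurable]: "g \<in> borel_measurable past_sp"
    using g by simp
  have eq0: "p 0 = q 0"
    using eq by simp
  have p0: "p 0 \<in> space M"
    using measurable_space[OF measurable_past_coord p] by simp
  have "g (extend_past p y) = g (extend_past q y)" if y: "y \<in> space (P (p 0))" for y
  proof (rule dep[unfolded depends_on_last_def, rule_format])
    show "extend_past p y \<in> space past_sp"
      using measurable_space[OF measurable_extend_past_1[OF p] y] .
    show "extend_past q y \<in> space past_sp"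
      using measurable_space[OF measurable_extend_past_1[OF q]] y by (simp add: eq0)
    fix k assume "k \<in> {- int (Suc l)..0}"
    then show "extend_past p y k = extend_past q y k"
      using eq by auto
  qed
  then show "kernel_op K g p = kernel_op K g q"
    unfolding kernel_op_def using p q
    by (simp add: integral_past_kernel eq0[symmetric] cong: Bochner_Integration.integral_cong)
qed

lemma depends_on_last_funpow:
  assumes "g \<in> unit_functions past_sp" "depends_on_last l g"
  shows "depends_on_last 0 ((kernel_op K ^^ l) g)"
  using assms
proof (induction l arbitrary: g)
  case (Suc l)
  have "depends_on_last 0 ((kernel_op K ^^ l) (kernel_op K g))"
    by (intro Suc.IH kernel_op_K_unit depends_on_last_kernel_op Suc.prems)
  then show ?case
    by (simp add: funpow_swap1)
qed simp

lemma depends_on_last_0_obtain: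
  assumes g: "g \<in> unit_functions past_sp" and dep: "depends_on_last 0 g"
  obtains G where "G \<in> unit_functions M" "\<And>p. p \<in> space past_sp \<Longrightarrow> g p = G (p 0)"
proof
  \<comment> \<open>The constant path is a measurable section of the map to coordinate 0, so
    evaluating \<open>g\<close> along it yields the factor.\<close>
  let ?c = "\<lambda>x. \<lambda>k\<in>{..0::int}. x"
  have c [measurable]: "?c \<in> measurable M past_sp"
    unfolding past_space_def by measurable
  have gm: "g \<in> borel_measurable past_sp" and gr: "g \<in> space past_sp \<rightarrow> {0..1}"
    using g by auto
  have "(\<lambda>x. g (?c x)) \<in> borel_measurable M"
    by (rule measurable_compose[OF c gm])
  moreover have "g (?c x) \<in> {0..1}" if "x \<in> space M" for x
    by (rule funcset_mem[OF gr measurable_space[OF c that]])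
  ultimately show "(\<lambda>x. g (?c x)) \<in> unit_functions M"
    by auto
  fix p assume p: "p \<in> space past_sp"
  then have "p 0 \<in> space M"
    using measurable_space[OF measurable_past_coord p] by simp
  then have "?c (p 0) \<in> space past_sp"
    using measurable_space[OF c] by blast
  moreover have "\<forall>k\<in>{- int 0..0}. p k = ?c (p 0) k"
    by auto
  ultimately show "g p = g (?c (p 0))"
    using dep p unfolding depends_on_last_def by blast
qed

section \<open>Approximation by events of a finite window\<close>

lemma sets_past_eq: "sets past_sp =
    sigma_sets (space past_sp) {{p\<in>space past_sp. p k \<in> A} | k A. k \<in> {..0} \<and> A \<in> sets M}"
  unfolding past_space_def sets_PiM_single space_PiM ..

text \<open>The approximable sets contain the generators and are closed under complements and
  countable unions; a union is first cut off at a finite stage.\<close>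

lemma window_approximation:
  assumes "D \<in> sets past_sp" "e > 0"
  shows "\<exists>W\<in>sets past_sp. \<exists>l. depends_on_last l (\<lambda>p. p \<in> W) \<and> measure mu ((W - D) \<union> (D - W)) < e"
  using assms(1)[unfolded sets_past_eq] assms(2)
proof (induction arbitrary: e rule: sigma_sets.induct)
  case (Basic D)
  then obtain k A where k: "k \<le> 0" "A \<in> sets M" "D = {p\<in>space past_sp. p k \<in> A}"
    by auto
  have "D \<in> sets past_sp"
    using Basic by (auto simp: sets_past_eq)
  moreover have "depends_on_last (nat (- k)) (\<lambda>p. p \<in> D)"
    using k by (auto simp: depends_on_last_def)
  ultimately show ?case
    using Basic(2) by (intro bexI[of _ D] exI[of _ "nat (- k)"]) auto
next
  case Empty
  then show ?case
    by (intro bexI[of _ "{}"] exI[of _ 0]) (auto simp: depends_on_last_def)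
next
  case (Compl D)
  obtain W l where W: "W \<in> sets past_sp" "depends_on_last l (\<lambda>p. p \<in> W)"
      "measure mu ((W - D) \<union> (D - W)) < e"
    using Compl.IH[OF Compl.prems] by blast
  have D: "D \<subseteq> space past_sp"
    using Compl.hyps sets.sets_into_space[of D past_sp] by (simp add: sets_past_eq)
  have Ws: "W \<subseteq> space past_sp"
    using W(1) by (rule sets.sets_into_space)
  have "((space past_sp - W) - (space past_sp - D)) \<union> ((space past_sp - D) - (space past_sp - W)) =
      (W - D) \<union> (D - W)"
    using D Ws by auto
  moreover have "depends_on_last l (\<lambda>p. p \<in> space past_sp - W)"
    using W(2) unfolding depends_on_last_def by blast
  moreover have "space past_sp - W \<in> sets past_sp"
    using W(1) by blast
  ultimately show ?case
    using W(3) by metis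
next
  case (Union D)
  have Dm: "D i \<in> sets past_sp" for i
    using Union.hyps by (simp add: sets_past_eq)
  then have Dmu: "range D \<subseteq> sets mu"
    by auto
  let ?U = "\<lambda>n. \<Union>i<n. D i"
  have "incseq ?U"
    by (intro incseq_SucI UN_mono) auto
  then have "(\<lambda>n. measure mu (?U n)) \<longlonglongrightarrow> measure mu (\<Union>n. ?U n)"
    using Dm by (intro mu.finite_Lim_measure_incseq) auto
  also have "(\<Union>n. ?U n) = (\<Union>i. D i)"
    by auto
  finally have "\<forall>\<^sub>F n in sequentially. dist (measure mu (?U n)) (measure mu (\<Union>i. D i)) < e / 2"
    using Union.prems by (intro tendstoD) simp_all
  then obtain n where n: "dist (measure mu (?U n)) (measure mu (\<Union>i. D i)) < e / 2"
    by (auto simp: eventually_sequentially)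
  have "measure mu ((\<Union>i. D i) - ?U n) = measure mu (\<Union>i. D i) - measure mu (?U n)"
    using Dm by (intro mu.finite_measure_Diff) auto
  with n have n': "measure mu ((\<Union>i. D i) - ?U n) < e / 2"
    unfolding dist_real_def by linarith
  \<comment> \<open>The \<open>n\<close> approximations may together cost \<open>e / 2\<close>;
    \<open>Suc n\<close> keeps the quotient meaningful for \<open>n = 0\<close>.\<close>
  define d where "d = e / (2 * real (Suc n))"
  have "d > 0"
    using Union.prems by (simp add: d_def)
  then have "\<forall>i. \<exists>W l. W \<in> sets past_sp \<and> depends_on_last l (\<lambda>p. p \<in> W) \<and>
      measure mu ((W - D i) \<union> (D i - W)) < d"
    using Union.IH by blast
  then obtain W l where W: "\<And>i. W i \<in> sets past_sp" "\<And>i. depends_on_last (l i) (\<lambda>p. p \<in> W i)"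
      "\<And>i. measure mu ((W i - D i) \<union> (D i - W i)) < d"
    by metis
  \<comment> \<open>The sum of the window lengths serves as a common upper bound for them.\<close>
  let ?W = "\<Union>i<n. W i" and ?l = "\<Sum>i<n. l i"
  have "depends_on_last ?l (\<lambda>p. p \<in> ?W)"
  proof -
    have "depends_on_last ?l (\<lambda>p. p \<in> W i)" if "i < n" for i
      using that by (intro depends_on_last_mono[OF W(2)[of i]] member_le_sum) auto
    then have eq: "p \<in> W i \<longleftrightarrow> q \<in> W i"
      if "i < n" "p \<in> space past_sp" "q \<in> space past_sp" "\<forall>k\<in>{- int ?l..0}. p k = q k" for i p q
      using that unfolding depends_on_last_def by blast
    show ?thesis
      unfolding depends_on_last_def
    proof (intro ballI impI)
      fix p q assume "p \<in> space past_sp" "q \<in> space past_sp" "\<forall>k\<in>{- int ?l..0}. p k = q k"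
      from eq[OF _ this] show "(p \<in> ?W) = (q \<in> ?W)"
        by blast
    qed
  qed
  moreover have "measure mu ((?W - (\<Union>i. D i)) \<union> ((\<Union>i. D i) - ?W)) < e"
  proof -
    have "measure mu ((?W - (\<Union>i. D i)) \<union> ((\<Union>i. D i) - ?W)) \<le>
        measure mu (((\<Union>i. D i) - ?U n) \<union> (\<Union>i<n. (W i - D i) \<union> (D i - W i)))"
      using Dm W(1) by (intro mu.finite_measure_mono) (auto intro!: sets.Un sets.finite_UN)
    also have "\<dots> \<le> measure mu ((\<Union>i. D i) - ?U n) + measure mu (\<Union>i<n. (W i - D i) \<union> (D i - W i))"
      using Dm W(1) by (intro measure_Un_le) auto
    also have "measure mu (\<Union>i<n. (W i - D i) \<union> (D i - W i)) \<le>
        (\<Sum>i<n. measure mu ((W i - D i) \<union> (D i - W i)))"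
      using Dm W(1) by (intro mu.finite_measure_subadditive_finite) auto
    also have "\<dots> \<le> (\<Sum>i<n. d)"
      using W(3) by (intro sum_mono less_imp_le)
    also have "\<dots> = n * d"
      by simp
    also have "\<dots> \<le> e / 2"
      using Union.prems by (simp add: d_def field_simps)
    finally show ?thesis
      using n' by simp
  qed
  moreover have "?W \<in> sets past_sp"
    using W(1) by auto
  ultimately show ?case
    by blast
qed

text \<open>Moves the time origin to \<open>m\<close>. With \<open>m = - n\<close> it shows that,
  for a tail set \<open>C\<close>, whether the forward shift of \<open>x\<close> by \<open>n\<close>
  lies in \<open>C\<close> is decided by the past of \<open>x\<close>.\<close>

lemma sigma_upto_shift:
  assumes "C \<in> sigma_upto N M m"
  shows "\<exists>D\<in>sets past_sp. \<forall>x\<in>space N. shift_by (- m) x \<in> C \<longleftrightarrow> past x \<in> D"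
  using assms unfolding sigma_upto_def
proof (induction rule: sigma_sets.induct)
  case (Basic C)
  then obtain k A where k: "k \<le> m" "A \<in> sets M" "C = {x\<in>space N. x k \<in> A}"
    by auto
  let ?D = "{p\<in>space past_sp. p (k - m) \<in> A}"
  have "?D \<in> sets past_sp"
    using k unfolding sets_past_eq by (intro sigma_sets.Basic) force
  moreover have "\<forall>x\<in>space N. shift_by (- m) x \<in> C \<longleftrightarrow> past x \<in> ?D"
  proof
    fix x assume x: "x \<in> space N"
    have "shift_by (- m) x k = past x (k - m)"
      using k(1) by (simp add: shift_by_def past_def)
    then show "shift_by (- m) x \<in> C \<longleftrightarrow> past x \<in> ?D"
      using shift_by_space[OF x] past_in_space[OF x] by (simp add: k(3))
  qed
  ultimately show ?case
    by blast
next
  case Empty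
  then show ?case
    by (intro bexI[of _ "{}"]) auto
next
  case (Compl C)
  then obtain D where "D \<in> sets past_sp" "\<forall>x\<in>space N. shift_by (- m) x \<in> C \<longleftrightarrow> past x \<in> D"
    by blast
  then show ?case
    by (intro bexI[of _ "space past_sp - D"]) (auto simp: past_in_space shift_by_space)
next
  case (Union C)
  then have "\<forall>i. \<exists>D. D \<in> sets past_sp \<and> (\<forall>x\<in>space N. shift_by (- m) x \<in> C i \<longleftrightarrow> past x \<in> D)"
    by blast
  then obtain D where "\<And>i. D i \<in> sets past_sp" "\<And>i x. x \<in> space N \<Longrightarrow> shift_by (- m) x \<in> C i \<longleftrightarrow> past x \<in> D i"
    by metis
  then show ?case
    by (intro bexI[of _ "\<Union>i. D i"]) auto
qed

text \<open>Averaging a window set over the future until only the last coordinate matters cannot increase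
  its distance to a tail set, because the forward shifts of a tail set are determined by the past.\<close>
lemma tail_approximation:
  assumes C: "C \<in> backwards_tail N M" and e: "e > 0"
  shows "\<exists>l0. \<forall>l\<ge>l0. \<exists>G\<in>unit_functions M. \<forall>k.
    (\<integral>x. \<bar>(kernel_op P ^^ k) G (x 0) - indicator C (shift_by (int l + int k) x)\<bar> \<partial>N) \<le> e"
proof -
  \<comment> \<open>A tail set is measurable with respect to the times up to \<open>- n\<close> for
    every \<open>n\<close>, so each forward shift has its own past event \<open>D n\<close>.\<close>
  have "\<exists>D. D \<in> sets past_sp \<and> (\<forall>x\<in>space N. shift_by (int n) x \<in> C \<longleftrightarrow> past x \<in> D)" for n
    using C sigma_upto_shift[of C "- int n"] by (auto simp: backwards_tail_def)
  then obtain D where D: "\<And>n. D n \<in> sets past_sp"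
      "\<And>n x. x \<in> space N \<Longrightarrow> shift_by (int n) x \<in> C \<longleftrightarrow> past x \<in> D n"
    by metis
  obtain W l0 where W: "W \<in> sets past_sp" "depends_on_last l0 (\<lambda>p. p \<in> W)"
      "measure mu ((W - D 0) \<union> (D 0 - W)) < e"
    using window_approximation[OF D(1)[of 0] e] by blast
  define w :: "(int \<Rightarrow> 'a) \<Rightarrow> real" where "w = indicator W"
  define v :: "nat \<Rightarrow> (int \<Rightarrow> 'a) \<Rightarrow> real" where "v n = indicator (D n)" for n
  have w: "w \<in> unit_functions past_sp"
    using W(1) by (auto simp: w_def indicator_def)
  have v: "v n \<in> unit_functions past_sp" for n
    using D(1)[of n] by (auto simp: v_def indicator_def)
  have meas: "v n \<in> borel_measurable past_sp" "(kernel_op K ^^ n) w \<in> borel_measurable past_sp" for n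
    using v[of n] funpow_kernel_op_K_unit[OF w, of n] by auto
  have bound: "(\<integral>p. \<bar>(kernel_op K ^^ n) w p - v n p\<bar> \<partial>mu) \<le> e" for n
  proof (induction n)
    case 0
    have "(\<integral>p. \<bar>w p - v 0 p\<bar> \<partial>mu) = (\<integral>p. indicator ((W - D 0) \<union> (D 0 - W)) p \<partial>mu)"
      by (intro Bochner_Integration.integral_cong) (auto simp: w_def v_def indicator_def)
    also have "\<dots> = measure mu ((W - D 0) \<union> (D 0 - W))"
      using W(1) D(1) by (simp add: sets.Int_space_eq2)
    finally show ?case
      using W(3) by simp
  next
    case (Suc n)
    have vd: "(\<lambda>p. v (Suc n) (delay p)) \<in> borel_measurable past_sp"
      using meas(1) by (intro measurable_compose[OF measurable_delay])
    have "(\<integral>p. \<bar>(kernel_op K ^^ Suc n) w p - v (Suc n) p\<bar> \<partial>mu) \<le>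
        (\<integral>p. \<bar>(kernel_op K ^^ n) w p - v (Suc n) (delay p)\<bar> \<partial>mu)"
      using kernel_op_contraction[OF funpow_kernel_op_K_unit[OF w, of n] v[of "Suc n"]] by simp
    also have "\<dots> = (\<integral>x. \<bar>(kernel_op K ^^ n) w (past x) - v (Suc n) (delay (past x))\<bar> \<partial>N)"
      using meas vd by (intro integral_mu) measurable
    also have "\<dots> = (\<integral>x. \<bar>(kernel_op K ^^ n) w (past x) - v n (past x)\<bar> \<partial>N)"
    proof (intro Bochner_Integration.integral_cong refl)
      fix x assume x: "x \<in> space N"
      \<comment> \<open>A delay cancels one forward shift of \<open>C\<close>:
        \<open>v (Suc n)\<close> after \<open>delay\<close> is \<open>v n\<close> on pasts. The
        contraction therefore never increases the initial error.\<close>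
      have "past (shift_by (- 1) x) \<in> D (Suc n) \<longleftrightarrow> past x \<in> D n"
        using D(2)[OF x, of n] D(2)[OF shift_by_space[OF x, of "- 1"], of "Suc n"] by simp
      then show "\<bar>(kernel_op K ^^ n) w (past x) - v (Suc n) (delay (past x))\<bar> =
          \<bar>(kernel_op K ^^ n) w (past x) - v n (past x)\<bar>"
        by (simp add: v_def indicator_def)
    qed
    also have "\<dots> = (\<integral>p. \<bar>(kernel_op K ^^ n) w p - v n p\<bar> \<partial>mu)"
      using meas by (intro integral_mu[symmetric]) measurable
    finally show ?case
      using Suc by simp
  qed
  show ?thesis
  \<comment> \<open>A longer window is still a window for \<open>W\<close>, so every
    \<open>l\<close> from \<open>l0\<close> on works. Finitely many tail sets can then share one
    \<open>l\<close>.\<close>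
  proof (intro exI[of _ l0] allI impI)
    fix l assume "l0 \<le> l"
    then have "depends_on_last l (\<lambda>p. p \<in> W)"
      using W(2) depends_on_last_mono by blast
    then have "depends_on_last l w"
      using depends_on_last_compose[of l "\<lambda>p. p \<in> W" of_bool]
      by (simp add: w_def indicator_def[abs_def] of_bool_def)
    then have "depends_on_last 0 ((kernel_op K ^^ l) w)"
      by (rule depends_on_last_funpow[OF w])
    then obtain G where G: "G \<in> unit_functions M"
        "\<And>p. p \<in> space past_sp \<Longrightarrow> (kernel_op K ^^ l) w p = G (p 0)"
      using depends_on_last_0_obtain[OF funpow_kernel_op_K_unit[OF w]] by blast
    have "(\<integral>x. \<bar>(kernel_op P ^^ k) G (x 0) - indicator C (shift_by (int l + int k) x)\<bar> \<partial>N) \<le> e" for k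
    proof -
      have "(\<integral>x. \<bar>(kernel_op P ^^ k) G (x 0) - indicator C (shift_by (int l + int k) x)\<bar> \<partial>N) =
          (\<integral>x. \<bar>(kernel_op K ^^ (k + l)) w (past x) - v (k + l) (past x)\<bar> \<partial>N)"
      proof (intro Bochner_Integration.integral_cong refl)
        fix x assume x: "x \<in> space N"
        have "(kernel_op P ^^ k) G (x 0) = (kernel_op P ^^ k) G (past x 0)"
          by (simp add: past_def)
        also have "\<dots> = (kernel_op K ^^ k) (\<lambda>p. G (p 0)) (past x)"
          by (rule kernel_op_lift[OF G(1) past_in_space[OF x], symmetric])
        also have "\<dots> = (kernel_op K ^^ k) ((kernel_op K ^^ l) w) (past x)"
          using G(2) by (intro funpow_kernel_op_K_cong past_in_space x) simp
        finally have "(kernel_op P ^^ k) G (x 0) = (kernel_op K ^^ (k + l)) w (past x)"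
          by (simp add: funpow_add)
        moreover have "indicator C (shift_by (int l + int k) x) = v (k + l) (past x)"
          using D(2)[OF x, of "k + l"] by (simp add: v_def indicator_def add.commute)
        ultimately show "\<bar>(kernel_op P ^^ k) G (x 0) - indicator C (shift_by (int l + int k) x)\<bar> =
            \<bar>(kernel_op K ^^ (k + l)) w (past x) - v (k + l) (past x)\<bar>"
          by simp
      qed
      also have "\<dots> = (\<integral>p. \<bar>(kernel_op K ^^ (k + l)) w p - v (k + l) p\<bar> \<partial>mu)"
        using meas by (intro integral_mu[symmetric]) measurable
      finally show ?thesis
        using bound by simp
    qed
    then show "\<exists>G\<in>unit_functions M. \<forall>k.
        (\<integral>x. \<bar>(kernel_op P ^^ k) G (x 0) - indicator C (shift_by (int l + int k) x)\<bar> \<partial>N) \<le> e"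
      using G(1) by blast
  qed
qed

end

section \<open>A reverse martingale\<close>

context prob_space
begin

text \<open>The L2 to L1 comparison, obtained by integrating the pointwise bound of
  \<open>|f|\<close> by the mean of \<open>f^2 / d\<close> and \<open>d\<close>.\<close>

lemma integral_abs_le_of_square:
  fixes f :: "'a \<Rightarrow> real"
  assumes f: "f \<in> borel_measurable M" and bound: "\<And>x. x \<in> space M \<Longrightarrow> \<bar>f x\<bar> \<le> c"
    and d: "0 < d" and le: "(\<integral>x. (f x)\<^sup>2 \<partial>M) \<le> d\<^sup>2"
  shows "(\<integral>x. \<bar>f x\<bar> \<partial>M) \<le> d"
proof -
  have i1: "integrable M (\<lambda>x. \<bar>f x\<bar>)"
    using f bound by (intro integrable_const_bound[of _ c] AE_I2) auto
  have i2: "integrable M (\<lambda>x. (f x)\<^sup>2)"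
  proof (intro integrable_const_bound[of _ "c\<^sup>2"] AE_I2)
    fix x assume "x \<in> space M"
    from bound[OF this] show "norm ((f x)\<^sup>2) \<le> c\<^sup>2"
      using power_mono[of "\<bar>f x\<bar>" c 2] by simp
  qed (use f in measurable)
  have pt: "\<bar>f x\<bar> \<le> ((f x)\<^sup>2 / d + d) / 2" for x
  proof -
    have "0 \<le> (\<bar>f x\<bar> - d)\<^sup>2"
      by simp
    then have "2 * \<bar>f x\<bar> * d \<le> (f x)\<^sup>2 + d\<^sup>2"
      by (simp add: power2_diff)
    then show ?thesis
      using d by (simp add: field_simps power2_eq_square)
  qed
  have "(\<integral>x. \<bar>f x\<bar> \<partial>M) \<le> (\<integral>x. ((f x)\<^sup>2 / d + d) / 2 \<partial>M)"
    using i1 i2 pt by (intro integral_mono) auto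
  also have "\<dots> = ((\<integral>x. (f x)\<^sup>2 \<partial>M) / d + d) / 2"
    using i2 by (simp add: prob_space)
  also have "\<dots> \<le> (d\<^sup>2 / d + d) / 2"
    using le d by (intro divide_right_mono add_right_mono) auto
  also have "\<dots> = d"
    using d by (simp add: power2_eq_square)
  finally show ?thesis .
qed

end

context markov_path
begin

text \<open>The \<open>d\<close>-step version, read on the two-sided path space: the
  \<open>d\<close>-th iterate is the conditional expectation of \<open>g\<close> after
  \<open>d\<close> forward shifts, tested against functions \<open>w\<close> of the past.\<close>

lemma funpow_kernel_op_adjoint:
  assumes g: "g \<in> unit_functions past_sp" and w: "w \<in> unit_functions past_sp"
  shows "(\<integral>x. (kernel_op K ^^ d) g (past x) * w (past x) \<partial>N) =
    (\<integral>x. g (past (shift_by (int d) x)) * w (past x) \<partial>N)"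
  using w
proof (induction d arbitrary: w)
  case (Suc d)
  have [measurable]: "(kernel_op K ^^ d) g \<in> borel_measurable past_sp"
      "(kernel_op K ^^ Suc d) g \<in> borel_measurable past_sp" "w \<in> borel_measurable past_sp"
      "g \<in> borel_measurable past_sp"
    using funpow_kernel_op_K_unit[OF g, of d] funpow_kernel_op_K_unit[OF g, of "Suc d"] Suc.prems g
    by blast+
  have wd: "(\<lambda>p. w (delay p)) \<in> unit_functions past_sp"
    using Suc.prems measurable_space[OF measurable_delay]
    by (auto intro!: measurable_compose[OF measurable_delay])
  have "(\<integral>x. (kernel_op K ^^ Suc d) g (past x) * w (past x) \<partial>N) =
      (\<integral>p. (kernel_op K ^^ Suc d) g p * w p \<partial>mu)"
    by (intro integral_mu[symmetric]) measurable
  also have "\<dots> = (\<integral>p. (kernel_op K ^^ d) g p * w (delay p) \<partial>mu)"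
    using kernel_op_adjoint[OF funpow_kernel_op_K_unit[OF g, of d] Suc.prems] by simp
  also have "\<dots> = (\<integral>x. (kernel_op K ^^ d) g (past x) * w (delay (past x)) \<partial>N)"
    by (intro integral_mu) measurable
  also have "\<dots> = (\<integral>x. g (past (shift_by (int d) x)) * w (delay (past x)) \<partial>N)"
    by (rule Suc.IH[OF wd])
  \<comment> \<open>Stationarity trades the delay inside \<open>w\<close> for one more forward shift
    inside \<open>g\<close>.\<close>
  also have "\<dots> = (\<integral>x. g (past (shift_by (int d) (shift_by 1 x))) * w (delay (past (shift_by 1 x))) \<partial>N)"
    by (rule integral_shift_by[symmetric]) measurable
  also have "\<dots> = (\<integral>x. g (past (shift_by (int (Suc d)) x)) * w (past x) \<partial>N)"
    by (simp add: add.commute)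
  finally show ?case .
qed simp

text \<open>A measure space carrying \<open>sigma_upto\<close>, present only so that measurability
  lemmas apply; its measure is irrelevant.\<close>

definition time_upto :: "int \<Rightarrow> (int \<Rightarrow> 'a) measure" where
  "time_upto n = sigma (space N) {{x \<in> space N. x k \<in> A} | k A. k \<le> n \<and> A \<in> sets M}"

lemma space_time_upto: "space (time_upto n) = space N"
  and sets_time_upto: "sets (time_upto n) = sigma_upto N M n"
  unfolding time_upto_def sigma_upto_def
  by (auto simp: space_measure_of_conv intro!: sets_measure_of)

lemma measurable_past_time_upto:
  assumes "- int k \<le> n"
  shows "(\<lambda>x. past (shift_by (- int k) x)) \<in> measurable (time_upto n) past_sp"
  unfolding past_def past_space_def shift_by_def
proof (rule measurable_restrict)
  fix j :: int assume j: "j \<in> {..0}"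
  show "(\<lambda>x. x (j + - int k)) \<in> measurable (time_upto n) M"
  proof (rule measurableI)
    fix A assume "A \<in> sets M"
    then have "{x\<in>space N. x (j + - int k) \<in> A} \<in> sigma_upto N M n"
      unfolding sigma_upto_def using j assms by (intro sigma_sets.Basic) force
    then show "(\<lambda>x. x (j + - int k)) -` A \<inter> space (time_upto n) \<in> sets (time_upto n)"
      by (simp add: space_time_upto sets_time_upto vimage_def Int_def conj_commute)
  qed (simp add: space_time_upto coord_space)
qed

text \<open>Increments are orthogonal: the squared L2 distance of \<open>u k\<close> and
  \<open>u l\<close> is \<open>a k - a l\<close>, where \<open>a\<close> is the sequence of second
  moments. Being decreasing and bounded below, \<open>a\<close> converges, so \<open>u\<close> is
  Cauchy in L2 and hence in L1.\<close>

lemma reverse_martingale_limit: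
  assumes f: "f \<in> unit_functions past_sp"
  obtains h where "h \<in> unit_functions N" "\<And>S. S \<in> sets borel \<Longrightarrow> {x\<in>space N. h x \<in> S} \<in> backwards_tail N M"
    "(\<lambda>k. \<integral>x. \<bar>(kernel_op K ^^ k) f (past x) - h (shift_by (int k) x)\<bar> \<partial>N) \<longlonglongrightarrow> 0"
proof -
  define g where "g k = (kernel_op K ^^ k) f" for k
  define u where "u k x = g k (past (shift_by (- int k) x))" for k x
  define a where "a k = (\<integral>x. (g k (past x))\<^sup>2 \<partial>N)" for k
  have g: "g k \<in> unit_functions past_sp" for k
    unfolding g_def by (rule funpow_kernel_op_K_unit[OF f])
  have gm [measurable]: "g k \<in> borel_measurable past_sp" for k
    using g[of k] by simp
  have gb: "0 \<le> g k p" "g k p \<le> 1" if "p \<in> space past_sp" for k p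
    using unit_functionsD[OF g[of k]] that by auto
  have um [measurable]: "u k \<in> borel_measurable N" for k
    unfolding u_def by measurable
  have ub: "0 \<le> u k x" "u k x \<le> 1" if "x \<in> space N" for k x
    unfolding u_def using gb past_in_space shift_by_space that by auto
  have diff: "(\<integral>x. (u k x - u l x)\<^sup>2 \<partial>N) = a k - a l" if "k \<le> l" for k l
  proof -
    define d where "d = l - k"
    have l: "l = k + d"
      using that by (simp add: d_def)
    have gl: "g l = (kernel_op K ^^ d) (g k)"
      by (simp add: g_def l funpow_add add.commute)
    let ?A = "\<lambda>x. g k (past (shift_by (int d) x))" and ?B = "\<lambda>x. g l (past x)"
    have AB: "0 \<le> ?A x" "?A x \<le> 1" "0 \<le> ?B x" "?B x \<le> 1" if "x \<in> space N" for x
      using gb past_in_space shift_by_space that by auto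
    have int: "integrable N (\<lambda>x. ?A x * ?A x)" "integrable N (\<lambda>x. ?A x * ?B x)" "integrable N (\<lambda>x. ?B x * ?B x)"
      using AB by (auto intro!: N.integrable_const_bound[of _ 1] AE_I2 mult_le_one simp: abs_mult)
    \<comment> \<open>After a shift by \<open>l\<close>, \<open>u l\<close> becomes a function of
      the past and \<open>u k\<close> becomes \<open>g k\<close> seen \<open>d\<close> steps ahead.
      The adjoint formula then evaluates the cross term as \<open>a l\<close>.\<close>
    have "(\<integral>x. (u k x - u l x)\<^sup>2 \<partial>N) = (\<integral>x. (u k (shift_by (int l) x) - u l (shift_by (int l) x))\<^sup>2 \<partial>N)"
      by (rule integral_shift_by[symmetric]) measurable
    also have "\<dots> = (\<integral>x. (?A x - ?B x)\<^sup>2 \<partial>N)"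
      by (simp add: u_def l)
    also have "\<dots> = (\<integral>x. ?A x * ?A x - 2 * (?A x * ?B x) + ?B x * ?B x \<partial>N)"
      by (intro Bochner_Integration.integral_cong) (auto simp: power2_eq_square algebra_simps)
    also have "\<dots> = (\<integral>x. ?A x * ?A x \<partial>N) - 2 * (\<integral>x. ?A x * ?B x \<partial>N) + (\<integral>x. ?B x * ?B x \<partial>N)"
      using int by simp
    also have "(\<integral>x. ?A x * ?A x \<partial>N) = a k"
      unfolding a_def power2_eq_square by (rule integral_shift_by) measurable
    also have "(\<integral>x. ?A x * ?B x \<partial>N) = a l"
      using funpow_kernel_op_adjoint[OF g g, of d k l] by (simp add: gl a_def power2_eq_square)
    also have "(\<integral>x. ?B x * ?B x \<partial>N) = a l"
      by (simp add: a_def power2_eq_square)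
    finally show ?thesis
      by simp
  qed
  have a_nonneg: "0 \<le> a k" for k
    unfolding a_def by simp
  have dec: "decseq a"
  proof (rule decseq_SucI)
    fix k
    have "0 \<le> (\<integral>x. (u k x - u (Suc k) x)\<^sup>2 \<partial>N)"
      by simp
    then show "a (Suc k) \<le> a k"
      by (simp add: diff)
  qed
  have cauchy: "\<exists>n. \<forall>i\<ge>n. \<forall>j\<ge>n. (\<integral>x. \<bar>u i x - u j x\<bar> \<partial>N) < e" if e: "0 < e" for e
  proof -
    obtain L where L: "a \<longlonglongrightarrow> L" "\<And>k. L \<le> a k"
      using decseq_convergent[OF dec, of 0] a_nonneg by blast
    have "eventually (\<lambda>k. a k < L + (e / 2)\<^sup>2) sequentially"
      using L(1) e by (intro order_tendstoD(2)[OF L(1)]) simp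
    then obtain n where n: "\<And>k. k \<ge> n \<Longrightarrow> a k < L + (e / 2)\<^sup>2"
      by (auto simp: eventually_sequentially)
    have le: "(\<integral>x. \<bar>u i x - u j x\<bar> \<partial>N) \<le> e / 2" if "n \<le> i" "i \<le> j" for i j
    proof (rule N.integral_abs_le_of_square[of _ 1])
      show "\<bar>u i x - u j x\<bar> \<le> 1" if "x \<in> space N" for x
        using ub[OF that, of i] ub[OF that, of j] by (auto simp: abs_le_iff)
      show "(\<integral>x. (u i x - u j x)\<^sup>2 \<partial>N) \<le> (e / 2)\<^sup>2"
        using n[OF that(1)] L(2)[of j] by (simp add: diff[OF that(2)])
    qed (use e in simp_all)
    have "(\<integral>x. \<bar>u i x - u j x\<bar> \<partial>N) < e" if "n \<le> i" "n \<le> j" for i j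
    proof (cases "i \<le> j")
      case True
      then show ?thesis
        using le[OF that(1) True] e by simp
    next
      case False
      then have "(\<integral>x. \<bar>u j x - u i x\<bar> \<partial>N) \<le> e / 2"
        using le[OF that(2), of i] by simp
      then show ?thesis
        using e by (simp add: abs_minus_commute)
    qed
    then show ?thesis
      by blast
  qed
  have ui: "integrable N (u k)" for k
    using ub by (intro N.integrable_const_bound[of _ 1] AE_I2) auto
  have cauchy': "\<exists>n. \<forall>i\<ge>n. \<forall>j\<ge>n. (LINT x|N. norm (u i x - u j x)) < e" if "0 < e" for e
    using cauchy[OF that] by simp
  obtain r where r: "strict_mono r" "AE x in N. Cauchy (\<lambda>i. u (r i) x)"
    by (rule cauchy_L1_AE_cauchy_subseq[OF ui cauchy'])
  \<comment> \<open>\<open>lim\<close> is unspecified where the subsequence diverges; clamping gives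
    values in the unit interval everywhere.\<close>
  define h where "h x = max 0 (min 1 (lim (\<lambda>i. u (r i) x)))" for x
  \<comment> \<open>Dropping \<open>n\<close> terms keeps the limit, and
    \<open>r (i + n) >= n\<close> leaves only terms that depend on times up to \<open>- n\<close>.
    Hence \<open>h\<close> is tail measurable exactly, not merely up to null sets.\<close>
  have h_time: "h \<in> borel_measurable (time_upto (- int n))" for n
  proof -
    have "u (r (i + n)) \<in> borel_measurable (time_upto (- int n))" for i
    proof -
      have "n \<le> r (i + n)"
        using seq_suble[OF r(1), of "i + n"] by simp
      then show ?thesis
        unfolding u_def by (intro measurable_compose[OF measurable_past_time_upto gm]) simp
    qed
    then have "(\<lambda>x. lim (\<lambda>i. u (r (i + n)) x)) \<in> borel_measurable (time_upto (- int n))"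
      by (rule borel_measurable_lim_metric)
    moreover have "lim (\<lambda>i. u (r (i + n)) x) = lim (\<lambda>i. u (r i) x)" for x
    proof -
      have "(\<lambda>i. u (r (i + n)) x) \<longlonglongrightarrow> L \<longleftrightarrow> (\<lambda>i. u (r i) x) \<longlonglongrightarrow> L" for L
        using LIMSEQ_ignore_initial_segment[of "\<lambda>i. u (r i) x" L n] LIMSEQ_offset[of "\<lambda>i. u (r i) x" n L]
        by blast
      then show ?thesis
        unfolding lim_def by simp
    qed
    ultimately show ?thesis
      unfolding h_def by simp
  qed
  have tail: "{x\<in>space N. h x \<in> S} \<in> backwards_tail N M" if S: "S \<in> sets borel" for S
    unfolding backwards_tail_def
  proof
    fix n :: int assume "n \<in> {..0}"
    then have "n = - int (nat (- n))"
      by simp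
    then have "h \<in> borel_measurable (time_upto n)"
      using h_time[of "nat (- n)"] by simp
    from measurable_sets[OF this S] show "{x\<in>space N. h x \<in> S} \<in> sigma_upto N M n"
      by (simp add: space_time_upto sets_time_upto vimage_def Int_def conj_commute)
  qed
  have hm [measurable]: "h \<in> borel_measurable N"
    unfolding h_def by measurable
  have hb: "0 \<le> h x" "h x \<le> 1" for x
    by (auto simp: h_def)
  have uh1: "\<bar>u k x - h x\<bar> \<le> 1" if "x \<in> space N" for k x
    using ub[OF that, of k] hb[of x] by (auto simp: abs_le_iff)
  have sub: "(\<lambda>i. \<integral>x. \<bar>u (r i) x - h x\<bar> \<partial>N) \<longlonglongrightarrow> (\<integral>x. 0 \<partial>N)"
  proof (rule integral_dominated_convergence[where w = "\<lambda>_. 1"])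
    show "AE x in N. (\<lambda>i. \<bar>u (r i) x - h x\<bar>) \<longlonglongrightarrow> 0"
      using r(2) AE_space
    proof eventually_elim
      case (elim x)
      then have "convergent (\<lambda>i. u (r i) x)"
        using real_Cauchy_convergent by blast
      then have lim: "(\<lambda>i. u (r i) x) \<longlonglongrightarrow> lim (\<lambda>i. u (r i) x)"
        by (simp add: convergent_LIMSEQ_iff)
      have "0 \<le> lim (\<lambda>i. u (r i) x)" "lim (\<lambda>i. u (r i) x) \<le> 1"
        using ub[OF elim(2)] by (auto intro!: LIMSEQ_le_const[OF lim] LIMSEQ_le_const2[OF lim])
      then have "h x = lim (\<lambda>i. u (r i) x)"
        by (simp add: h_def)
      with lim have "(\<lambda>i. u (r i) x - h x) \<longlonglongrightarrow> 0"
        by (simp add: LIM_zero_iff)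
      then show ?case
        by (rule tendsto_rabs_zero)
    qed
    show "AE x in N. norm \<bar>u (r i) x - h x\<bar> \<le> 1" for i
      using uh1 by (intro AE_I2) simp
  qed auto
  \<comment> \<open>The Cauchy property carries convergence along \<open>r\<close> over to the full
    sequence.\<close>
  have conv: "(\<lambda>k. \<integral>x. \<bar>u k x - h x\<bar> \<partial>N) \<longlonglongrightarrow> 0"
  proof (rule LIMSEQ_I)
    fix e :: real assume e: "0 < e"
    then obtain n where n: "\<And>i j. n \<le> i \<Longrightarrow> n \<le> j \<Longrightarrow> (\<integral>x. \<bar>u i x - u j x\<bar> \<partial>N) < e / 2"
      using cauchy[of "e / 2"] by auto
    have "eventually (\<lambda>i. (\<integral>x. \<bar>u (r i) x - h x\<bar> \<partial>N) < e / 2 \<and> n \<le> i) sequentially"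
      using order_tendstoD(2)[OF sub, of "e / 2"] e by (intro eventually_conj eventually_ge_at_top) simp
    then obtain i where i: "(\<integral>x. \<bar>u (r i) x - h x\<bar> \<partial>N) < e / 2" "n \<le> i"
      by (auto dest: eventually_happens)
    have "norm ((\<integral>x. \<bar>u k x - h x\<bar> \<partial>N) - 0) < e" if "n \<le> k" for k
    proof -
      have [intro]: "integrable N (\<lambda>x. \<bar>u i x - u j x\<bar>)" "integrable N (\<lambda>x. \<bar>u i x - h x\<bar>)" for i j
        using uh1 ui by (auto intro!: N.integrable_const_bound[of _ 1] AE_I2)
      have "(\<integral>x. \<bar>u k x - h x\<bar> \<partial>N) \<le> (\<integral>x. \<bar>u k x - u (r i) x\<bar> + \<bar>u (r i) x - h x\<bar> \<partial>N)"
        by (intro integral_mono Bochner_Integration.integrable_add) auto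
      also have "\<dots> = (\<integral>x. \<bar>u k x - u (r i) x\<bar> \<partial>N) + (\<integral>x. \<bar>u (r i) x - h x\<bar> \<partial>N)"
        by (intro Bochner_Integration.integral_add) auto
      also have "\<dots> < e / 2 + e / 2"
        using n[OF that, of "r i"] i seq_suble[OF r(1), of i] by (intro add_strict_mono) auto
      finally show ?thesis
        by simp
    qed
    then show "\<exists>n. \<forall>k\<ge>n. norm ((\<integral>x. \<bar>u k x - h x\<bar> \<partial>N) - 0) < e"
      by blast
  qed
  show ?thesis
  proof (rule that)
    show "h \<in> unit_functions N"
      using hm hb by auto
    show "{x\<in>space N. h x \<in> S} \<in> backwards_tail N M" if "S \<in> sets borel" for S
      using tail that .
    have "(\<integral>x. \<bar>u k x - h x\<bar> \<partial>N) = (\<integral>x. \<bar>(kernel_op K ^^ k) f (past x) - h (shift_by (int k) x)\<bar> \<partial>N)" for k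
    proof -
      have "(\<lambda>x. \<bar>u k x - h x\<bar>) \<in> borel_measurable N"
        by measurable
      from integral_shift_by[OF this, of "int k"] show ?thesis
        by (simp add: u_def g_def)
    qed
    then show "(\<lambda>k. \<integral>x. \<bar>(kernel_op K ^^ k) f (past x) - h (shift_by (int k) x)\<bar> \<partial>N) \<longlonglongrightarrow> 0"
      using conv by simp
  qed
qed

end

section \<open>Entropy of subgraphs\<close>

abbreviation unit_interval :: "real measure" where
  "unit_interval \<equiv> restrict_space lborel {0..1}"

lemma prob_space_unit_interval: "prob_space unit_interval"
  by (rule prob_space_restrict_space) simp_all

lemma space_with_unit_interval: "space (with_unit_interval M) = space M \<times> {0..1}"
  by (simp add: with_unit_interval_def space_pair_measure)

lemma measurable_unit_interval: "(\<lambda>t. t) \<in> borel_measurable unit_interval"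
  by (rule measurable_restrict_space1) simp

lemma measure_unit_interval:
  assumes "A \<subseteq> {0..1}" "A \<in> sets borel"
  shows "measure unit_interval A = measure lborel A"
  using assms by (intro measure_restrict_space) auto

text \<open>A vertical slice of the symmetric difference of two subgraphs; integrated over the base
  it gives their L1 distance.\<close>

lemma measure_unit_interval_le_neq_le:
  assumes "a \<in> {0..1}" "b \<in> {0..1}"
  shows "measure unit_interval {t\<in>{0..1}. (t \<le> a) \<noteq> (t \<le> b)} = \<bar>a - b\<bar>"
proof -
  have "{t\<in>{0..1}. (t \<le> a) \<noteq> (t \<le> b)} = {min a b<..max a b}"
    using assms by auto
  moreover have "measure unit_interval {min a b<..max a b} = measure lborel {min a b<..max a b}"
    using assms by (intro measure_unit_interval) auto
  moreover have "measure lborel {min a b<..max a b} = \<bar>a - b\<bar>"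
    by (cases "a \<le> b") simp_all
  ultimately show ?thesis
    by simp
qed

text \<open>Here a subgraph is compared with a full or empty slice, the shape of an event of the
  base. The subgraph of an indicator would differ from it at \<open>t = 0\<close>.\<close>

lemma measure_unit_interval_le_neq_bool:
  assumes "a \<in> {0..1}"
  shows "measure unit_interval {t\<in>{0..1}. (t \<le> a) \<noteq> c} = \<bar>a - of_bool c\<bar>"
proof -
  have "{t\<in>{0..1}. (t \<le> a) \<noteq> c} = (if c then {a<..1} else {0..a})"
    using assms by auto
  moreover have "measure unit_interval (if c then {a<..1} else {0..a}) =
      measure lborel (if c then {a<..1} else {0..a})"
    using assms by (intro measure_unit_interval) auto
  moreover have "measure lborel (if c then {a<..1} else {0..a}) = \<bar>a - of_bool c\<bar>"
    using assms by (cases c) simp_all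
  ultimately show ?thesis
    by simp
qed

text \<open>Operator-theoretic entropy of an indexed family instead of a set of functions: two
  families over the same \<open>I\<close> can be compared index by index even if some of their
  members coincide.\<close>

definition graph_entropy :: "'a measure \<Rightarrow> 'i set \<Rightarrow> ('i \<Rightarrow> 'a \<Rightarrow> real) \<Rightarrow> real" where
  "graph_entropy M I u = rv_entropy (with_unit_interval M) (\<lambda>z. {i\<in>I. snd z \<le> u i (fst z)})"

lemma pred_le_graph:
  assumes [measurable]: "u \<in> borel_measurable M"
  shows "Measurable.pred (with_unit_interval M) (\<lambda>z. snd z \<le> u (fst z))"
proof -
  have [measurable]: "(\<lambda>z. snd z) \<in> borel_measurable (M \<Otimes>\<^sub>M unit_interval)"
    by (rule measurable_compose[OF measurable_snd measurable_unit_interval])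
  show ?thesis
    unfolding with_unit_interval_def by measurable
qed

text \<open>Pulls the entropy of a factor back along \<open>f\<close> times the identity of the unit
  interval, which preserves the product measures. Repeated functions repeat a condition and leave
  the refinement unchanged.\<close>

lemma family_entropy_eq_graph_entropy:
  assumes M: "prob_space M" and f: "f \<in> measurable M M'" and distr: "distr M M' f = M'"
    and I: "finite I" and g: "\<And>i. i \<in> I \<Longrightarrow> g i \<in> borel_measurable M'"
  shows "family_entropy M' (g ` I) = graph_entropy M I (\<lambda>i x. g i (f x))"
proof -
  interpret M: prob_space M by fact
  interpret M': prob_space M'
    using M.prob_space_distr[OF f] by (simp add: distr)
  interpret L: prob_space unit_interval
    by (rule prob_space_unit_interval)
  interpret P': pair_prob_space M' unit_interval ..
  have W': "prob_space (with_unit_interval M')"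
    unfolding with_unit_interval_def by unfold_locales
  let ?\<Omega> = "space M' \<times> {0..1::real}"
  define X where "X z = {i\<in>I. snd z \<le> g i (fst z)}" for z
  define A where "A i = {(x, t) \<in> ?\<Omega>. t \<le> g i x}" for i
  have part: "subgraph_partition M' (g i) = {A i, ?\<Omega> - A i}" for i
    by (simp add: subgraph_partition_def A_def Let_def)
  have "family_entropy M' (g ` I) = rv_entropy (with_unit_interval M') X"
    unfolding family_entropy_def space_with_unit_interval[symmetric]
  proof (rule shannon_entropy_common_refinement)
    show "finite (subgraph_partition M' ` g ` I)"
      using I by simp
    show "finite Q" if "Q \<in> subgraph_partition M' ` g ` I" for Q
      using that part by auto
    show "\<exists>!S. S \<in> Q \<and> z \<in> S" if Q: "Q \<in> subgraph_partition M' ` g ` I"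
      and z: "z \<in> space (with_unit_interval M')" for Q z
    proof -
      obtain i where "Q = {A i, ?\<Omega> - A i}"
        using Q part by auto
      then show ?thesis
        using z by (cases "z \<in> A i") (auto simp: space_with_unit_interval)
    qed
    fix z z' assume z: "z \<in> space (with_unit_interval M')" and z': "z' \<in> space (with_unit_interval M')"
    have "X z = X z' \<longleftrightarrow> (\<forall>i\<in>I. z \<in> A i \<longleftrightarrow> z' \<in> A i)"
      using z z' unfolding space_with_unit_interval by (auto simp: X_def A_def)
    also have "\<dots> \<longleftrightarrow> (\<forall>i\<in>I. \<forall>S\<in>{A i, ?\<Omega> - A i}. z \<in> S \<longleftrightarrow> z' \<in> S)"
      using z z' unfolding space_with_unit_interval by auto
    also have "\<dots> \<longleftrightarrow> (\<forall>Q\<in>subgraph_partition M' ` g ` I. \<forall>S\<in>Q. z \<in> S \<longleftrightarrow> z' \<in> S)"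
      by (simp add: part)
    finally show "X z = X z' \<longleftrightarrow> (\<forall>Q\<in>subgraph_partition M' ` g ` I. \<forall>S\<in>Q. z \<in> S \<longleftrightarrow> z' \<in> S)" .
  qed
  also have "with_unit_interval M' = distr (with_unit_interval M) (with_unit_interval M') (\<lambda>(x, t). (f x, t))"
  proof -
    have "distr M M' f \<Otimes>\<^sub>M distr unit_interval unit_interval (\<lambda>t. t) =
        distr (M \<Otimes>\<^sub>M unit_interval) (M' \<Otimes>\<^sub>M unit_interval) (\<lambda>(x, t). (f x, t))"
      using f by (intro pair_measure_distr) (simp_all add: distr_id L.sigma_finite_measure_axioms)
    then show ?thesis
      by (simp add: distr distr_id with_unit_interval_def)
  qed
  also have "rv_entropy \<dots> X = rv_entropy (with_unit_interval M) (X \<circ> (\<lambda>(x, t). (f x, t)))"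
  proof (rule rv_entropy_distr)
    show "(\<lambda>(x, t). (f x, t)) \<in> measurable (with_unit_interval M) (with_unit_interval M')"
      unfolding with_unit_interval_def using f by measurable
    show "simple_function (with_unit_interval M') X"
      unfolding X_def using I g by (intro prob_space.simple_function_Collect[OF W'] pred_le_graph)
  qed
  also have "\<dots> = graph_entropy M I (\<lambda>i x. g i (f x))"
    unfolding graph_entropy_def by (intro rv_entropy_cong) (auto simp: X_def)
  finally show ?thesis .
qed

context prob_space
begin

lemma prob_space_with_unit_interval: "prob_space (with_unit_interval M)"
proof -
  interpret L: prob_space unit_interval
    by (rule prob_space_unit_interval)
  interpret P': pair_prob_space M unit_interval ..
  show ?thesis
    unfolding with_unit_interval_def by unfold_locales
qed

lemma measure_with_unit_interval_slices:
  assumes R: "Measurable.pred (with_unit_interval M) R" and h: "h \<in> borel_measurable M"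
    and slice: "\<And>x. x \<in> space M \<Longrightarrow> measure unit_interval {t\<in>{0..1}. R (x, t)} = h x"
  shows "measure (with_unit_interval M) {z\<in>space (with_unit_interval M). R z} = (\<integral>x. h x \<partial>M)"
proof -
  interpret L: prob_space unit_interval
    by (rule prob_space_unit_interval)
  have h01: "0 \<le> h x" "h x \<le> 1" if "x \<in> space M" for x
    using slice[OF that, symmetric] by simp_all
  let ?A = "{z\<in>space (with_unit_interval M). R z}"
  have A: "?A \<in> sets (M \<Otimes>\<^sub>M unit_interval)"
    using R by (simp add: pred_def with_unit_interval_def)
  have "emeasure (with_unit_interval M) ?A = (\<integral>\<^sup>+x. emeasure unit_interval (Pair x -` ?A) \<partial>M)"
    using L.emeasure_pair_measure_alt[OF A] by (simp add: with_unit_interval_def)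
  also have "\<dots> = (\<integral>\<^sup>+x. ennreal (h x) \<partial>M)"
  proof (rule nn_integral_cong)
    fix x assume x: "x \<in> space M"
    have "Pair x -` ?A = {t\<in>{0..1}. R (x, t)}"
      using x by (auto simp: space_with_unit_interval)
    then show "emeasure unit_interval (Pair x -` ?A) = ennreal (h x)"
      using slice[OF x] by (simp add: L.emeasure_eq_measure)
  qed
  also have "\<dots> = ennreal (\<integral>x. h x \<partial>M)"
    using h h01 by (intro nn_integral_eq_integral integrable_const_bound[of _ 1] AE_I2) auto
  finally show ?thesis
    using h01 by (simp add: measure_def enn2real_ennreal Bochner_Integration.integral_nonneg)
qed

lemma graph_entropy_perturb:
  assumes I: "finite I" and u: "\<And>i. i \<in> I \<Longrightarrow> u i \<in> unit_functions M"
    and v: "\<And>i. i \<in> I \<Longrightarrow> v i \<in> unit_functions M"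
  shows "graph_entropy M I u \<le> graph_entropy M I v + (\<Sum>i\<in>I. 2 * sqrt (\<integral>x. \<bar>u i x - v i x\<bar> \<partial>M))"
proof -
  interpret W: prob_space "with_unit_interval M"
    by (rule prob_space_with_unit_interval)
  have pu: "Measurable.pred (with_unit_interval M) (\<lambda>z. snd z \<le> u i (fst z))"
    and pv: "Measurable.pred (with_unit_interval M) (\<lambda>z. snd z \<le> v i (fst z))" if "i \<in> I" for i
    using u[OF that] v[OF that] by (auto intro: pred_le_graph)
  have "W.prob {z\<in>space (with_unit_interval M). (snd z \<le> u i (fst z)) \<noteq> (snd z \<le> v i (fst z))} =
      (\<integral>x. \<bar>u i x - v i x\<bar> \<partial>M)" if i: "i \<in> I" for i
  proof (rule measure_with_unit_interval_slices)
    show "Measurable.pred (with_unit_interval M) (\<lambda>z. (snd z \<le> u i (fst z)) \<noteq> (snd z \<le> v i (fst z)))"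
      using pu[OF i] pv[OF i] by measurable
    show "(\<lambda>x. \<bar>u i x - v i x\<bar>) \<in> borel_measurable M"
      using u[OF i] v[OF i] by auto
    show "measure unit_interval {t\<in>{0..1}. (snd (x, t) \<le> u i (fst (x, t))) \<noteq> (snd (x, t) \<le> v i (fst (x, t)))} =
        \<bar>u i x - v i x\<bar>" if "x \<in> space M" for x
      using u[OF i] v[OF i] that unfolding fst_conv snd_conv
      by (intro measure_unit_interval_le_neq_le) auto
  qed
  then show ?thesis
    unfolding graph_entropy_def using W.rv_entropy_perturb[of I "\<lambda>i z. snd z \<le> u i (fst z)" "\<lambda>i z. snd z \<le> v i (fst z)", OF I pu pv]
    by (simp cong: sum.cong)
qed

lemma distr_with_unit_interval_fst: "distr (with_unit_interval M) M fst = M"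
proof -
  interpret L: prob_space unit_interval
    by (rule prob_space_unit_interval)
  show ?thesis
    unfolding with_unit_interval_def by (rule L.distr_pair_fst)
qed

text \<open>An event of the base is viewed as a cylinder over the unit interval, at no change of
  entropy, and is then a perturbation of the subgraph of \<open>u i\<close>.\<close>

lemma rv_entropy_le_graph_entropy:
  assumes I: "finite I" and u: "\<And>i. i \<in> I \<Longrightarrow> u i \<in> unit_functions M"
    and A: "\<And>i. i \<in> I \<Longrightarrow> Measurable.pred M (A i)"
  shows "rv_entropy M (\<lambda>x. {i\<in>I. A i x}) \<le>
    graph_entropy M I u + (\<Sum>i\<in>I. 2 * sqrt (\<integral>x. \<bar>u i x - of_bool (A i x)\<bar> \<partial>M))"
proof -
  interpret W: prob_space "with_unit_interval M"
    by (rule prob_space_with_unit_interval)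
  have fst: "fst \<in> measurable (with_unit_interval M) M"
    unfolding with_unit_interval_def by (rule measurable_fst)
  have pu: "Measurable.pred (with_unit_interval M) (\<lambda>z. snd z \<le> u i (fst z))"
    and pA: "Measurable.pred (with_unit_interval M) (\<lambda>z. A i (fst z))" if "i \<in> I" for i
    using u[OF that] A[OF that] by (auto intro: pred_le_graph measurable_compose[OF fst])
  have prob: "W.prob {z\<in>space (with_unit_interval M). A i (fst z) \<noteq> (snd z \<le> u i (fst z))} =
      (\<integral>x. \<bar>u i x - of_bool (A i x)\<bar> \<partial>M)" if i: "i \<in> I" for i
  proof (rule measure_with_unit_interval_slices)
    show "Measurable.pred (with_unit_interval M) (\<lambda>z. A i (fst z) \<noteq> (snd z \<le> u i (fst z)))"
      using pu[OF i] pA[OF i] by measurable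
    have [measurable]: "Measurable.pred M (A i)" "u i \<in> borel_measurable M"
      using A[OF i] u[OF i] by auto
    show "(\<lambda>x. \<bar>u i x - of_bool (A i x)\<bar>) \<in> borel_measurable M"
      by measurable
    fix x assume x: "x \<in> space M"
    have "{t\<in>{0..1}. A i (fst (x, t)) \<noteq> (snd (x, t) \<le> u i (fst (x, t)))} =
        {t\<in>{0..1}. (t \<le> u i x) \<noteq> A i x}"
      by auto
    then show "measure unit_interval {t\<in>{0..1}. A i (fst (x, t)) \<noteq> (snd (x, t) \<le> u i (fst (x, t)))} =
        \<bar>u i x - of_bool (A i x)\<bar>"
      using u[OF i] x by (simp only:) (intro measure_unit_interval_le_neq_bool, auto)
  qed
  have "rv_entropy M (\<lambda>x. {i\<in>I. A i x}) = rv_entropy (distr (with_unit_interval M) M fst) (\<lambda>x. {i\<in>I. A i x})"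
    by (simp add: distr_with_unit_interval_fst)
  also have "\<dots> = rv_entropy (with_unit_interval M) (\<lambda>z. {i\<in>I. A i (fst z)})"
    using rv_entropy_distr[OF fst simple_function_Collect[of I A, OF I A]] by (simp add: comp_def)
  also have "\<dots> \<le> graph_entropy M I u + (\<Sum>i\<in>I. 2 * sqrt (\<integral>x. \<bar>u i x - of_bool (A i x)\<bar> \<partial>M))"
    unfolding graph_entropy_def using W.rv_entropy_perturb[of I "\<lambda>i z. A i (fst z)" "\<lambda>i z. snd z \<le> u i (fst z)", OF I pA pu] prob
    by (simp cong: sum.cong)
  finally show ?thesis .
qed

text \<open>For functions with values in the multiples of \<open>1 / m\<close>, the subgraphs are determined by the
  values together with the cell of \<open>t\<close> among the \<open>m + 1\<close> values of \<open>\<lceil>m t\<rceil>\<close>.\<close>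
lemma graph_entropy_le_rv_entropy:
  assumes I: "finite I" and m: "0 < (m :: nat)"
    and Y: "simple_function M Y"
    and det: "\<And>i x y. i \<in> I \<Longrightarrow> x \<in> space M \<Longrightarrow> y \<in> space M \<Longrightarrow> Y x = Y y \<Longrightarrow> J i x = J i y"
  shows "graph_entropy M I (\<lambda>i x. real (J i x) / m) \<le> ln (real m + 1) + rv_entropy M Y"
proof -
  interpret W: prob_space "with_unit_interval M"
    by (rule prob_space_with_unit_interval)
  have fst: "fst \<in> measurable (with_unit_interval M) M"
    unfolding with_unit_interval_def by (rule measurable_fst)
  let ?c = "\<lambda>z. \<lceil>real m * snd z\<rceil>"
  have range: "?c ` space (with_unit_interval M) \<subseteq> {0..int m}"
  proof
    fix c assume "c \<in> ?c ` space (with_unit_interval M)"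
    then obtain t where t: "c = \<lceil>real m * t\<rceil>" "0 \<le> t" "t \<le> 1"
      by (auto simp: space_with_unit_interval)
    then have "real m * t \<le> real m"
      using mult_left_mono[of t 1 "real m"] by simp
    moreover have "0 \<le> real m * t"
      using t by simp
    ultimately show "c \<in> {0..int m}"
      unfolding t(1) by (auto simp: ceiling_le_iff le_ceiling_iff)
  qed
  have snd: "(\<lambda>z. snd z) \<in> borel_measurable (with_unit_interval M)"
    unfolding with_unit_interval_def by (rule measurable_compose[OF measurable_snd measurable_unit_interval])
  have c: "simple_function (with_unit_interval M) ?c"
    unfolding simple_function_def
  proof (intro conjI ballI)
    show "finite (?c ` space (with_unit_interval M))"
      using range by (rule finite_subset) simp
    have "?c \<in> measurable (with_unit_interval M) (count_space UNIV)"
      using snd by measurable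
    then show "?c -` {x} \<inter> space (with_unit_interval M) \<in> sets (with_unit_interval M)" for x
      by (rule measurable_sets) simp
  qed
  have Yf: "simple_function (with_unit_interval M) (\<lambda>z. Y (fst z))"
    unfolding simple_function_def
  proof (intro conjI ballI)
    show "finite ((\<lambda>z. Y (fst z)) ` space (with_unit_interval M))"
      by (rule finite_subset[of _ "Y ` space M"])
         (use Y in \<open>auto simp: simple_function_def space_with_unit_interval\<close>)
    fix y
    have "(\<lambda>z. Y (fst z)) -` {y} \<inter> space (with_unit_interval M) =
        fst -` (Y -` {y} \<inter> space M) \<inter> space (with_unit_interval M)"
      by (auto simp: space_with_unit_interval)
    also have "\<dots> \<in> sets (with_unit_interval M)"
      using fst simple_functionD(2)[OF Y] by (rule measurable_sets)
    finally show "(\<lambda>z. Y (fst z)) -` {y} \<inter> space (with_unit_interval M) \<in> sets (with_unit_interval M)" .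
  qed
  have "graph_entropy M I (\<lambda>i x. real (J i x) / m) \<le> rv_entropy (with_unit_interval M) (\<lambda>z. (?c z, Y (fst z)))"
    unfolding graph_entropy_def
  proof (rule W.rv_entropy_data_processing)
    fix z z' assume z: "z \<in> space (with_unit_interval M)" "z' \<in> space (with_unit_interval M)"
      and eq: "(?c z, Y (fst z)) = (?c z', Y (fst z'))"
    \<comment> \<open>The ceiling, unlike the floor, breaks exactly at the closed thresholds
      \<open>t <= j / m\<close>, so every such condition is a union of cells.\<close>
    have iff: "t \<le> real j / m \<longleftrightarrow> \<lceil>real m * t\<rceil> \<le> int j" for t j
      using m by (simp add: ceiling_le_iff field_simps)
    have "J i (fst z) = J i (fst z')" if "i \<in> I" for i
      using det[OF that, of "fst z" "fst z'"] z eq by (auto simp: space_with_unit_interval)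
    then show "{i\<in>I. snd z \<le> real (J i (fst z)) / m} = {i\<in>I. snd z' \<le> real (J i (fst z')) / m}"
      using eq unfolding iff by auto
  qed (intro simple_function_Pair c Yf)
  also have "\<dots> \<le> rv_entropy (with_unit_interval M) ?c + rv_entropy (with_unit_interval M) (\<lambda>z. Y (fst z))"
    by (intro W.rv_entropy_Pair_le c Yf)
  also have "rv_entropy (with_unit_interval M) ?c \<le> ln (card {0..int m})"
    using c range by (intro W.rv_entropy_le_ln_card) auto
  also have "rv_entropy (with_unit_interval M) (\<lambda>z. Y (fst z)) = rv_entropy M Y"
    using rv_entropy_distr[OF fst Y] by (simp add: distr_with_unit_interval_fst comp_def)
  finally show ?thesis
    by (simp add: add.commute)
qed

end

section \<open>The boundary system\<close>

lemma graph_entropy_cong: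
  assumes "\<And>i x. i \<in> I \<Longrightarrow> x \<in> space M \<Longrightarrow> u i x = v i x"
  shows "graph_entropy M I u = graph_entropy M I v"
  unfolding graph_entropy_def
  using assms by (intro rv_entropy_cong) (auto simp: space_with_unit_interval)

text \<open>Turns a comparison for each \<open>n\<close> into one of rates: the additive constant
  disappears and the linear error survives as its slope \<open>d\<close>.\<close>

lemma limsup_div_le:
  fixes a b :: "nat \<Rightarrow> real"
  assumes "\<And>n. a n \<le> b n + c + real n * d"
  shows "limsup (\<lambda>n. ereal (a n / real n)) \<le> limsup (\<lambda>n. ereal (b n / real n)) + ereal d"
proof -
  have "(\<lambda>n. c / real n + d) \<longlonglongrightarrow> 0 + d"
    by (intro tendsto_add tendsto_const lim_const_over_n)
  then have lim: "(\<lambda>n. ereal (c / real n + d)) \<longlonglongrightarrow> ereal d"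
    by simp
  have "limsup (\<lambda>n. ereal (a n / real n)) \<le> limsup (\<lambda>n. ereal (c / real n + d) + ereal (b n / real n))"
  proof (rule Limsup_mono)
    show "\<forall>\<^sub>F n in sequentially. ereal (a n / real n) \<le> ereal (c / real n + d) + ereal (b n / real n)"
      using eventually_gt_at_top[of 0]
    proof eventually_elim
      case (elim n)
      have "a n / real n \<le> (b n + c + real n * d) / real n"
        using assms by (intro divide_right_mono) auto
      also have "\<dots> = c / real n + d + b n / real n"
        using elim by (simp add: field_simps)
      finally show ?case
        by simp
    qed
  qed
  also have "\<dots> = ereal d + limsup (\<lambda>n. ereal (b n / real n))"
    by (rule ereal_limsup_lim_add[OF lim]) simp
  finally show ?thesis
    by (simp add: add.commute)
qed

lemma UN_funpow_image:
  "(\<Union>k<n. (op ^^ k) ` g ` J) = (\<lambda>i. (op ^^ snd i) (g (fst i))) ` (J \<times> {..<n})"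
  by force

lemma simple_function_level_partition:
  assumes Z: "simple_function B Z" and Q: "Q = (\<lambda>z. Z -` {z} \<inter> space B) ` Z ` space B"
  shows "finite Q" "Q \<subseteq> sets B" "partition_on (space B) Q"
proof -
  show "finite Q" "Q \<subseteq> sets B"
    using Z unfolding Q by (auto simp: simple_function_def)
  show "partition_on (space B) Q"
  proof (rule partition_onI)
    show "\<Union>Q = space B"
      unfolding Q by auto
    show "disjnt p q" if "p \<in> Q" "q \<in> Q" "p \<noteq> q" for p q
      using that unfolding Q disjnt_def by auto
    show "{} \<notin> Q"
      unfolding Q by auto
  qed
qed

section \<open>Operator entropies read on path space\<close>

context markov_path
begin

lemma sigma_upto_sets: "sigma_upto N M n \<subseteq> sets N"
proof -
  have "{x\<in>space N. x k \<in> A} \<in> sets N" if "A \<in> sets M" for k A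
    using measurable_sets[OF measurable_coord that, of k] by (simp add: vimage_def Int_def conj_commute)
  then show ?thesis
    unfolding sigma_upto_def by (intro sets.sigma_sets_subset) auto
qed

lemma backwards_tail_sets: "C \<in> backwards_tail N M \<Longrightarrow> C \<in> sets N"
  using sigma_upto_sets[of 0] by (auto simp: backwards_tail_def)

lemma distr_coord: "distr N M (\<lambda>x. x 0) = M"
proof (rule measure_eqI)
  fix A assume "A \<in> sets (distr N M (\<lambda>x. x 0))"
  then have A: "A \<in> sets M"
    by simp
  have "emeasure (distr N M (\<lambda>x. x 0)) A = emeasure N {x\<in>space N. \<forall>k\<in>{0..0 + int 0}. x k \<in> A}"
    using A by (simp add: emeasure_distr vimage_def Int_def conj_commute)
  also have "\<dots> = (\<integral>\<^sup>+x\<in>A. path_weight P (\<lambda>_. A) 0 0 x \<partial>M)"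
    by (rule emeasure_cylinder) (rule A)
  also have "\<dots> = emeasure M A"
    using A by simp
  finally show "emeasure (distr N M (\<lambda>x. x 0)) A = emeasure M A" .
qed simp

lemma distr_past: "distr N mu past = mu"
  unfolding mu_eq by (intro distr_cong) simp_all

lemma family_entropy_state:
  assumes J: "finite J" and G: "\<And>j. j \<in> J \<Longrightarrow> G j \<in> unit_functions M"
  shows "family_entropy M (\<Union>k<n. (kernel_op P ^^ k) ` G ` J) =
    graph_entropy N (J \<times> {..<n}) (\<lambda>i x. (kernel_op P ^^ snd i) (G (fst i)) (x 0))"
  unfolding UN_funpow_image
proof (rule family_entropy_eq_graph_entropy[OF N.prob_space_axioms measurable_coord distr_coord])
  fix i assume "i \<in> J \<times> {..<n}"
  then show "(kernel_op P ^^ snd i) (G (fst i)) \<in> borel_measurable M"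
    using kernel_op_funpow_unit_function[OF kernel G, of "fst i" "snd i"] by auto
qed (use J in simp)

lemma family_entropy_past:
  assumes J: "finite J" and g: "\<And>j. j \<in> J \<Longrightarrow> g j \<in> unit_functions past_sp"
  shows "family_entropy mu (\<Union>k<n. (kernel_op K ^^ k) ` g ` J) =
    graph_entropy N (J \<times> {..<n}) (\<lambda>i x. (kernel_op K ^^ snd i) (g (fst i)) (past x))"
  unfolding UN_funpow_image
proof (rule family_entropy_eq_graph_entropy[OF N.prob_space_axioms _ distr_past])
  show "past \<in> measurable N mu"
    using measurable_past by (simp cong: measurable_cong_sets)
  fix i assume "i \<in> J \<times> {..<n}"
  then show "(kernel_op K ^^ snd i) (g (fst i)) \<in> borel_measurable mu"
    using funpow_kernel_op_K_unit[OF g, of "fst i" "snd i"] by auto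
qed (use J in simp)

text \<open>The lift of a family to coordinate 0 has the same entropy at every \<open>n\<close>,
  since \<open>K\<close> acts on it as \<open>P\<close>; the supremum for past paths is taken over
  more families.\<close>

lemma operator_entropy_le_past: "operator_entropy M P \<le> operator_entropy mu K"
  unfolding operator_entropy_def
proof (rule SUP_least)
  fix F :: "('a \<Rightarrow> real) set"
  assume "F \<in> {F. finite F \<and> (\<forall>f\<in>F. f \<in> borel_measurable M \<and> f \<in> space M \<rightarrow> {0..1})}"
  then have F: "finite F" "\<And>f. f \<in> F \<Longrightarrow> f \<in> unit_functions M"
    by auto
  let ?g = "\<lambda>(f :: 'a \<Rightarrow> real) (p :: int \<Rightarrow> 'a). f (p 0)"
  have g: "?g f \<in> unit_functions past_sp" if "f \<in> F" for f
    using F(2)[OF that] by (rule lift_unit)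
  have "family_entropy M (\<Union>k<n. (kernel_op P ^^ k) ` F) =
      family_entropy mu (\<Union>k<n. (kernel_op K ^^ k) ` ?g ` F)" for n
  proof -
    have "family_entropy M (\<Union>k<n. (kernel_op P ^^ k) ` F) =
        graph_entropy N (F \<times> {..<n}) (\<lambda>i x. (kernel_op P ^^ snd i) (fst i) (x 0))"
      using family_entropy_state[of F "\<lambda>f. f" n] F by simp
    also have "\<dots> = graph_entropy N (F \<times> {..<n}) (\<lambda>i x. (kernel_op K ^^ snd i) (?g (fst i)) (past x))"
    proof (rule graph_entropy_cong)
      fix i :: "('a \<Rightarrow> real) \<times> nat" and x assume i: "i \<in> F \<times> {..<n}" and x: "x \<in> space N"
      from i have "fst i \<in> F"
        by auto
      then have "fst i \<in> unit_functions M"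
        by (rule F(2))
      from kernel_op_lift[OF this past_in_space[OF x], of "snd i"]
      show "(kernel_op P ^^ snd i) (fst i) (x 0) = (kernel_op K ^^ snd i) (?g (fst i)) (past x)"
        by (simp add: past_def)
    qed
    also have "\<dots> = family_entropy mu (\<Union>k<n. (kernel_op K ^^ k) ` ?g ` F)"
      using family_entropy_past[of F ?g n, OF F(1) g] by simp
    finally show ?thesis .
  qed
  then have "operator_entropy_of F M P = operator_entropy_of (?g ` F) mu K"
    by (simp add: operator_entropy_of_def)
  also have "\<dots> \<le> (SUP F \<in> {F. finite F \<and> (\<forall>f\<in>F. f \<in> borel_measurable mu \<and> f \<in> space mu \<rightarrow> {0..1})}.
      operator_entropy_of F mu K)"
    using F(1) g by (intro SUP_upper) auto
  finally show "operator_entropy_of F M P \<le>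
      (SUP F \<in> {F. finite F \<and> (\<forall>f\<in>F. f \<in> borel_measurable mu \<and> f \<in> space mu \<rightarrow> {0..1})}.
        operator_entropy_of F mu K)" .
qed

end

section \<open>The boundary as a factor of path space, and the two inequalities that involve
  it\<close>

locale tail_boundary = markov_path M P N
  for M :: "'a measure" and P N +
  fixes B :: "'b measure" and T :: "'b \<Rightarrow> 'b" and \<phi> :: "(int \<Rightarrow> 'a) \<Rightarrow> 'b"
  assumes boundary: "backwards_tail_boundary M N B T \<phi>"
begin

lemma T_measurable [measurable]: "T \<in> measurable B B"
  and distr_T: "distr B B T = B"
  and \<phi>_measurable [measurable]: "\<phi> \<in> measurable N B"
  and distr_\<phi>: "distr N B \<phi> = B"
  and equivariant: "AE x in N. \<phi> (shift_by 1 x) = T (\<phi> x)"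
  and agree: "agree_mod_null N (sets (vimage_algebra (space N) \<phi> B)) (backwards_tail N M)"
  using boundary by (auto simp: backwards_tail_boundary_def pp_system_def path_shift_eq)

sublocale B: prob_space B
  using boundary by (simp add: backwards_tail_boundary_def pp_system_def)

lemma funpow_T_measurable [measurable]: "T ^^ k \<in> measurable B B"
  by (rule measurable_compose_n[OF T_measurable])

lemma distr_funpow_T: "distr N B (\<lambda>x. (T ^^ k) (\<phi> x)) = B"
proof (induction k)
  case (Suc k)
  have "distr N B (\<lambda>x. (T ^^ Suc k) (\<phi> x)) = distr (distr N B (\<lambda>x. (T ^^ k) (\<phi> x))) B T"
    by (subst distr_distr) (simp_all add: comp_def)
  then show ?case
    by (simp add: Suc distr_T)
qed (simp add: distr_\<phi>)

lemma funpow_T_\<phi>_measurable: "(\<lambda>x. (T ^^ k) (\<phi> x)) \<in> measurable N B"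
  by measurable

text \<open>Each iteration uses the almost sure identity at a shifted point, so null sets must be
  shift invariant.\<close>

lemma equivariant_funpow: "AE x in N. \<phi> (shift_by (int k) x) = (T ^^ k) (\<phi> x)"
proof (induction k)
  case (Suc k)
  have "AE x in N. \<phi> (shift_by 1 (shift_by (int k) x)) = T (\<phi> (shift_by (int k) x))"
    by (rule AE_shift_by[OF equivariant])
  with Suc show ?case
    by eventually_elim (simp add: add.commute)
qed simp

lemma vimage_sets: "sets (vimage_algebra (space N) \<phi> B) = {\<phi> -` C \<inter> space N | C. C \<in> sets B}"
  using measurable_space[OF \<phi>_measurable] by (intro sets_vimage_algebra2) auto

lemma tail_of_boundary:
  assumes "C \<in> sets B"
  shows "\<exists>D\<in>backwards_tail N M. AE x in N. \<phi> x \<in> C \<longleftrightarrow> x \<in> D"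
proof -
  have "\<phi> -` C \<inter> space N \<in> sets (vimage_algebra (space N) \<phi> B)"
    using assms by (auto simp: vimage_sets)
  then obtain D where D: "D \<in> backwards_tail N M"
      "(\<phi> -` C \<inter> space N - D) \<union> (D - \<phi> -` C \<inter> space N) \<in> null_sets N"
    using agree unfolding agree_mod_null_def by blast
  from AE_not_in[OF D(2)] AE_space have "AE x in N. \<phi> x \<in> C \<longleftrightarrow> x \<in> D"
    by eventually_elim auto
  then show ?thesis
    using D(1) by blast
qed

lemma boundary_of_tail:
  assumes "D \<in> backwards_tail N M"
  shows "\<exists>C\<in>sets B. AE x in N. \<phi> x \<in> C \<longleftrightarrow> x \<in> D"
proof -
  obtain A where A: "A \<in> sets (vimage_algebra (space N) \<phi> B)" "(A - D) \<union> (D - A) \<in> null_sets N"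
    using agree assms unfolding agree_mod_null_def by blast
  then obtain C where C: "C \<in> sets B" "A = \<phi> -` C \<inter> space N"
    by (auto simp: vimage_sets)
  from AE_not_in[OF A(2)] AE_space have "AE x in N. \<phi> x \<in> C \<longleftrightarrow> x \<in> D"
    by eventually_elim (auto simp: C(2))
  then show ?thesis
    using C(1) by blast
qed

text \<open>The itinerary stored as its set of pairs of cell and time, to match the random sets of
  indices above.\<close>

definition itinerary :: "'b set set \<Rightarrow> nat \<Rightarrow> 'b \<Rightarrow> ('b set \<times> nat) set" where
  "itinerary Q n b = {i \<in> Q \<times> {..<n}. (T ^^ snd i) b \<in> fst i}"

lemma simple_function_itinerary:
  assumes "finite Q" "Q \<subseteq> sets B"
  shows "simple_function B (itinerary Q n)"
  unfolding itinerary_def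
proof (rule B.simple_function_Collect)
  fix i assume "i \<in> Q \<times> {..<n}"
  then have [measurable]: "fst i \<in> sets B"
    using assms by auto
  show "Measurable.pred B (\<lambda>b. (T ^^ snd i) b \<in> fst i)"
    by measurable
qed (use assms in simp)

lemma ks_entropy_of_eq:
  assumes Q: "finite Q" "Q \<subseteq> sets B" "partition_on (space B) Q"
  shows "ks_entropy_of Q B T = limsup (\<lambda>n. ereal (rv_entropy B (itinerary Q n) / real n))"
proof -
  have "shannon_entropy B (common_refinement (space B)
      ((\<lambda>k. preimage_partition (space B) (T ^^ k) Q) ` {..<n})) = rv_entropy B (itinerary Q n)" for n
  proof (rule shannon_entropy_common_refinement)
    show "finite R" if "R \<in> (\<lambda>k. preimage_partition (space B) (T ^^ k) Q) ` {..<n}" for R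
      using that Q(1) by (auto simp: preimage_partition_def)
    show "\<exists>!S. S \<in> R \<and> b \<in> S" if R: "R \<in> (\<lambda>k. preimage_partition (space B) (T ^^ k) Q) ` {..<n}"
      and b: "b \<in> space B" for R b
    proof -
      obtain k where k: "R = (\<lambda>C. (T ^^ k) -` C \<inter> space B) ` Q"
        using R by (auto simp: preimage_partition_def)
      have "(T ^^ k) b \<in> space B"
        using b measurable_space[OF funpow_T_measurable] by blast
      then obtain C where C: "C \<in> Q" "(T ^^ k) b \<in> C"
        using partition_onD1[OF Q(3)] by blast
      have unique: "C' = C" if "C' \<in> Q" "(T ^^ k) b \<in> C'" for C'
        using disjointD[OF partition_onD2[OF Q(3)] that(1) C(1)] that(2) C(2) by blast
      show ?thesis
      proof (rule ex1I)
        show "(T ^^ k) -` C \<inter> space B \<in> R \<and> b \<in> (T ^^ k) -` C \<inter> space B"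
          using C b by (auto simp: k)
        show "S = (T ^^ k) -` C \<inter> space B" if "S \<in> R \<and> b \<in> S" for S
          using that unique by (auto simp: k)
      qed
    qed
    fix b c assume b: "b \<in> space B" and c: "c \<in> space B"
    have "itinerary Q n b = itinerary Q n c \<longleftrightarrow>
        (\<forall>k\<in>{..<n}. \<forall>C\<in>Q. (T ^^ k) b \<in> C \<longleftrightarrow> (T ^^ k) c \<in> C)"
      by (auto simp: itinerary_def set_eq_iff)
    also have "\<dots> \<longleftrightarrow> (\<forall>R\<in>(\<lambda>k. preimage_partition (space B) (T ^^ k) Q) ` {..<n}. \<forall>S\<in>R. b \<in> S \<longleftrightarrow> c \<in> S)"
      using b c by (simp add: preimage_partition_def)
    finally show "itinerary Q n b = itinerary Q n c \<longleftrightarrow>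
        (\<forall>R\<in>(\<lambda>k. preimage_partition (space B) (T ^^ k) Q) ` {..<n}. \<forall>S\<in>R. b \<in> S \<longleftrightarrow> c \<in> S)" .
  qed simp
  then show ?thesis
    by (simp add: ks_entropy_of_def)
qed

text \<open>The freedom to start at time \<open>l\<close> absorbs the delay \<open>l\<close> that
  the approximation of tail sets introduces.\<close>

lemma rv_entropy_itinerary_transport:
  assumes "finite Q" "Q \<subseteq> sets B"
  shows "rv_entropy B (itinerary Q n) = rv_entropy N (\<lambda>x. itinerary Q n ((T ^^ l) (\<phi> x)))"
  using rv_entropy_distr[OF funpow_T_\<phi>_measurable simple_function_itinerary[OF assms], of l n]
  by (simp add: distr_funpow_T comp_def)

text \<open>With one function \<open>G C\<close> per cell, the iterate at time \<open>k\<close>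
  follows the event that the boundary point at time \<open>l + k\<close> lies in \<open>C\<close>,
  within \<open>e\<close> for all \<open>k\<close>. Each time step thus costs at most
  \<open>card Q\<close> times \<open>2 * sqrt e\<close>.\<close>

lemma ks_entropy_of_le:
  assumes Q: "finite Q" "Q \<subseteq> sets B" "partition_on (space B) Q" and e: "e > 0"
  shows "ks_entropy_of Q B T \<le> operator_entropy M P + ereal (real (card Q) * (2 * sqrt e))"
proof -
  have "\<forall>C. \<exists>D. C \<in> Q \<longrightarrow> D \<in> backwards_tail N M \<and> (AE x in N. \<phi> x \<in> C \<longleftrightarrow> x \<in> D)"
    using tail_of_boundary Q(2) by blast
  then obtain D where D: "\<And>C. C \<in> Q \<Longrightarrow> D C \<in> backwards_tail N M"
      "\<And>C. C \<in> Q \<Longrightarrow> AE x in N. \<phi> x \<in> C \<longleftrightarrow> x \<in> D C"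
    by metis
  let ?close = "\<lambda>C l G. \<forall>k. (\<integral>x. \<bar>(kernel_op P ^^ k) G (x 0) - indicator (D C) (shift_by (int l + int k) x)\<bar> \<partial>N) \<le> e"
  have "\<forall>C. \<exists>l0. C \<in> Q \<longrightarrow> (\<forall>l\<ge>l0. \<exists>G\<in>unit_functions M. ?close C l G)"
    using tail_approximation[OF D(1) e] by blast
  from choice[OF this] obtain l0
    where l0: "\<And>C l. C \<in> Q \<Longrightarrow> l0 C \<le> l \<Longrightarrow> \<exists>G\<in>unit_functions M. ?close C l G"
    by blast
  \<comment> \<open>A common upper bound for the thresholds of the finitely many cells.\<close>
  define l where "l = (\<Sum>C\<in>Q. l0 C)"
  have "l0 C \<le> l" if "C \<in> Q" for C
    unfolding l_def using that Q(1) by (intro member_le_sum) auto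
  then have "\<forall>C. \<exists>G. C \<in> Q \<longrightarrow> G \<in> unit_functions M \<and> ?close C l G"
    using l0 by blast
  from choice[OF this] obtain G
    where G: "\<And>C. C \<in> Q \<Longrightarrow> G C \<in> unit_functions M" "\<And>C. C \<in> Q \<Longrightarrow> ?close C l (G C)"
    by blast
  have bound: "rv_entropy B (itinerary Q n) \<le>
      family_entropy M (\<Union>k<n. (kernel_op P ^^ k) ` G ` Q) + 0 + real n * (real (card Q) * (2 * sqrt e))" for n
  proof -
    let ?I = "Q \<times> {..<n}"
    let ?u = "\<lambda>i x. (kernel_op P ^^ snd i) (G (fst i)) (x 0)"
    let ?A = "\<lambda>i x. (T ^^ snd i) ((T ^^ l) (\<phi> x)) \<in> fst i"
    have PG: "(kernel_op P ^^ k) (G C) \<in> unit_functions M" if "C \<in> Q" for k C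
      by (rule kernel_op_funpow_unit_function[OF kernel G(1)[OF that]])
    have u: "?u i \<in> unit_functions N" if "i \<in> ?I" for i
    proof -
      from that have "fst i \<in> Q"
        by auto
      then have "(kernel_op P ^^ snd i) (G (fst i)) \<in> unit_functions M"
        by (rule PG)
      then have "(kernel_op P ^^ snd i) (G (fst i)) \<in> borel_measurable M"
        "(kernel_op P ^^ snd i) (G (fst i)) \<in> space M \<rightarrow> {0..1}"
        by auto
      then show ?thesis
        using coord_space by (auto intro!: measurable_compose[OF measurable_coord])
    qed
    have A: "Measurable.pred N (?A i)" if "i \<in> ?I" for i
    proof -
      have [measurable]: "fst i \<in> sets B"
        using that Q(2) by auto
      show ?thesis
        by measurable
    qed
    have le: "(\<integral>x. \<bar>?u i x - of_bool (?A i x)\<bar> \<partial>N) \<le> e" if i: "i \<in> ?I" for i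
    proof -
      obtain C k where ik: "i = (C, k)" and C: "C \<in> Q"
        using i by auto
      have [measurable]: "?u i \<in> borel_measurable N" "Measurable.pred N (?A i)" "D C \<in> sets N"
        using u[OF i] A[OF i] backwards_tail_sets[OF D(1)[OF C]] by auto
      have "AE x in N. \<bar>?u i x - of_bool (?A i x)\<bar> =
          \<bar>(kernel_op P ^^ k) (G C) (x 0) - indicator (D C) (shift_by (int l + int k) x)\<bar>"
        \<comment> \<open>The first fact replaces the cell by its tail set at the shifted path, the
          second turns the shift by \<open>l + k\<close> into an iterate of
          \<open>T\<close>.\<close>
        using AE_shift_by[OF D(2)[OF C], of "int (l + k)"] equivariant_funpow[of "l + k"]
      proof eventually_elim
        case (elim x)
        have "(T ^^ k) ((T ^^ l) (\<phi> x)) = (T ^^ (l + k)) (\<phi> x)"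
          by (simp add: add.commute[of l] funpow_add)
        then show ?case
          using elim by (simp add: ik indicator_def)
      qed
      moreover have "(\<lambda>x. \<bar>?u i x - of_bool (?A i x)\<bar>) \<in> borel_measurable N"
        by measurable
      moreover have "(\<lambda>x. \<bar>(kernel_op P ^^ k) (G C) (x 0) - indicator (D C) (shift_by (int l + int k) x)\<bar>)
          \<in> borel_measurable N"
      proof -
        have "(\<lambda>x. indicator (D C) (shift_by (int l + int k) x) :: real) \<in> borel_measurable N"
          by (rule measurable_compose[OF measurable_shift_by]) measurable
        moreover have "(\<lambda>x. (kernel_op P ^^ k) (G C) (x 0)) \<in> borel_measurable N"
          using u[OF i] by (simp add: ik)
        ultimately show ?thesis
          by measurable
      qed
      ultimately have "(\<integral>x. \<bar>?u i x - of_bool (?A i x)\<bar> \<partial>N) =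
          (\<integral>x. \<bar>(kernel_op P ^^ k) (G C) (x 0) - indicator (D C) (shift_by (int l + int k) x)\<bar> \<partial>N)"
        by (intro integral_cong_AE)
      then show ?thesis
        using G(2)[OF C] by simp
    qed
    have "rv_entropy B (itinerary Q n) = rv_entropy N (\<lambda>x. {i\<in>?I. ?A i x})"
      using rv_entropy_itinerary_transport[OF Q(1,2), of n l] by (simp add: itinerary_def)
    also have "\<dots> \<le> graph_entropy N ?I ?u + (\<Sum>i\<in>?I. 2 * sqrt (\<integral>x. \<bar>?u i x - of_bool (?A i x)\<bar> \<partial>N))"
      using Q(1) by (intro N.rv_entropy_le_graph_entropy[OF _ u A]) simp_all
    also have "(\<Sum>i\<in>?I. 2 * sqrt (\<integral>x. \<bar>?u i x - of_bool (?A i x)\<bar> \<partial>N)) \<le> (\<Sum>i\<in>?I. 2 * sqrt e)"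
      using le by (intro sum_mono mult_left_mono real_sqrt_le_mono) auto
    also have "\<dots> = real n * (real (card Q) * (2 * sqrt e))"
      by (simp add: card_cartesian_product)
    also have "graph_entropy N ?I ?u = family_entropy M (\<Union>k<n. (kernel_op P ^^ k) ` G ` Q)"
      using family_entropy_state[of Q G n, OF Q(1) G(1)] by simp
    finally show ?thesis
      by simp
  qed
  have "ks_entropy_of Q B T \<le> operator_entropy_of (G ` Q) M P + ereal (real (card Q) * (2 * sqrt e))"
    unfolding ks_entropy_of_eq[OF Q] operator_entropy_of_def by (rule limsup_div_le[OF bound])
  also have "operator_entropy_of (G ` Q) M P \<le> operator_entropy M P"
    unfolding operator_entropy_def using Q(1) G(1) by (intro SUP_upper) auto
  finally show ?thesis
    by (simp add: add_right_mono)
qed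

lemma ks_entropy_le: "ks_entropy B T \<le> operator_entropy M P"
  unfolding ks_entropy_def
proof (rule SUP_least)
  fix Q assume "Q \<in> {Q. finite Q \<and> Q \<subseteq> sets B \<and> partition_on (space B) Q}"
  then have Q: "finite Q" "Q \<subseteq> sets B" "partition_on (space B) Q"
    by auto
  show "ks_entropy_of Q B T \<le> operator_entropy M P"
  proof (rule ereal_le_epsilon2)
    fix d :: real assume d: "0 < d"
    \<comment> \<open>The error level will be \<open>s^2\<close>, which clears the square root; the
      added 1 keeps the denominator positive if \<open>Q\<close> is empty.\<close>
    define s where "s = d / (2 * (real (card Q) + 1))"
    have s: "0 < s"
      using d by (simp add: s_def add_nonneg_pos)
    have "sqrt (s\<^sup>2) = s"
      using s by simp
    then have "real (card Q) * (2 * sqrt (s\<^sup>2)) = d * (real (card Q) / (real (card Q) + 1))"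
      by (simp only: s_def) (simp add: field_simps)
    also have "\<dots> \<le> d * 1"
      using d by (intro mult_left_mono) auto
    finally have "operator_entropy M P + ereal (real (card Q) * (2 * sqrt (s\<^sup>2))) \<le> operator_entropy M P + ereal d"
      by (intro add_left_mono) simp
    then show "ks_entropy_of Q B T \<le> operator_entropy M P + ereal d"
      using ks_entropy_of_le[OF Q, of "s\<^sup>2"] s by (meson order_trans zero_less_power)
  qed
qed

text \<open>The level sets of the rounded-down function \<open>m * h\<close> are tail events, so
  each agrees almost surely with a set of the boundary. The index of that set is the value of
  \<open>J\<close>.\<close>

lemma discretize_on_boundary:
  assumes h: "h \<in> unit_functions N" and tail: "\<And>S. S \<in> sets borel \<Longrightarrow> {x\<in>space N. h x \<in> S} \<in> backwards_tail N M"
    and m: "0 < (m :: nat)"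
  obtains J where "simple_function B J" "\<And>b. J b \<le> m" "AE x in N. \<bar>real (J (\<phi> x)) / m - h x\<bar> \<le> 1 / m"
proof -
  define L where "L j = {x\<in>space N. h x \<in> {y. \<lfloor>real m * y\<rfloor> = int j}}" for j :: nat
  have "{y :: real. \<lfloor>real m * y\<rfloor> = int j} \<in> sets borel" for j
    by measurable
  then have "L j \<in> backwards_tail N M" for j
    unfolding L_def by (rule tail)
  then have "\<forall>j. \<exists>C. C \<in> sets B \<and> (AE x in N. \<phi> x \<in> C \<longleftrightarrow> x \<in> L j)"
    using boundary_of_tail by blast
  then obtain C where C: "\<And>j. C j \<in> sets B" "\<And>j. AE x in N. \<phi> x \<in> C j \<longleftrightarrow> x \<in> L j"
    by metis
  \<comment> \<open>Almost surely the set of indices is a singleton and the sum extracts its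
    element; \<open>min m\<close> keeps \<open>J\<close> bounded at exceptional points too. The
    index \<open>m\<close> occurs where \<open>h\<close> equals 1.\<close>
  define J where "J b = min m (\<Sum>{j\<in>{..m}. b \<in> C j})" for b
  have "simple_function B (\<lambda>b. {j\<in>{..m}. b \<in> C j})"
    using C(1) by (intro B.simple_function_Collect) (auto simp: pred_def sets.Int_space_eq2 Collect_conj_eq)
  from simple_function_compose[OF this, of "\<lambda>A. min m (\<Sum>A)"] have "simple_function B J"
    by (simp add: J_def[abs_def] comp_def)
  moreover have "J b \<le> m" for b
    by (simp add: J_def)
  moreover have "AE x in N. \<bar>real (J (\<phi> x)) / m - h x\<bar> \<le> 1 / m"
  proof -
    have "AE x in N. \<forall>j. \<phi> x \<in> C j \<longleftrightarrow> x \<in> L j"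
      using C(2) by (simp add: AE_all_countable)
    then show ?thesis
      using AE_space
    proof eventually_elim
      case (elim x)
      define j where "j = nat \<lfloor>real m * h x\<rfloor>"
      have hx: "0 \<le> h x" "h x \<le> 1"
        using h elim(2) by auto
      then have "0 \<le> real m * h x" "real m * h x \<le> real m"
        using m by (simp_all add: mult_left_le)
      then have j: "\<lfloor>real m * h x\<rfloor> = int j" "j \<le> m"
        by (auto simp: j_def floor_le_iff nat_le_iff)
      then have "{i\<in>{..m}. \<phi> x \<in> C i} = {j}"
        using elim by (auto simp: L_def)
      then have "J (\<phi> x) = j"
        using j(2) by (simp add: J_def)
      moreover have "real j \<le> real m * h x" "real m * h x < real j + 1"
        using j(1) by linarith+
      then have "\<bar>real j - real m * h x\<bar> \<le> 1"
        by linarith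
      then have "\<bar>(real j - real m * h x) / real m\<bar> \<le> 1 / real m"
        using m by (simp add: abs_divide divide_right_mono)
      moreover have "(real j - real m * h x) / real m = real j / real m - h x"
        using m by (simp add: field_simps)
      ultimately show ?case
        by simp
    qed
  qed
  ultimately show ?thesis
    by (rule that)
qed

text \<open>The itinerary determines the rounded limits at all times below \<open>n\<close>, so
  their subgraphs cost its entropy plus a single \<open>ln (m + 1)\<close>. The L1 error
  \<open>2 / m\<close> is \<open>1 / m\<close> for the martingale convergence plus
  \<open>1 / m\<close> for the rounding.\<close>

lemma operator_entropy_of_past_le:
  assumes F: "finite F" "\<And>f. f \<in> F \<Longrightarrow> f \<in> unit_functions past_sp" and m: "0 < (m :: nat)"
  shows "operator_entropy_of F mu K \<le> ks_entropy B T + ereal (real (card F) * (2 * sqrt (2 / m)))"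
proof -
  let ?err = "\<lambda>f h k. \<integral>x. \<bar>(kernel_op K ^^ k) f (past x) - h (shift_by (int k) x)\<bar> \<partial>N"
  \<comment> \<open>Bundles the properties of the limit, so that one application of choice covers
    all of \<open>F\<close>.\<close>
  define limit where "limit f h \<longleftrightarrow> h \<in> unit_functions N \<and>
      (\<forall>S\<in>sets borel. {x\<in>space N. h x \<in> S} \<in> backwards_tail N M) \<and> ?err f h \<longlonglongrightarrow> 0" for f h
  have "\<exists>h. limit f h" if f: "f \<in> F" for f
  proof (rule reverse_martingale_limit[OF F(2)[OF f]])
    fix h assume "h \<in> unit_functions N"
        "\<And>S. S \<in> sets borel \<Longrightarrow> {x\<in>space N. h x \<in> S} \<in> backwards_tail N M" "?err f h \<longlonglongrightarrow> 0"
    then show ?thesis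
      unfolding limit_def by (intro exI[of _ h] conjI ballI)
  qed
  then have "\<forall>f\<in>F. \<exists>h. limit f h"
    by simp
  from bchoice[OF this] obtain h where "\<forall>f\<in>F. limit f (h f)"
    by (elim exE)
  then have h: "\<And>f. f \<in> F \<Longrightarrow> h f \<in> unit_functions N"
      "\<And>f S. f \<in> F \<Longrightarrow> S \<in> sets borel \<Longrightarrow> {x\<in>space N. h f x \<in> S} \<in> backwards_tail N M"
      "\<And>f. f \<in> F \<Longrightarrow> ?err f (h f) \<longlonglongrightarrow> 0"
    by (simp_all only: limit_def)
  define approx where "approx f J \<longleftrightarrow> simple_function B J \<and> (\<forall>b. J b \<le> m) \<and>
      (AE x in N. \<bar>real (J (\<phi> x)) / m - h f x\<bar> \<le> 1 / m)" for f J
  have "\<exists>J. approx f J" if f: "f \<in> F" for f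
  proof (rule discretize_on_boundary[OF h(1,2)[OF f] m])
    fix J assume "simple_function B J" "\<And>b. J b \<le> m" "AE x in N. \<bar>real (J (\<phi> x)) / m - h f x\<bar> \<le> 1 / m"
    then show ?thesis
      unfolding approx_def by (intro exI[of _ J] conjI allI)
  qed
  then have "\<forall>f\<in>F. \<exists>J. approx f J"
    by simp
  from bchoice[OF this] obtain J where "\<forall>f\<in>F. approx f (J f)"
    by (elim exE)
  then have J: "\<And>f. f \<in> F \<Longrightarrow> simple_function B (J f)" "\<And>f b. f \<in> F \<Longrightarrow> J f b \<le> m"
      "\<And>f. f \<in> F \<Longrightarrow> AE x in N. \<bar>real (J f (\<phi> x)) / m - h f x\<bar> \<le> 1 / m"
    by (simp_all only: approx_def)
  have "\<forall>f\<in>F. \<forall>\<^sub>F k in sequentially. ?err f (h f) k < 1 / m"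
    using h(3) m by (auto intro!: order_tendstoD(2))
  then have "\<forall>\<^sub>F k in sequentially. \<forall>f\<in>F. ?err f (h f) k < 1 / m"
    using F(1) by (simp add: eventually_ball_finite_distrib)
  then obtain k0 where k0: "\<And>f k. f \<in> F \<Longrightarrow> k0 \<le> k \<Longrightarrow> ?err f (h f) k < 1 / m"
    by (auto simp: eventually_sequentially)
  \<comment> \<open>The joint value of all roundings, stored as their graph; its level sets form the
    partition \<open>Q\<close>.\<close>
  define Z where "Z b = {i\<in>F \<times> {..m}. J (fst i) b = snd i}" for b
  have Z: "simple_function B Z"
    unfolding Z_def
  proof (rule B.simple_function_Collect)
    fix i assume "i \<in> F \<times> {..m}"
    then have [measurable]: "J (fst i) \<in> measurable B (count_space UNIV)"
      using J(1) by (auto intro: measurable_simple_function)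
    show "Measurable.pred B (\<lambda>b. J (fst i) b = snd i)"
      by measurable
  qed (use F in simp)
  have ZJ: "J f b = J f c" if "Z b = Z c" "f \<in> F" for f b c
  proof -
    have "(f, J f b) \<in> Z b"
      using that(2) J(2) by (simp add: Z_def)
    then have "(f, J f b) \<in> Z c"
      using that(1) by simp
    then show ?thesis
      by (simp add: Z_def)
  qed
  define Q where "Q = (\<lambda>z. Z -` {z} \<inter> space B) ` Z ` space B"
  note Q = simple_function_level_partition[OF Z Q_def]
  have bound: "family_entropy mu (\<Union>k<n. (kernel_op K ^^ k) ` F) \<le>
      rv_entropy B (itinerary Q n) + (ln (real m + 1) + real (card F) * (2 * real k0)) +
      real n * (real (card F) * (2 * sqrt (2 / m)))" for n
  proof -
    let ?I = "F \<times> {..<n}"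
    let ?u = "\<lambda>i x. (kernel_op K ^^ snd i) (fst i) (past x)"
    define JN where "JN i x = J (fst i) ((T ^^ snd i) (\<phi> x))" for i x
    let ?v = "\<lambda>i x. real (JN i x) / m"
    have u: "?u i \<in> unit_functions N" if "i \<in> ?I" for i
    proof -
      from that have "fst i \<in> F"
        by auto
      then have "(kernel_op K ^^ snd i) (fst i) \<in> unit_functions past_sp"
        by (intro funpow_kernel_op_K_unit F(2))
      then have "(kernel_op K ^^ snd i) (fst i) \<in> borel_measurable past_sp"
        "(kernel_op K ^^ snd i) (fst i) \<in> space past_sp \<rightarrow> {0..1}"
        by auto
      then show ?thesis
        using past_in_space by (auto intro!: measurable_compose[OF measurable_past])
    qed
    have v: "?v i \<in> unit_functions N" if i: "i \<in> ?I" for i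
    proof -
      have "J (fst i) \<in> measurable B (count_space UNIV)"
        using i J(1) by (auto intro: measurable_simple_function)
      from measurable_compose[OF funpow_T_\<phi>_measurable this]
      have "JN i \<in> measurable N (count_space UNIV)"
        by (simp add: JN_def[abs_def])
      then have "?v i \<in> borel_measurable N"
        by (rule measurable_compose) simp
      moreover have "?v i x \<in> {0..1}" for x
        using J(2)[of "fst i"] i m by (auto simp: JN_def)
      ultimately show ?thesis
        by auto
    qed
    have int: "integrable N (\<lambda>x. \<bar>?u i x - ?v i x\<bar>)" if "i \<in> ?I" for i
      using u[OF that] v[OF that]
      by (intro Bochner_Integration.integrable_abs Bochner_Integration.integrable_diff N.integrable_unit_function)
    have err1: "(\<integral>x. \<bar>?u i x - ?v i x\<bar> \<partial>N) \<le> 1" if i: "i \<in> ?I" for i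
    proof -
      have "\<bar>?u i x - ?v i x\<bar> \<le> 1" if "x \<in> space N" for x
        using unit_functionsD(2,3)[OF u[OF i] that] unit_functionsD(2,3)[OF v[OF i] that]
        by linarith
      then have "(\<integral>x. \<bar>?u i x - ?v i x\<bar> \<partial>N) \<le> (\<integral>x. 1 \<partial>N)"
        using int[OF i] by (intro integral_mono) auto
      then show ?thesis
        by (simp add: N.prob_space)
    qed
    have err2: "(\<integral>x. \<bar>?u i x - ?v i x\<bar> \<partial>N) \<le> 2 / m" if i: "i \<in> ?I" and k: "k0 \<le> snd i" for i
    proof -
      obtain f k where ik: "i = (f, k)" and f: "f \<in> F"
        using i by auto
      have hm: "h f \<in> borel_measurable N" "h f \<in> space N \<rightarrow> {0..1}"
        using h(1)[OF f] by auto
      then have hs: "(\<lambda>x. h f (shift_by (int k) x)) \<in> unit_functions N"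
        using shift_by_space by (auto intro!: measurable_compose[OF measurable_shift_by])
      have iuh: "integrable N (\<lambda>x. \<bar>?u i x - h f (shift_by (int k) x)\<bar>)"
        using u[OF i] hs
        by (intro Bochner_Integration.integrable_abs Bochner_Integration.integrable_diff N.integrable_unit_function)
      have "AE x in N. \<bar>?u i x - ?v i x\<bar> \<le> \<bar>?u i x - h f (shift_by (int k) x)\<bar> + 1 / m"
        using AE_shift_by[OF J(3)[OF f], of "int k"] equivariant_funpow[of k]
      proof eventually_elim
        case (elim x)
        then have "\<bar>?v i x - h f (shift_by (int k) x)\<bar> \<le> 1 / m"
          by (simp add: JN_def ik)
        then show ?case
          by linarith
      qed
      then have "(\<integral>x. \<bar>?u i x - ?v i x\<bar> \<partial>N) \<le> (\<integral>x. \<bar>?u i x - h f (shift_by (int k) x)\<bar> + 1 / m \<partial>N)"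
        using int[OF i] iuh by (intro integral_mono_AE) auto
      also have "\<dots> = ?err f (h f) k + 1 / m"
        using iuh by (simp add: N.prob_space ik)
      also have "\<dots> \<le> 2 / m"
        using k0[OF f, of k] k by (simp add: ik)
      finally show ?thesis .
    qed
    have "family_entropy mu (\<Union>k<n. (kernel_op K ^^ k) ` F) = graph_entropy N ?I ?u"
      using family_entropy_past[of F "\<lambda>f. f" n] F by simp
    also have "\<dots> \<le> graph_entropy N ?I ?v + (\<Sum>i\<in>?I. 2 * sqrt (\<integral>x. \<bar>?u i x - ?v i x\<bar> \<partial>N))"
      using F(1) by (intro N.graph_entropy_perturb u v) simp_all
    \<comment> \<open>Before \<open>k0\<close> only the trivial L1 bound 1 is available, costing 2
      per function and time. These times contribute to the constant, the later ones to the
      slope.\<close>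
    also have "(\<Sum>i\<in>?I. 2 * sqrt (\<integral>x. \<bar>?u i x - ?v i x\<bar> \<partial>N)) \<le>
        (\<Sum>i\<in>?I. (if snd i < k0 then 2 else 0) + 2 * sqrt (2 / m))"
    proof (rule sum_mono)
      fix i assume i: "i \<in> ?I"
      show "2 * sqrt (\<integral>x. \<bar>?u i x - ?v i x\<bar> \<partial>N) \<le> (if snd i < k0 then 2 else 0) + 2 * sqrt (2 / m)"
      proof (cases "snd i < k0")
        case True
        have "sqrt (\<integral>x. \<bar>?u i x - ?v i x\<bar> \<partial>N) \<le> 1"
          using err1[OF i] by (simp add: real_sqrt_le_1_iff)
        moreover have "0 \<le> sqrt (2 / m)"
          by simp
        ultimately have "2 * sqrt (\<integral>x. \<bar>?u i x - ?v i x\<bar> \<partial>N) \<le> 2 + 2 * sqrt (2 / m)"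
          by linarith
        then show ?thesis
          using True by simp
      next
        case False
        then have "sqrt (\<integral>x. \<bar>?u i x - ?v i x\<bar> \<partial>N) \<le> sqrt (2 / m)"
          using err2[OF i] by (intro real_sqrt_le_mono) simp
        then show ?thesis
          using False by simp
      qed
    qed
    also have "\<dots> = (\<Sum>i\<in>?I. if snd i < k0 then 2 else 0) + real n * (real (card F) * (2 * sqrt (2 / m)))"
      by (simp add: sum.distrib card_cartesian_product)
    also have "(\<Sum>i\<in>?I. if snd i < k0 then 2 else 0) \<le> real (card F) * (2 * real k0)"
    proof -
      have "(\<Sum>k<n. if k < k0 then 2 else 0 :: real) = (\<Sum>k\<in>{k. k < n \<and> k < k0}. 2)"
        by (subst sum.mono_neutral_cong_right[of "{..<n}" "{k. k < n \<and> k < k0}"]) auto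
      also have "\<dots> \<le> (\<Sum>k<k0. 2)"
        by (intro sum_mono2) auto
      finally have "(\<Sum>k<n. if k < k0 then 2 else 0 :: real) \<le> 2 * real k0"
        by simp
      then have "real (card F) * (\<Sum>k<n. if k < k0 then 2 else 0) \<le> real (card F) * (2 * real k0)"
        by (rule mult_left_mono) simp
      moreover have "(\<Sum>i\<in>?I. if snd i < k0 then 2 else 0 :: real) = (\<Sum>f\<in>F. \<Sum>k<n. if k < k0 then 2 else 0)"
        unfolding sum.cartesian_product by (intro sum.cong) auto
      ultimately show ?thesis
        by simp
    qed
    also have "graph_entropy N ?I ?v \<le> ln (real m + 1) + rv_entropy N (\<lambda>x. itinerary Q n (\<phi> x))"
    proof (rule N.graph_entropy_le_rv_entropy[OF _ m])
      show "finite ?I"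
        using F(1) by simp
      show "simple_function N (\<lambda>x. itinerary Q n (\<phi> x))"
        unfolding itinerary_def
      proof (rule N.simple_function_Collect)
        fix i assume "i \<in> Q \<times> {..<n}"
        then have [measurable]: "fst i \<in> sets B"
          using Q(2) by auto
        show "Measurable.pred N (\<lambda>x. (T ^^ snd i) (\<phi> x) \<in> fst i)"
          by measurable
      qed (use Q(1) in simp)
      fix i x y assume i: "i \<in> ?I" and x: "x \<in> space N" and y: "y \<in> space N"
        and eq: "itinerary Q n (\<phi> x) = itinerary Q n (\<phi> y)"
      have sp: "(T ^^ snd i) (\<phi> x) \<in> space B"
        using x measurable_space[OF funpow_T_\<phi>_measurable] by blast
      define C where "C = Z -` {Z ((T ^^ snd i) (\<phi> x))} \<inter> space B"
      \<comment> \<open>The cell of \<open>x\<close> at this time occurs in its itinerary, hence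
        also in that of \<open>y\<close>; being a level set of \<open>Z\<close>, it fixes all the
        rounded values.\<close>
      have "(C, snd i) \<in> itinerary Q n (\<phi> x)"
        using sp i by (auto simp: itinerary_def C_def Q_def)
      then have "(T ^^ snd i) (\<phi> y) \<in> C"
        unfolding eq by (simp add: itinerary_def)
      then have "Z ((T ^^ snd i) (\<phi> x)) = Z ((T ^^ snd i) (\<phi> y))"
        by (simp add: C_def)
      moreover from i have "fst i \<in> F"
        by auto
      ultimately show "JN i x = JN i y"
        unfolding JN_def by (rule ZJ)
    qed
    also have "rv_entropy N (\<lambda>x. itinerary Q n (\<phi> x)) = rv_entropy B (itinerary Q n)"
      using rv_entropy_itinerary_transport[OF Q(1,2), of n 0] by simp
    finally show ?thesis
      by simp
  qed
  have "operator_entropy_of F mu K \<le> ks_entropy_of Q B T + ereal (real (card F) * (2 * sqrt (2 / m)))"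
    unfolding ks_entropy_of_eq[OF Q] operator_entropy_of_def by (rule limsup_div_le[OF bound])
  also have "ks_entropy_of Q B T \<le> ks_entropy B T"
    unfolding ks_entropy_def using Q by (intro SUP_upper) auto
  finally show ?thesis
    by (simp add: add_right_mono)
qed

lemma operator_entropy_past_le: "operator_entropy mu K \<le> ks_entropy B T"
proof -
  have "operator_entropy_of F mu K \<le> ks_entropy B T"
    if "finite F" "\<And>f. f \<in> F \<Longrightarrow> f \<in> unit_functions past_sp" for F
  proof (rule ereal_le_epsilon2)
    fix d :: real assume d: "0 < d"
    \<comment> \<open>For a fixed family the slope vanishes as the rounding is refined;
      \<open>m\<close> is chosen only after \<open>n\<close> has gone to infinity, so
      \<open>ln (m + 1)\<close> and \<open>k0\<close> do no harm.\<close>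
    have "(\<lambda>m. real (card F) * (2 * sqrt (2 / real m))) \<longlonglongrightarrow> real (card F) * (2 * sqrt 0)"
      by (intro tendsto_intros lim_const_over_n)
    then have "\<forall>\<^sub>F m in sequentially. real (card F) * (2 * sqrt (2 / real m)) < d \<and> 0 < m"
      using d by (intro eventually_conj order_tendstoD(2) eventually_gt_at_top) auto
    then obtain m where m: "real (card F) * (2 * sqrt (2 / real m)) < d" "0 < m"
      by (auto dest: eventually_happens)
    have "operator_entropy_of F mu K \<le> ks_entropy B T + ereal (real (card F) * (2 * sqrt (2 / real m)))"
      by (rule operator_entropy_of_past_le[OF that m(2)])
    also have "\<dots> \<le> ks_entropy B T + ereal d"
      using m(1) by (intro add_left_mono) simp
    finally show "operator_entropy_of F mu K \<le> ks_entropy B T + ereal d" .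
  qed
  then show ?thesis
    unfolding operator_entropy_def by (intro SUP_least) auto
qed

end

theorem theorem1:
  fixes M :: "'a measure" and P :: "'a \<Rightarrow> 'a measure"
    and N :: "(int \<Rightarrow> 'a) measure"
    and B :: "'b measure" and T :: "'b \<Rightarrow> 'b" and \<phi> :: "(int \<Rightarrow> 'a) \<Rightarrow> 'b"
  assumes "random_pp_system M P"
    and "path_space_measure M P N"
    and "backwards_tail_boundary M N B T \<phi>"
  shows "operator_entropy M P = operator_entropy (past_measure M N) (past_kernel M P) \<and>
         operator_entropy (past_measure M N) (past_kernel M P) = ks_entropy B T"
proof -
  interpret tail_boundary M P N B T \<phi>
    using assms by unfold_locales
  show ?thesis
    using operator_entropy_le_past operator_entropy_past_le ks_entropy_le by (meson antisym order_trans)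
qed

end
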